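(* Let $\mathcal{C}$ be a semi-abelian category. Let $P$ be a projective object of $\mathcal{C}$ and let $$0\to Q \xrightarrow{\ \partial'\ } Z \underset{s}{\overset{p}{\rightleftarrows}} P\to 0$$ be a split extension of $P$ (that is, $\partial'=\ker p$ and $ps=1_P$) which is a projective object of the category $\mathsf{SSE}_P(\mathcal{C})$ of split extensions over $P$. Then the kernel $\partial'\colon Q\to Z$, endowed with its natural internal crossed module structure $(Q,Z,\overline{\chi},\partial')$, is a projective object of $\mathsf{XMod}(\mathcal{C})$.
   Context: A semi-abelian category is a pointed, Barr exact, Bourn protomodular category with binary coproducts. Projective means projective with respect to regular epimorphisms. $\langle f,g\rangle$ denotes the morphism induced on a binary coproduct. Split extensions: $\mathsf{SSE}_B(\mathcal{C})$ is the category whose objects are split extensions over the fixed object $B$, i.e. diagrams $0\to X\xrightarrow{k}E\underset{s}{\overset{p}{\rightleftarrows}}B\to 0$ with $ps=1_B$ and $k=\ker p$; a morphism is a pair $(f\colon X\to X', g\colon E\to E')$ with $gk=k'f$, $p'g=p$, $gs=s'$ (identity on $B$). Cosmash products: $h_{A,B}\colon A\diamond B\to A+B$ is the kernel of the canonical morphism $\Sigma_{A,B}\colon A+B\to A\times B$ with components $\langle 1_A,0\rangle$ and $\langle 0,1_B\rangle$. $h_{A,B,C}\colon A\diamond B\diamond C\to A+B+C$ is the kernel of the canonical morphism $\Sigma_{A,B,C}\colon A+B+C\to (A+B)\times(A+C)\times(B+C)$ whose three components send respectively $C$, $B$, $A$ to $0$ and are the coproduct injections on the other summands. Both constructions are functorial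 (written $f\diamond g$, $f\diamond g\diamond l$) by restricting $f+g$, $f+g+l$ to the kernels. $S_{2,1}^{A,B}\colon A\diamond A\diamond B\to A\diamond B$ and $S_{1,2}^{A,B}\colon A\diamond B\diamond B\to A\diamond B$ are the unique morphisms with $h_{A,B}S_{2,1}^{A,B}=(\langle 1_A,1_A\rangle+1_B)h_{A,A,B}$ and $h_{A,B}S_{1,2}^{A,B}=(1_A+\langle 1_B,1_B\rangle)h_{A,B,B}$. Action cores: the action core associated to a split extension $0\to X\xrightarrow{k}E\underset{s}{\overset{p}{\rightleftarrows}}A\to 0$ is the unique $\psi\colon A\diamond X\to X$ with $k\psi=\langle s,k\rangle h_{A,X}$. The conjugation action core is $\overline{\chi_A}=\langle 1_A,1_A\rangle h_{A,A}\colon A\diamond A\to A$. Internal crossed modules: an internal crossed module $(X,A,\psi,\partial)$ consists of a morphism $\partial\colon X\to A$ and an action core $\psi\colon A\diamond X\to X$ (associated to some split extension) such that (1) $\partial\psi=\overline{\chi_A}(1_A\diamond\partial)$; (2) $\psi(\partial\diamond 1_X)=\overline{\chi_X}$; (3) $\psi S_{1,2}^{A,X}=\psi S_{2,1}^{A,X}(1_A\diamond\partial\diamond 1_X)$. A morphism $(X,A,\psi,\partial)\to(X',A',\psi',\partial')$ is a pair $(f_X\colon X\to X',f_A\colon A\to A')$ with $f_A\partial=\partial'f_X$ and $f_X\psi=\psi'(f_A\diamond f_X)$. These form the category $\mathsf{XMod}(\mathcal{C})$. Natural structure on kernels: if $k\colon Y\to X$ is a kernel, there is a unique $\overline{\chi}\colon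 X\diamond Y\to Y$ with $k\overline{\chi}=\overline{\chi_X}(1_X\diamond k)$, and $(Y,X,\overline{\chi},k)$ is an internal crossed module. *)

theory Defs
  imports Main
begin

section \<open>Categories\<close>

record ('o, 'm) cat =
  Obj :: "'o set"
  Arr :: "'m set"
  Dom :: "'m \<Rightarrow> 'o"
  Cod :: "'m \<Rightarrow> 'o"
  Id :: "'o \<Rightarrow> 'm"  (\<open>\<one>\<index>_\<close> [91] 90)
  Comp :: "'m \<Rightarrow> 'm \<Rightarrow> 'm"  (infixr \<open>\<cdot>\<index>\<close> 70)

definition Hom :: "('o, 'm) cat \<Rightarrow> 'o \<Rightarrow> 'o \<Rightarrow> 'm set"
  where "Hom C a b = {f \<in> Arr C. Dom C f = a \<and> Cod C f = b}"

locale category =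
  fixes C :: "('o, 'm) cat"  (structure)
  assumes Dom_Obj: "f \<in> Arr C \<Longrightarrow> Dom C f \<in> Obj C"
    and Cod_Obj: "f \<in> Arr C \<Longrightarrow> Cod C f \<in> Obj C"
    and Id_Hom: "a \<in> Obj C \<Longrightarrow> \<one>a \<in> Hom C a a"
    and Comp_Hom: "f \<in> Hom C a b \<Longrightarrow> g \<in> Hom C b c \<Longrightarrow> g \<cdot> f \<in> Hom C a c"
    and Id_left: "f \<in> Hom C a b \<Longrightarrow> \<one>b \<cdot> f = f"
    and Id_right: "f \<in> Hom C a b \<Longrightarrow> f \<cdot> \<one>a = f"
    and Comp_assoc: "f \<in> Hom C a b \<Longrightarrow> g \<in> Hom C b c \<Longrightarrow> h \<in> Hom C c d \<Longrightarrow>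
      (h \<cdot> g) \<cdot> f = h \<cdot> (g \<cdot> f)"

definition is_iso :: "('o, 'm) cat \<Rightarrow> 'm \<Rightarrow> bool"
  where "is_iso C f \<longleftrightarrow> f \<in> Arr C \<and>
    (\<exists>g \<in> Hom C (Cod C f) (Dom C f). g \<cdot> f = \<one>(Dom C f) \<and> f \<cdot> g = \<one>(Cod C f))"
  for C (structure)

definition is_coequalizer :: "('o, 'm) cat \<Rightarrow> 'm \<Rightarrow> 'm \<Rightarrow> 'm \<Rightarrow> bool"
  where "is_coequalizer C f g e \<longleftrightarrow>
    f \<in> Arr C \<and> g \<in> Hom C (Dom C f) (Cod C f) \<and> e \<in> Arr C \<and> Dom C e = Cod C f \<and>
    e \<cdot> f = e \<cdot> g \<and>
    (\<forall>d \<in> Arr C. Dom C d = Cod C f \<and> d \<cdot> f = d \<cdot> g \<longrightarrow>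
      (\<exists>!u. u \<in> Hom C (Cod C e) (Cod C d) \<and> u \<cdot> e = d))"
  for C (structure)

definition regular_epi :: "('o, 'm) cat \<Rightarrow> 'm \<Rightarrow> bool"
  where "regular_epi C e \<longleftrightarrow> (\<exists>f g. is_coequalizer C f g e)"

definition projective :: "('o, 'm) cat \<Rightarrow> 'o \<Rightarrow> bool"
  where "projective C P \<longleftrightarrow> P \<in> Obj C \<and>
    (\<forall>e f. regular_epi C e \<and> f \<in> Hom C P (Cod C e) \<longrightarrow>
      (\<exists>g \<in> Hom C P (Dom C e). e \<cdot> g = f))"
  for C (structure)


section \<open>Finite limits and binary coproducts\<close>

text \<open>
  A finite diagram consists of objects \<open>D 0, \<dots>, D (n - 1)\<close> and a finite set of edges; an edge
  \<open>(i, j, f)\<close> is an arrow \<open>f\<close> from \<open>D i\<close> to \<open>D j\<close>.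
\<close>

definition finite_diagram :: "('o, 'm) cat \<Rightarrow> nat \<Rightarrow> (nat \<Rightarrow> 'o) \<Rightarrow> (nat \<times> nat \<times> 'm) set \<Rightarrow> bool"
  where "finite_diagram C n D E \<longleftrightarrow> (\<forall>i<n. D i \<in> Obj C) \<and> finite E \<and>
    (\<forall>(i, j, f) \<in> E. i < n \<and> j < n \<and> f \<in> Hom C (D i) (D j))"

definition is_cone ::
    "('o, 'm) cat \<Rightarrow> nat \<Rightarrow> (nat \<Rightarrow> 'o) \<Rightarrow> (nat \<times> nat \<times> 'm) set \<Rightarrow> 'o \<Rightarrow> (nat \<Rightarrow> 'm) \<Rightarrow> bool"
  where "is_cone C n D E L \<pi> \<longleftrightarrow> L \<in> Obj C \<and> (\<forall>i<n. \<pi> i \<in> Hom C L (D i)) \<and>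
    (\<forall>(i, j, f) \<in> E. f \<cdot> \<pi> i = \<pi> j)"
  for C (structure)

definition is_limit ::
    "('o, 'm) cat \<Rightarrow> nat \<Rightarrow> (nat \<Rightarrow> 'o) \<Rightarrow> (nat \<times> nat \<times> 'm) set \<Rightarrow> 'o \<Rightarrow> (nat \<Rightarrow> 'm) \<Rightarrow> bool"
  where "is_limit C n D E L \<pi> \<longleftrightarrow> is_cone C n D E L \<pi> \<and>
    (\<forall>M \<rho>. is_cone C n D E M \<rho> \<longrightarrow> (\<exists>!u. u \<in> Hom C M L \<and> (\<forall>i<n. \<pi> i \<cdot> u = \<rho> i)))"
  for C (structure)

definition finitely_complete :: "('o, 'm) cat \<Rightarrow> bool"
  where "finitely_complete C \<longleftrightarrow>
    (\<forall>n D E. finite_diagram C n D E \<longrightarrow> (\<exists>L \<pi>. is_limit C n D E L \<pi>))"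

definition is_product :: "('o, 'm) cat \<Rightarrow> 'o \<Rightarrow> 'o \<Rightarrow> 'm \<Rightarrow> 'm \<Rightarrow> bool"
  where "is_product C a b p q \<longleftrightarrow>
    p \<in> Arr C \<and> q \<in> Arr C \<and> Dom C p = Dom C q \<and> Cod C p = a \<and> Cod C q = b \<and>
    (\<forall>c. \<forall>f \<in> Hom C c a. \<forall>g \<in> Hom C c b.
      \<exists>!u. u \<in> Hom C c (Dom C p) \<and> p \<cdot> u = f \<and> q \<cdot> u = g)"
  for C (structure)

definition is_coproduct :: "('o, 'm) cat \<Rightarrow> 'o \<Rightarrow> 'o \<Rightarrow> 'm \<Rightarrow> 'm \<Rightarrow> bool"
  where "is_coproduct C a b i j \<longleftrightarrow>
    i \<in> Arr C \<and> j \<in> Arr C \<and> Cod C i = Cod C j \<and> Dom C i = a \<and> Dom C j = b \<and>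
    (\<forall>c. \<forall>f \<in> Hom C a c. \<forall>g \<in> Hom C b c.
      \<exists>!u. u \<in> Hom C (Cod C i) c \<and> u \<cdot> i = f \<and> u \<cdot> j = g)"
  for C (structure)

definition has_binary_coproducts :: "('o, 'm) cat \<Rightarrow> bool"
  where "has_binary_coproducts C \<longleftrightarrow>
    (\<forall>a \<in> Obj C. \<forall>b \<in> Obj C. \<exists>i j. is_coproduct C a b i j)"

text \<open>The square \<open>f \<cdot> p = g \<cdot> q\<close> is a pullback.\<close>

definition is_pullback :: "('o, 'm) cat \<Rightarrow> 'm \<Rightarrow> 'm \<Rightarrow> 'm \<Rightarrow> 'm \<Rightarrow> bool"
  where "is_pullback C f g p q \<longleftrightarrow>
    f \<in> Arr C \<and> g \<in> Arr C \<and> Cod C f = Cod C g \<and>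
    p \<in> Arr C \<and> q \<in> Arr C \<and> Dom C p = Dom C q \<and> Cod C p = Dom C f \<and> Cod C q = Dom C g \<and>
    f \<cdot> p = g \<cdot> q \<and>
    (\<forall>t. \<forall>x \<in> Hom C t (Dom C f). \<forall>y \<in> Hom C t (Dom C g). f \<cdot> x = g \<cdot> y \<longrightarrow>
      (\<exists>!u. u \<in> Hom C t (Dom C p) \<and> p \<cdot> u = x \<and> q \<cdot> u = y))"
  for C (structure)


section \<open>Barr exact categories\<close>

definition is_kernel_pair :: "('o, 'm) cat \<Rightarrow> 'm \<Rightarrow> 'm \<Rightarrow> 'm \<Rightarrow> bool"
  where "is_kernel_pair C f r\<^sub>1 r\<^sub>2 \<longleftrightarrow> is_pullback C f f r\<^sub>1 r\<^sub>2"

definition regular_category :: "('o, 'm) cat \<Rightarrow> bool"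
  where "regular_category C \<longleftrightarrow> finitely_complete C \<and>
    (\<forall>f r\<^sub>1 r\<^sub>2. is_kernel_pair C f r\<^sub>1 r\<^sub>2 \<longrightarrow> (\<exists>e. is_coequalizer C r\<^sub>1 r\<^sub>2 e)) \<and>
    (\<forall>f g p q. is_pullback C f g p q \<and> regular_epi C f \<longrightarrow> regular_epi C q)"

text \<open>
  Internal equivalence relations are expressed by generalized elements: the jointly monic pair
  \<open>r\<^sub>1, r\<^sub>2\<close> from \<open>R\<close> to \<open>a\<close> induces an equivalence relation on \<open>Hom(t, a)\<close> for each \<open>t\<close>.
\<close>

definition internal_equivalence :: "('o, 'm) cat \<Rightarrow> 'm \<Rightarrow> 'm \<Rightarrow> bool"
  where "internal_equivalence C r\<^sub>1 r\<^sub>2 \<longleftrightarrow>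
    r\<^sub>1 \<in> Arr C \<and> r\<^sub>2 \<in> Hom C (Dom C r\<^sub>1) (Cod C r\<^sub>1) \<and>
    (\<forall>t. \<forall>u \<in> Hom C t (Dom C r\<^sub>1). \<forall>v \<in> Hom C t (Dom C r\<^sub>1).
      r\<^sub>1 \<cdot> u = r\<^sub>1 \<cdot> v \<and> r\<^sub>2 \<cdot> u = r\<^sub>2 \<cdot> v \<longrightarrow> u = v) \<and>
    (\<forall>t \<in> Obj C. equiv (Hom C t (Cod C r\<^sub>1)) {(r\<^sub>1 \<cdot> u, r\<^sub>2 \<cdot> u) |u. u \<in> Hom C t (Dom C r\<^sub>1)})"
  for C (structure)

definition barr_exact :: "('o, 'm) cat \<Rightarrow> bool"
  where "barr_exact C \<longleftrightarrow> regular_category C \<and>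
    (\<forall>r\<^sub>1 r\<^sub>2. internal_equivalence C r\<^sub>1 r\<^sub>2 \<longrightarrow> (\<exists>f. is_kernel_pair C f r\<^sub>1 r\<^sub>2))"


section \<open>Bourn protomodular categories\<close>

text \<open>
  A point over \<open>B\<close> is a triple \<open>(E, p, s)\<close> with \<open>p \<cdot> s = \<one>B\<close>. Here and in the categories of split
  extensions and of crossed modules below, an arrow carries its source and target as its first and
  last components.
\<close>

definition Pt :: "('o, 'm) cat \<Rightarrow> 'o \<Rightarrow>
    ('o \<times> 'm \<times> 'm, ('o \<times> 'm \<times> 'm) \<times> 'm \<times> ('o \<times> 'm \<times> 'm)) cat"
  where "Pt C B =
    (let Ob = {(E, p, s). p \<in> Hom C E B \<and> s \<in> Hom C B E \<and> p \<cdot> s = \<one>B} in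
    \<lparr> Obj = Ob,
      Arr = {((E, p, s), g, (E', p', s')) |E p s g E' p' s'.
        (E, p, s) \<in> Ob \<and> (E', p', s') \<in> Ob \<and> g \<in> Hom C E E' \<and> p' \<cdot> g = p \<and> g \<cdot> s = s'},
      Dom = (\<lambda>(x, g, y). x),
      Cod = (\<lambda>(x, g, y). y),
      Id = (\<lambda>(E, p, s). ((E, p, s), \<one>E, (E, p, s))),
      Comp = (\<lambda>(y, g', z) (x, g, y'). (x, g' \<cdot> g, z)) \<rparr>)"
  for C (structure)

text \<open>The point \<open>(D, q, t)\<close> is the pullback of the point \<open>(E, p, s)\<close> along \<open>v\<close>.\<close>

definition is_base_change ::
    "('o, 'm) cat \<Rightarrow> 'm \<Rightarrow> 'o \<times> 'm \<times> 'm \<Rightarrow> 'o \<times> 'm \<times> 'm \<Rightarrow> 'm \<Rightarrow> bool"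
  where "is_base_change C v = (\<lambda>(E, p, s) (D, q, t) e.
    (E, p, s) \<in> Obj (Pt C (Cod C v)) \<and> (D, q, t) \<in> Obj (Pt C (Dom C v)) \<and>
    is_pullback C p v e q \<and> e \<in> Hom C D E \<and> e \<cdot> t = s \<cdot> v)"
  for C (structure)

text \<open>
  All change-of-base functors of the fibration of points reflect isomorphisms; \<open>h\<close> is the image
  of \<open>g\<close> under change of base along \<open>v\<close>.
\<close>

definition protomodular :: "('o, 'm) cat \<Rightarrow> bool"
  where "protomodular C \<longleftrightarrow>
    (\<forall>v \<in> Arr C. \<forall>x y e x' y' e' g h.
      is_base_change C v x y e \<and> is_base_change C v x' y' e' \<and>
      (x, g, x') \<in> Arr (Pt C (Cod C v)) \<and> (y, h, y') \<in> Arr (Pt C (Dom C v)) \<and>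
      e' \<cdot> h = g \<cdot> e \<and> is_iso (Pt C (Dom C v)) (y, h, y') \<longrightarrow>
      is_iso (Pt C (Cod C v)) (x, g, x'))"
  for C (structure)


section \<open>Semi-abelian categories\<close>

definition zero_object :: "('o, 'm) cat \<Rightarrow> 'o \<Rightarrow> bool"
  where "zero_object C z \<longleftrightarrow> z \<in> Obj C \<and>
    (\<forall>a \<in> Obj C. (\<exists>!f. f \<in> Hom C a z) \<and> (\<exists>!f. f \<in> Hom C z a))"

definition pointed :: "('o, 'm) cat \<Rightarrow> bool"
  where "pointed C \<longleftrightarrow> (\<exists>z. zero_object C z)"

locale semi_abelian = category +
  assumes pointed: "pointed C"
    and barr_exact: "barr_exact C"
    and protomodular: "protomodular C"
    and binary_coproducts: "has_binary_coproducts C"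

definition zero_arr :: "('o, 'm) cat \<Rightarrow> 'o \<Rightarrow> 'o \<Rightarrow> 'm"  (\<open>\<zero>\<index>\<close>)
  where "zero_arr C a b =
    (THE f. \<exists>z. zero_object C z \<and> (\<exists>u \<in> Hom C a z. \<exists>v \<in> Hom C z b. f = v \<cdot> u))"
  for C (structure)

definition is_kernel :: "('o, 'm) cat \<Rightarrow> 'm \<Rightarrow> 'm \<Rightarrow> bool"
  where "is_kernel C k f \<longleftrightarrow>
    f \<in> Arr C \<and> k \<in> Arr C \<and> Cod C k = Dom C f \<and> f \<cdot> k = \<zero> (Dom C k) (Cod C f) \<and>
    (\<forall>t. \<forall>x \<in> Hom C t (Dom C f). f \<cdot> x = \<zero> t (Cod C f) \<longrightarrow>
      (\<exists>!u. u \<in> Hom C t (Dom C k) \<and> k \<cdot> u = x))"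
  for C (structure)


section \<open>Split extensions over a fixed object\<close>

text \<open>The split extension with kernel \<open>k\<close> from \<open>X\<close> to \<open>E\<close> is the tuple \<open>(X, E, k, p, s)\<close>.\<close>

type_synonym ('o, 'm) split_ext = "'o \<times> 'o \<times> 'm \<times> 'm \<times> 'm"

definition split_extensions :: "('o, 'm) cat \<Rightarrow> 'o \<Rightarrow> ('o, 'm) split_ext set"
  where "split_extensions C B = {(X, E, k, p, s).
    k \<in> Hom C X E \<and> p \<in> Hom C E B \<and> s \<in> Hom C B E \<and> p \<cdot> s = \<one>B \<and> is_kernel C k p}"
  for C (structure)

definition SSE :: "('o, 'm) cat \<Rightarrow> 'o \<Rightarrow>
    (('o, 'm) split_ext, ('o, 'm) split_ext \<times> ('m \<times> 'm) \<times> ('o, 'm) split_ext) cat"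
  where "SSE C B =
    \<lparr> Obj = split_extensions C B,
      Arr = {((X, E, k, p, s), (f, g), (X', E', k', p', s')) |X E k p s f g X' E' k' p' s'.
        (X, E, k, p, s) \<in> split_extensions C B \<and> (X', E', k', p', s') \<in> split_extensions C B \<and>
        f \<in> Hom C X X' \<and> g \<in> Hom C E E' \<and> g \<cdot> k = k' \<cdot> f \<and> p' \<cdot> g = p \<and> g \<cdot> s = s'},
      Dom = (\<lambda>(x, fg, y). x),
      Cod = (\<lambda>(x, fg, y). y),
      Id = (\<lambda>(X, E, k, p, s). ((X, E, k, p, s), (\<one>X, \<one>E), (X, E, k, p, s))),
      Comp = (\<lambda>(y, (f', g'), z) (x, (f, g), y'). (x, (f' \<cdot> f, g' \<cdot> g), z)) \<rparr>"
  for C (structure)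


section \<open>Chosen products and coproducts\<close>

text \<open>
  Universal objects are chosen arbitrarily by Hilbert choice. Threefold coproducts and products
  are bracketed to the left.
\<close>

definition projs :: "('o, 'm) cat \<Rightarrow> 'o \<Rightarrow> 'o \<Rightarrow> 'm \<times> 'm"
  where "projs C a b = (SOME (p, q). is_product C a b p q)"

definition prod_obj :: "('o, 'm) cat \<Rightarrow> 'o \<Rightarrow> 'o \<Rightarrow> 'o"  (infixl \<open>\<otimes>\<index>\<close> 75)
  where "prod_obj C a b = Dom C (fst (projs C a b))"

definition tuple :: "('o, 'm) cat \<Rightarrow> 'm \<Rightarrow> 'm \<Rightarrow> 'm"
  where "tuple C f g = (THE u. u \<in> Hom C (Dom C f) (Cod C f \<otimes> Cod C g) \<and>
    fst (projs C (Cod C f) (Cod C g)) \<cdot> u = f \<and> snd (projs C (Cod C f) (Cod C g)) \<cdot> u = g)"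
  for C (structure)

definition injs :: "('o, 'm) cat \<Rightarrow> 'o \<Rightarrow> 'o \<Rightarrow> 'm \<times> 'm"
  where "injs C a b = (SOME (i, j). is_coproduct C a b i j)"

definition in\<^sub>1 :: "('o, 'm) cat \<Rightarrow> 'o \<Rightarrow> 'o \<Rightarrow> 'm"
  where "in\<^sub>1 C a b = fst (injs C a b)"

definition in\<^sub>2 :: "('o, 'm) cat \<Rightarrow> 'o \<Rightarrow> 'o \<Rightarrow> 'm"
  where "in\<^sub>2 C a b = snd (injs C a b)"

definition coprod_obj :: "('o, 'm) cat \<Rightarrow> 'o \<Rightarrow> 'o \<Rightarrow> 'o"  (infixl \<open>\<oplus>\<index>\<close> 75)
  where "coprod_obj C a b = Cod C (in\<^sub>1 C a b)"

definition cotuple :: "('o, 'm) cat \<Rightarrow> 'm \<Rightarrow> 'm \<Rightarrow> 'm"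
  where "cotuple C f g = (THE u. u \<in> Hom C (Dom C f \<oplus> Dom C g) (Cod C f) \<and>
    u \<cdot> in\<^sub>1 C (Dom C f) (Dom C g) = f \<and> u \<cdot> in\<^sub>2 C (Dom C f) (Dom C g) = g)"
  for C (structure)

definition coprod_map :: "('o, 'm) cat \<Rightarrow> 'm \<Rightarrow> 'm \<Rightarrow> 'm"
  where "coprod_map C f g = cotuple C
    (in\<^sub>1 C (Cod C f) (Cod C g) \<cdot> f) (in\<^sub>2 C (Cod C f) (Cod C g) \<cdot> g)"
  for C (structure)

definition tuple3 :: "('o, 'm) cat \<Rightarrow> 'm \<Rightarrow> 'm \<Rightarrow> 'm \<Rightarrow> 'm"
  where "tuple3 C f g l = tuple C (tuple C f g) l"

definition cotuple3 :: "('o, 'm) cat \<Rightarrow> 'm \<Rightarrow> 'm \<Rightarrow> 'm \<Rightarrow> 'm"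
  where "cotuple3 C f g l = cotuple C (cotuple C f g) l"

definition coprod_map3 :: "('o, 'm) cat \<Rightarrow> 'm \<Rightarrow> 'm \<Rightarrow> 'm \<Rightarrow> 'm"
  where "coprod_map3 C f g l = coprod_map C (coprod_map C f g) l"


section \<open>Cosmash products\<close>

definition \<Sigma>\<^sub>2 :: "('o, 'm) cat \<Rightarrow> 'o \<Rightarrow> 'o \<Rightarrow> 'm"
  where "\<Sigma>\<^sub>2 C a b = tuple C (cotuple C (\<one>a) (\<zero> b a)) (cotuple C (\<zero> a b) (\<one>b))"
  for C (structure)

definition \<Sigma>\<^sub>3 :: "('o, 'm) cat \<Rightarrow> 'o \<Rightarrow> 'o \<Rightarrow> 'o \<Rightarrow> 'm"
  where "\<Sigma>\<^sub>3 C a b c = tuple3 C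
    (cotuple3 C (in\<^sub>1 C a b) (in\<^sub>2 C a b) (\<zero> c (a \<oplus> b)))
    (cotuple3 C (in\<^sub>1 C a c) (\<zero> b (a \<oplus> c)) (in\<^sub>2 C a c))
    (cotuple3 C (\<zero> a (b \<oplus> c)) (in\<^sub>1 C b c) (in\<^sub>2 C b c))"
  for C (structure)

definition h\<^sub>2 :: "('o, 'm) cat \<Rightarrow> 'o \<Rightarrow> 'o \<Rightarrow> 'm"
  where "h\<^sub>2 C a b = (SOME h. is_kernel C h (\<Sigma>\<^sub>2 C a b))"

definition h\<^sub>3 :: "('o, 'm) cat \<Rightarrow> 'o \<Rightarrow> 'o \<Rightarrow> 'o \<Rightarrow> 'm"
  where "h\<^sub>3 C a b c = (SOME h. is_kernel C h (\<Sigma>\<^sub>3 C a b c))"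

definition cosmash :: "('o, 'm) cat \<Rightarrow> 'o \<Rightarrow> 'o \<Rightarrow> 'o"  (infix \<open>\<diamond>\<index>\<close> 75)
  where "cosmash C a b = Dom C (h\<^sub>2 C a b)"

definition cosmash3 :: "('o, 'm) cat \<Rightarrow> 'o \<Rightarrow> 'o \<Rightarrow> 'o \<Rightarrow> 'o"
  where "cosmash3 C a b c = Dom C (h\<^sub>3 C a b c)"

definition cosmash_map :: "('o, 'm) cat \<Rightarrow> 'm \<Rightarrow> 'm \<Rightarrow> 'm"
  where "cosmash_map C f g =
    (THE u. u \<in> Hom C (Dom C f \<diamond> Dom C g) (Cod C f \<diamond> Cod C g) \<and>
      h\<^sub>2 C (Cod C f) (Cod C g) \<cdot> u = coprod_map C f g \<cdot> h\<^sub>2 C (Dom C f) (Dom C g))"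
  for C (structure)

definition cosmash_map3 :: "('o, 'm) cat \<Rightarrow> 'm \<Rightarrow> 'm \<Rightarrow> 'm \<Rightarrow> 'm"
  where "cosmash_map3 C f g l =
    (THE u. u \<in> Hom C (cosmash3 C (Dom C f) (Dom C g) (Dom C l))
                      (cosmash3 C (Cod C f) (Cod C g) (Cod C l)) \<and>
      h\<^sub>3 C (Cod C f) (Cod C g) (Cod C l) \<cdot> u =
        coprod_map3 C f g l \<cdot> h\<^sub>3 C (Dom C f) (Dom C g) (Dom C l))"
  for C (structure)

definition S\<^sub>2\<^sub>1 :: "('o, 'm) cat \<Rightarrow> 'o \<Rightarrow> 'o \<Rightarrow> 'm"
  where "S\<^sub>2\<^sub>1 C a b = (THE u. u \<in> Hom C (cosmash3 C a a b) (a \<diamond> b) \<and>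
    h\<^sub>2 C a b \<cdot> u = coprod_map C (cotuple C (\<one>a) (\<one>a)) (\<one>b) \<cdot> h\<^sub>3 C a a b)"
  for C (structure)

text \<open>
  The arrow \<open>\<one>a + \<langle>\<one>b, \<one>b\<rangle>\<close> has domain \<open>a \<oplus> (b \<oplus> b)\<close>; on the left-bracketed coproduct it is the
  cotuple with components \<open>in\<^sub>1, in\<^sub>2, in\<^sub>2\<close>.
\<close>

definition S\<^sub>1\<^sub>2 :: "('o, 'm) cat \<Rightarrow> 'o \<Rightarrow> 'o \<Rightarrow> 'm"
  where "S\<^sub>1\<^sub>2 C a b = (THE u. u \<in> Hom C (cosmash3 C a b b) (a \<diamond> b) \<and>
    h\<^sub>2 C a b \<cdot> u = cotuple3 C (in\<^sub>1 C a b) (in\<^sub>2 C a b) (in\<^sub>2 C a b) \<cdot> h\<^sub>3 C a b b)"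
  for C (structure)


section \<open>Action cores and internal crossed modules\<close>

definition is_action_core :: "('o, 'm) cat \<Rightarrow> 'o \<Rightarrow> 'o \<Rightarrow> 'm \<Rightarrow> bool"
  where "is_action_core C A X \<psi> \<longleftrightarrow> \<psi> \<in> Hom C (A \<diamond> X) X \<and>
    (\<exists>E k p s. (X, E, k, p, s) \<in> split_extensions C A \<and> k \<cdot> \<psi> = cotuple C s k \<cdot> h\<^sub>2 C A X)"
  for C (structure)

definition conjugation_core :: "('o, 'm) cat \<Rightarrow> 'o \<Rightarrow> 'm"
  where "conjugation_core C A = cotuple C (\<one>A) (\<one>A) \<cdot> h\<^sub>2 C A A"
  for C (structure)

type_synonym ('o, 'm) xmod = "'o \<times> 'o \<times> 'm \<times> 'm"

definition crossed_modules :: "('o, 'm) cat \<Rightarrow> ('o, 'm) xmod set"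
  where "crossed_modules C = {(X, A, \<psi>, d).
    d \<in> Hom C X A \<and> is_action_core C A X \<psi> \<and>
    d \<cdot> \<psi> = conjugation_core C A \<cdot> cosmash_map C (\<one>A) d \<and>
    \<psi> \<cdot> cosmash_map C d (\<one>X) = conjugation_core C X \<and>
    \<psi> \<cdot> S\<^sub>1\<^sub>2 C A X = \<psi> \<cdot> S\<^sub>2\<^sub>1 C A X \<cdot> cosmash_map3 C (\<one>A) d (\<one>X)}"
  for C (structure)

definition XMod :: "('o, 'm) cat \<Rightarrow>
    (('o, 'm) xmod, ('o, 'm) xmod \<times> ('m \<times> 'm) \<times> ('o, 'm) xmod) cat"
  where "XMod C =
    \<lparr> Obj = crossed_modules C,
      Arr = {((X, A, \<psi>, d), (f, g), (X', A', \<psi>', d')) |X A \<psi> d f g X' A' \<psi>' d'.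
        (X, A, \<psi>, d) \<in> crossed_modules C \<and> (X', A', \<psi>', d') \<in> crossed_modules C \<and>
        f \<in> Hom C X X' \<and> g \<in> Hom C A A' \<and>
        g \<cdot> d = d' \<cdot> f \<and> f \<cdot> \<psi> = \<psi>' \<cdot> cosmash_map C g f},
      Dom = (\<lambda>(x, fg, y). x),
      Cod = (\<lambda>(x, fg, y). y),
      Id = (\<lambda>(X, A, \<psi>, d). ((X, A, \<psi>, d), (\<one>X, \<one>A), (X, A, \<psi>, d))),
      Comp = (\<lambda>(y, (f', g'), z) (x, (f, g), y'). (x, (f' \<cdot> f, g' \<cdot> g), z)) \<rparr>"
  for C (structure)

text \<open>Meaningful when \<open>k\<close> is a kernel: the conjugation action of its codomain on its domain.\<close>

definition kernel_core :: "('o, 'm) cat \<Rightarrow> 'm \<Rightarrow> 'm"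
  where "kernel_core C k = (THE \<chi>. \<chi> \<in> Hom C (Cod C k \<diamond> Dom C k) (Dom C k) \<and>
    k \<cdot> \<chi> = conjugation_core C (Cod C k) \<cdot> cosmash_map C (\<one>(Cod C k)) k)"
  for C (structure)

end

theory Submission
  imports Defs
begin

text \<open>The action core of an internal crossed module with boundary \<open>d\<close> from \<open>X\<close> to \<open>A\<close> belongs to a split
  extension of \<open>A\<close> by \<open>X\<close> with middle object \<open>E\<close>, the semidirect product. There is a second
  arrow \<open>c\<close> from \<open>E\<close> to \<open>A\<close>, equal to \<open>\<one>A\<close> on \<open>A\<close> and to \<open>d\<close> on \<open>X\<close>
  (\<open>crossed_module_universal\<close>). Let a regular epimorphism \<open>(e1, e2)\<close> of crossed modules from \<open>(X, A)\<close>
  to \<open>(X', A')\<close> be given, and an arrow \<open>(f1, f2)\<close> from \<open>(Q, Z)\<close> to \<open>(X', A')\<close>. Then \<open>e1\<close> and \<open>e2\<close> are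
  regular epimorphisms of the base category (\<open>regular_epi_XMod\<close>), so \<open>f2 \<cdot> s\<close> lifts to an arrow \<open>g0\<close>
  from \<open>P\<close> to \<open>A\<close>, because \<open>P\<close> is projective. Pulling back the semidirect products of the two crossed
  modules along \<open>g0\<close> and \<open>f2 \<cdot> s\<close> gives split extensions over \<open>P\<close>, and \<open>(e1, e2)\<close> induces a regular
  epimorphism between these (\<open>regular_epi_SSE\<close>). The arrow \<open>(f1, f2)\<close> induces an arrow from the given
  split extension \<open>Q \<rightarrow> Z \<rightarrow> P\<close> to the second one. By projectivity it lifts to the first one; this
  yields \<open>g1\<close> from \<open>Q\<close> to \<open>X\<close> and, by composition with \<open>c\<close>, an arrow \<open>g2\<close> from \<open>Z\<close> to \<open>A\<close>.

  It remains to see that \<open>(g1, g2)\<close> respects the actions. By construction \<open>g1\<close> respects the actions of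
  \<open>P\<close>, and it respects the actions of \<open>Q\<close> by the second axiom of crossed modules. Now \<open>Z\<close> is a
  regular quotient of \<open>P \<oplus> Q\<close>, but two arrows out of \<open>(P \<oplus> Q) \<diamond> Q\<close> that agree on \<open>P \<diamond> Q\<close> and \<open>Q \<diamond> Q\<close>
  need not be equal: generating \<open>(P \<oplus> Q) \<diamond> Q\<close> also takes the threefold cosmash product of \<open>P\<close>, \<open>Q\<close>, \<open>Q\<close>
  (\<open>cosmash_coprod_ext\<close>). There the third axiom, which expresses \<open>S\<^sub>1\<^sub>2\<close> in terms of \<open>S\<^sub>2\<^sub>1\<close>, reduces
  equivariance to the one already known for \<open>P\<close> (\<open>equivariance_extension\<close>).

  Exactness of the ambient category enters as follows. Protomodularity says that in a split extension the
  kernel and the section are jointly extremally epic (\<open>split_extension_extremal\<close>). With regularity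
  it follows that a morphism of split extensions which is a regular epimorphism on middle
  objects is one on kernels (\<open>kernel_map_regular_epi\<close>). This shows that the cosmash product with a fixed object
  preserves regular epimorphisms, and that the image of a morphism of crossed modules, formed on middle objects,
  is a crossed module whose two components are the images of the two components. The latter is why the
  components of a regular epimorphism of crossed modules are regular epimorphisms.\<close>

section \<open>Composition, monic arrows, pullbacks and coequalizers\<close>

definition monic :: "('o, 'm) cat \<Rightarrow> 'm \<Rightarrow> bool"
  where "monic C m \<longleftrightarrow> m \<in> Arr C \<and>
    (\<forall>x \<in> Arr C. \<forall>y \<in> Arr C. Dom C x = Dom C y \<and> Cod C x = Dom C m \<and> Cod C y = Dom C m \<and>
      m \<cdot> x = m \<cdot> y \<longrightarrow> x = y)"
  for C (structure)

context category
begin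

lemma in_Hom [simp]: "f \<in> Hom C a b \<longleftrightarrow> f \<in> Arr C \<and> Dom C f = a \<and> Cod C f = b"
  by (auto simp: Hom_def)

lemma Dom_in_Obj [simp]: "f \<in> Arr C \<Longrightarrow> Dom C f \<in> Obj C"
  by (rule Dom_Obj)

lemma Cod_in_Obj [simp]: "f \<in> Arr C \<Longrightarrow> Cod C f \<in> Obj C"
  by (rule Cod_Obj)

lemma Hom_Obj: "f \<in> Hom C a b \<Longrightarrow> a \<in> Obj C \<and> b \<in> Obj C"
  by auto

lemma Id_typing [simp]:
  assumes "a \<in> Obj C"
  shows "\<one>a \<in> Arr C" "Dom C (\<one>a) = a" "Cod C (\<one>a) = a"
  using Id_Hom[OF assms] by auto

lemma Comp_typing [simp]:
  assumes "g \<in> Arr C" "f \<in> Arr C" "Dom C g = Cod C f"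
  shows "g \<cdot> f \<in> Arr C" "Dom C (g \<cdot> f) = Dom C f" "Cod C (g \<cdot> f) = Cod C g"
  using Comp_Hom[of f "Dom C f" "Cod C f" g "Cod C g"] assms by auto

lemma Id_Comp [simp]: "f \<in> Arr C \<Longrightarrow> Cod C f = b \<Longrightarrow> \<one>b \<cdot> f = f"
  using Id_left[of f "Dom C f" b] by auto

lemma Comp_Id [simp]: "f \<in> Arr C \<Longrightarrow> Dom C f = a \<Longrightarrow> f \<cdot> \<one>a = f"
  using Id_right[of f a "Cod C f"] by auto

lemma assoc [simp]:
  "f \<in> Arr C \<Longrightarrow> g \<in> Arr C \<Longrightarrow> h \<in> Arr C \<Longrightarrow> Dom C g = Cod C f \<Longrightarrow> Dom C h = Cod C g \<Longrightarrow>
    (h \<cdot> g) \<cdot> f = h \<cdot> (g \<cdot> f)"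
  using Comp_assoc[of f "Dom C f" "Cod C f" g "Cod C g" h "Cod C h"] by auto

text \<open>The simplifier brackets composites to the right, so that an equation \<open>g \<cdot> f = h\<close> has to be
  available also in the following form.\<close>

lemma extend:
  "g \<cdot> f = h \<Longrightarrow> g \<in> Arr C \<Longrightarrow> f \<in> Arr C \<Longrightarrow> Dom C g = Cod C f \<Longrightarrow> x \<in> Arr C \<Longrightarrow>
    Cod C x = Dom C f \<Longrightarrow> g \<cdot> (f \<cdot> x) = h \<cdot> x"
  using assoc[of x f g] by simp

lemma extend2:
  "g \<cdot> f = h \<cdot> k \<Longrightarrow> g \<in> Arr C \<Longrightarrow> f \<in> Arr C \<Longrightarrow> Dom C g = Cod C f \<Longrightarrow>
    h \<in> Arr C \<Longrightarrow> k \<in> Arr C \<Longrightarrow> Dom C h = Cod C k \<Longrightarrow> x \<in> Arr C \<Longrightarrow>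
    Cod C x = Dom C f \<Longrightarrow> Dom C k = Dom C f \<Longrightarrow> g \<cdot> (f \<cdot> x) = h \<cdot> (k \<cdot> x)"
  using assoc[of x f g] assoc[of x k h] by simp

lemma monicD:
  "monic C m \<Longrightarrow> m \<cdot> x = m \<cdot> y \<Longrightarrow> x \<in> Arr C \<Longrightarrow> y \<in> Arr C \<Longrightarrow> Dom C x = Dom C y \<Longrightarrow>
    Cod C x = Dom C m \<Longrightarrow> Cod C y = Dom C m \<Longrightarrow> x = y"
  by (auto simp: monic_def)

lemma monic_Arr: "monic C m \<Longrightarrow> m \<in> Arr C"
  by (simp add: monic_def)

lemma monic_right_factor:
  assumes "monic C (g \<cdot> f)" "g \<in> Arr C" "f \<in> Arr C" "Dom C g = Cod C f"
  shows "monic C f"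
  unfolding monic_def
proof (intro conjI ballI impI)
  fix x y assume xy: "x \<in> Arr C" "y \<in> Arr C"
    "Dom C x = Dom C y \<and> Cod C x = Dom C f \<and> Cod C y = Dom C f \<and> f \<cdot> x = f \<cdot> y"
  then have "(g \<cdot> f) \<cdot> x = (g \<cdot> f) \<cdot> y" using assms(2-4) by simp
  then show "x = y"
    by (rule monicD[OF assms(1)]) (use xy assms(2-4) in simp_all)
qed (rule assms(3))

lemma is_pullbackD:
  assumes "is_pullback C f g p q"
  shows "f \<in> Arr C" "g \<in> Arr C" "Cod C f = Cod C g" "p \<in> Arr C" "q \<in> Arr C" "Dom C p = Dom C q"
    "Cod C p = Dom C f" "Cod C q = Dom C g" "f \<cdot> p = g \<cdot> q"
  using assms by (simp_all add: is_pullback_def)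

lemma pullback_ex1:
  assumes "is_pullback C f g p q" "x \<in> Arr C" "y \<in> Arr C" "Dom C x = Dom C y" "Cod C x = Dom C f"
    "Cod C y = Dom C g" "f \<cdot> x = g \<cdot> y"
  shows "\<exists>!u. u \<in> Hom C (Dom C x) (Dom C p) \<and> p \<cdot> u = x \<and> q \<cdot> u = y"
proof -
  have "\<forall>t. \<forall>x \<in> Hom C t (Dom C f). \<forall>y \<in> Hom C t (Dom C g). f \<cdot> x = g \<cdot> y \<longrightarrow>
      (\<exists>!u. u \<in> Hom C t (Dom C p) \<and> p \<cdot> u = x \<and> q \<cdot> u = y)"
    using assms(1) unfolding is_pullback_def by (elim conjE)
  then show ?thesis using assms(2-) by (metis in_Hom)
qed

lemma pullback_lift:
  assumes "is_pullback C f g p q" "x \<in> Arr C" "y \<in> Arr C" "Dom C x = Dom C y" "Cod C x = Dom C f"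
    "Cod C y = Dom C g" "f \<cdot> x = g \<cdot> y"
  obtains u where "u \<in> Arr C" "Dom C u = Dom C x" "Cod C u = Dom C p" "p \<cdot> u = x" "q \<cdot> u = y"
  using pullback_ex1[OF assms] that unfolding in_Hom by blast

lemma pullback_ext:
  assumes "is_pullback C f g p q" "u \<in> Arr C" "v \<in> Arr C" "Dom C u = Dom C v" "Cod C u = Dom C p"
    "Cod C v = Dom C p" "p \<cdot> u = p \<cdot> v" "q \<cdot> u = q \<cdot> v"
  shows "u = v"
proof -
  note [simp] = is_pullbackD(1-8)[OF assms(1)] assms(2-6)
  have "f \<cdot> (p \<cdot> u) = g \<cdot> (q \<cdot> u)"
    by (intro extend2[OF is_pullbackD(9)[OF assms(1)]]) simp_all
  then have "\<exists>!w. w \<in> Hom C (Dom C (p \<cdot> u)) (Dom C p) \<and> p \<cdot> w = p \<cdot> u \<and> q \<cdot> w = q \<cdot> u"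
    by (intro pullback_ex1[OF assms(1)]) simp_all
  moreover have "u \<in> Hom C (Dom C (p \<cdot> u)) (Dom C p) \<and> p \<cdot> u = p \<cdot> u \<and> q \<cdot> u = q \<cdot> u"
    "v \<in> Hom C (Dom C (p \<cdot> u)) (Dom C p) \<and> p \<cdot> v = p \<cdot> u \<and> q \<cdot> v = q \<cdot> u"
    using assms(7,8) by simp_all
  ultimately show ?thesis by blast
qed

lemma pullback_monic:
  assumes "is_pullback C f g p q" "monic C f"
  shows "monic C q"
  unfolding monic_def
proof (intro conjI ballI impI)
  note [simp] = is_pullbackD[OF assms(1)]
  show "q \<in> Arr C" by simp
  fix x y assume xy: "x \<in> Arr C" "y \<in> Arr C"
    "Dom C x = Dom C y \<and> Cod C x = Dom C q \<and> Cod C y = Dom C q \<and> q \<cdot> x = q \<cdot> y"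
  have "f \<cdot> (p \<cdot> x) = g \<cdot> (q \<cdot> x)"
    by (rule extend2[OF is_pullbackD(9)[OF assms(1)]]) (use xy in simp_all)
  also have "\<dots> = g \<cdot> (q \<cdot> y)"
    using xy by simp
  also have "\<dots> = f \<cdot> (p \<cdot> y)"
    by (rule extend2[OF is_pullbackD(9)[OF assms(1)], symmetric]) (use xy in simp_all)
  finally have "p \<cdot> x = p \<cdot> y"
    by (rule monicD[OF assms(2)]) (use xy in simp_all)
  then show "x = y" by (rule pullback_ext[OF assms(1), rotated 5]) (use xy in simp_all)
qed

lemma is_coequalizerD:
  assumes "is_coequalizer C f g e"
  shows "f \<in> Arr C" "g \<in> Arr C" "Dom C f = Dom C g" "Cod C f = Cod C g" "e \<in> Arr C"
    "Dom C e = Cod C g" "e \<cdot> f = e \<cdot> g"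
  using assms by (simp_all add: is_coequalizer_def)

lemma coequalizer_ex1:
  assumes "is_coequalizer C f g e" "d \<in> Arr C" "Dom C d = Dom C e" "d \<cdot> f = d \<cdot> g"
  shows "\<exists>!u. u \<in> Hom C (Cod C e) (Cod C d) \<and> u \<cdot> e = d"
proof -
  have "\<forall>d \<in> Arr C. Dom C d = Cod C f \<and> d \<cdot> f = d \<cdot> g \<longrightarrow>
      (\<exists>!u. u \<in> Hom C (Cod C e) (Cod C d) \<and> u \<cdot> e = d)"
    using assms(1) unfolding is_coequalizer_def by (elim conjE)
  then show ?thesis using assms(2-) is_coequalizerD(4,6)[OF assms(1)] by metis
qed

lemma coequalizer_factor:
  assumes "is_coequalizer C f g e" "d \<in> Arr C" "Dom C d = Dom C e" "d \<cdot> f = d \<cdot> g"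
  obtains u where "u \<in> Arr C" "Dom C u = Cod C e" "Cod C u = Cod C d" "u \<cdot> e = d"
  using coequalizer_ex1[OF assms] that unfolding in_Hom by blast

lemma coequalizer_epic:
  assumes "is_coequalizer C f g e" "x \<in> Arr C" "y \<in> Arr C" "Dom C x = Cod C e" "Dom C y = Cod C e"
    "x \<cdot> e = y \<cdot> e"
  shows "x = y"
proof -
  note [simp] = is_coequalizerD(1-6)[OF assms(1)] assms(2-5)
  have cod: "Cod C x = Cod C y"
    using arg_cong[OF assms(6), of "Cod C"] by simp
  have "\<exists>!u. u \<in> Hom C (Cod C e) (Cod C (x \<cdot> e)) \<and> u \<cdot> e = x \<cdot> e"
    using is_coequalizerD(7)[OF assms(1)] by (intro coequalizer_ex1[OF assms(1)]) simp_all
  moreover have "x \<in> Hom C (Cod C e) (Cod C (x \<cdot> e)) \<and> x \<cdot> e = x \<cdot> e"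
    "y \<in> Hom C (Cod C e) (Cod C (x \<cdot> e)) \<and> y \<cdot> e = x \<cdot> e"
    using assms(6) cod by simp_all
  ultimately show ?thesis by blast
qed

lemma regular_epi_Arr: "regular_epi C e \<Longrightarrow> e \<in> Arr C"
  by (auto simp: regular_epi_def dest: is_coequalizerD)

lemma regular_epi_epic:
  assumes "regular_epi C e" "x \<cdot> e = y \<cdot> e" "x \<in> Arr C" "y \<in> Arr C" "Dom C x = Cod C e"
    "Dom C y = Cod C e"
  shows "x = y"
  using assms coequalizer_epic unfolding regular_epi_def by metis

text \<open>Since \<open>m\<close> is monic, \<open>x\<close> identifies every pair of arrows that \<open>q\<close> identifies, hence factors through \<open>q\<close>.\<close>

lemma diagonal_fill_in:
  assumes "regular_epi C q" "monic C m" "m \<cdot> x = y \<cdot> q" "x \<in> Arr C" "y \<in> Arr C"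
    "Cod C x = Dom C m" "Dom C x = Dom C q" "Dom C y = Cod C q" "Cod C y = Cod C m"
  obtains d where "d \<in> Arr C" "Dom C d = Cod C q" "Cod C d = Dom C m" "d \<cdot> q = x" "m \<cdot> d = y"
proof -
  obtain u v where c: "is_coequalizer C u v q"
    using assms(1) by (auto simp: regular_epi_def)
  note [simp] = is_coequalizerD(1-6)[OF c] monic_Arr[OF assms(2)]
  have "m \<cdot> (x \<cdot> u) = m \<cdot> (x \<cdot> v)"
    using assms by (simp add: extend2[OF assms(3)] is_coequalizerD(7)[OF c])
  then have "x \<cdot> u = x \<cdot> v"
    by (rule monicD[OF assms(2)]) (use assms in auto)
  then obtain d where d: "d \<in> Arr C" "Dom C d = Cod C q" "Cod C d = Cod C x" "d \<cdot> q = x"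
    using coequalizer_factor[OF c, of x] assms by auto
  have "(m \<cdot> d) \<cdot> q = y \<cdot> q" using d assms by simp
  then have "m \<cdot> d = y" by (rule regular_epi_epic[OF assms(1)]) (use d assms in auto)
  then show thesis using that d assms by auto
qed

text \<open>Extremality is stated through a section \<open>w\<close> of the monic arrow \<open>m\<close>, which is then an inverse
  (\<open>monic_split_iso\<close>): a section is what the arguments below produce.\<close>

lemma regular_epi_extremal:
  assumes "regular_epi C e" "monic C m" "m \<cdot> g = e" "g \<in> Arr C" "Cod C g = Dom C m"
  obtains w where "w \<in> Arr C" "Dom C w = Cod C m" "Cod C w = Dom C m" "m \<cdot> w = \<one>(Cod C m)"
proof -
  note [simp] = regular_epi_Arr[OF assms(1)] monic_Arr[OF assms(2)]
  have t: "Dom C e = Dom C g" "Cod C e = Cod C m"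
    using assms(3-5) Comp_typing[of m g] by auto
  obtain d where "d \<in> Arr C" "Dom C d = Cod C e" "Cod C d = Dom C m" "d \<cdot> e = g"
      "m \<cdot> d = \<one>(Cod C m)"
    by (rule diagonal_fill_in[OF assms(1,2), of g "\<one>(Cod C m)"]) (use assms(3-5) t in auto)
  then show thesis using that t by auto
qed

lemma coequalizer_Comp_iso:
  assumes "is_coequalizer C u v q" "m \<in> Arr C" "Dom C m = Cod C q" "w \<in> Arr C" "Dom C w = Cod C m"
    "Cod C w = Dom C m" "m \<cdot> w = \<one>(Cod C m)" "w \<cdot> m = \<one>(Dom C m)"
  shows "is_coequalizer C u v (m \<cdot> q)"
proof -
  note [simp] = is_coequalizerD(1-6)[OF assms(1)] assms(2-8)
  have wm: "w \<cdot> (m \<cdot> x) = x" if "x \<in> Arr C" "Cod C x = Cod C q" for x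
    using that by (simp add: extend[OF assms(8)])
  show ?thesis
    unfolding is_coequalizer_def
  proof (intro conjI ballI impI, goal_cases)
    case (6 d)
    obtain x where x: "x \<in> Arr C" "Dom C x = Cod C q" "Cod C x = Cod C d" "x \<cdot> q = d"
      using coequalizer_factor[OF assms(1), of d] 6 by auto
    have "y = x \<cdot> w" if "y \<in> Arr C" "Dom C y = Cod C m" "y \<cdot> (m \<cdot> q) = d" for y
    proof -
      have "(y \<cdot> m) \<cdot> q = x \<cdot> q" using that x by simp
      then have ym: "y \<cdot> m = x" by (rule coequalizer_epic[OF assms(1), rotated 4]) (use that x in auto)
      have "x \<cdot> w = (y \<cdot> m) \<cdot> w" by (simp only: ym)
      also have "\<dots> = y" using that by simp
      finally show ?thesis by simp
    qed
    then show ?case using x wm[of q] by (intro ex1I[of _ "x \<cdot> w"]) auto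
  qed (use is_coequalizerD(7)[OF assms(1)] in auto)
qed

lemma monic_split_iso:
  assumes "monic C m" "w \<in> Arr C" "Dom C w = Cod C m" "Cod C w = Dom C m" "m \<cdot> w = \<one>(Cod C m)"
  shows "w \<cdot> m = \<one>(Dom C m)"
proof (rule monicD[OF assms(1)])
  note [simp] = monic_Arr[OF assms(1)] assms(2-5)
  show "m \<cdot> (w \<cdot> m) = m \<cdot> \<one>(Dom C m)"
    by (simp add: extend[OF assms(5)])
qed (use assms monic_Arr[OF assms(1)] in auto)

lemma regular_epi_Comp_iso:
  assumes "regular_epi C q" "monic C m" "Dom C m = Cod C q" "w \<in> Arr C" "Dom C w = Cod C m"
    "Cod C w = Dom C m" "m \<cdot> w = \<one>(Cod C m)"
  shows "regular_epi C (m \<cdot> q)"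
  using assms coequalizer_Comp_iso monic_split_iso monic_Arr unfolding regular_epi_def by metis

lemma regular_epi_kernel_pair:
  assumes e: "regular_epi C e" and R: "is_pullback C e e r\<^sub>1 r\<^sub>2"
  shows "is_coequalizer C r\<^sub>1 r\<^sub>2 e"
proof -
  obtain a b where c: "is_coequalizer C a b e" using e by (auto simp: regular_epi_def)
  note [simp] = regular_epi_Arr[OF e] is_pullbackD(4-8)[OF R]
  obtain l where l: "l \<in> Arr C" "Cod C l = Dom C r\<^sub>1" "r\<^sub>1 \<cdot> l = a" "r\<^sub>2 \<cdot> l = b"
    by (rule pullback_lift[OF R, of a b]) (use is_coequalizerD[OF c] in simp_all)
  have "\<exists>!u. u \<in> Hom C (Cod C e) (Cod C d) \<and> u \<cdot> e = d"
    if d: "d \<in> Arr C" "Dom C d = Dom C e" "d \<cdot> r\<^sub>1 = d \<cdot> r\<^sub>2" for d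
  proof (rule coequalizer_ex1[OF c])
    have "d \<cdot> (r\<^sub>1 \<cdot> l) = d \<cdot> (r\<^sub>2 \<cdot> l)"
      by (rule extend2[OF d(3)]) (use d l in simp_all)
    then show "d \<cdot> a = d \<cdot> b" using l by simp
  qed (use d in simp_all)
  then show ?thesis
    unfolding is_coequalizer_def by (simp add: is_pullbackD(9)[OF R])
qed

end

section \<open>Finite limits\<close>

context semi_abelian
begin

lemma finitely_complete: "finitely_complete C"
  and kernel_pair_coequalizer: "is_kernel_pair C f r\<^sub>1 r\<^sub>2 \<Longrightarrow> \<exists>e. is_coequalizer C r\<^sub>1 r\<^sub>2 e"
  and pullback_regular_epi: "is_pullback C f g p q \<Longrightarrow> regular_epi C f \<Longrightarrow> regular_epi C q"
  using barr_exact unfolding barr_exact_def regular_category_def by blast+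

lemma pullback_exists:
  assumes "f \<in> Arr C" "g \<in> Arr C" "Cod C f = Cod C g"
  obtains p q where "is_pullback C f g p q"
proof -
  define D where "D = (\<lambda>i::nat. if i = 0 then Dom C f else if i = 1 then Dom C g else Cod C f)"
  define E where "E = {(0::nat, 2::nat, f), (1, 2, g)}"
  have "finite_diagram C 3 D E"
    using assms by (auto simp: finite_diagram_def D_def E_def)
  then obtain L \<pi> where lim: "is_limit C 3 D E L \<pi>"
    using finitely_complete unfolding finitely_complete_def by blast
  have 3: "(\<forall>i<3. R i) \<longleftrightarrow> R 0 \<and> R 1 \<and> R 2" for R :: "nat \<Rightarrow> bool"
    by (auto simp: numeral_3_eq_3 less_Suc_eq numeral_2_eq_2)
  have cone: "is_cone C 3 D E L \<pi>"
    using lim unfolding is_limit_def by simp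
  then have L: "L \<in> Obj C" "\<pi> 0 \<in> Hom C L (Dom C f)" "\<pi> 1 \<in> Hom C L (Dom C g)" "f \<cdot> \<pi> 0 = \<pi> 2"
    "g \<cdot> \<pi> 1 = \<pi> 2"
    by (auto simp: is_cone_def 3 D_def E_def)
  have ex: "\<exists>!u. u \<in> Hom C t L \<and> \<pi> 0 \<cdot> u = x \<and> \<pi> 1 \<cdot> u = y"
    if xy: "x \<in> Hom C t (Dom C f)" "y \<in> Hom C t (Dom C g)" "f \<cdot> x = g \<cdot> y" for t x y
  proof -
    define \<rho> where "\<rho> = (\<lambda>i::nat. if i = 0 then x else if i = 1 then y else f \<cdot> x)"
    have "is_cone C 3 D E t \<rho>"
      using xy assms by (auto simp: is_cone_def 3 D_def E_def \<rho>_def)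
    then have "\<exists>!u. u \<in> Hom C t L \<and> (\<forall>i<3. \<pi> i \<cdot> u = \<rho> i)"
      using lim unfolding is_limit_def by blast
    moreover have "(u \<in> Hom C t L \<and> (\<forall>i<3. \<pi> i \<cdot> u = \<rho> i)) \<longleftrightarrow>
      (u \<in> Hom C t L \<and> \<pi> 0 \<cdot> u = x \<and> \<pi> 1 \<cdot> u = y)" for u
    proof -
      have "f \<cdot> (\<pi> 0 \<cdot> u) = \<pi> 2 \<cdot> u" if "u \<in> Hom C t L"
        by (rule extend[OF L(4)]) (use L assms that in simp_all)
      then show ?thesis by (auto simp: 3 \<rho>_def)
    qed
    ultimately show ?thesis by simp
  qed
  have D: "Dom C (\<pi> 0) = L" using L by simp
  have "is_pullback C f g (\<pi> 0) (\<pi> 1)"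
    unfolding is_pullback_def D by (intro conjI allI ballI impI ex) (use L assms in simp_all)
  then show thesis by (rule that)
qed

lemma equalizer_exists:
  assumes "f \<in> Arr C" "g \<in> Arr C" "Dom C f = Dom C g" "Cod C f = Cod C g"
  obtains e where "monic C e" "Cod C e = Dom C f" "f \<cdot> e = g \<cdot> e"
    "\<And>x. x \<in> Arr C \<Longrightarrow> Cod C x = Dom C f \<Longrightarrow> f \<cdot> x = g \<cdot> x \<Longrightarrow>
      \<exists>u \<in> Arr C. Dom C u = Dom C x \<and> Cod C u = Dom C e \<and> e \<cdot> u = x"
proof -
  define D where "D = (\<lambda>i::nat. if i = 0 then Dom C f else Cod C f)"
  define E where "E = {(0::nat, 1::nat, f), (0, 1, g)}"
  have "finite_diagram C 2 D E"
    using assms by (auto simp: finite_diagram_def D_def E_def)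
  then obtain L \<pi> where lim: "is_limit C 2 D E L \<pi>"
    using finitely_complete unfolding finitely_complete_def by blast
  have 2: "(\<forall>i<2. R i) \<longleftrightarrow> R 0 \<and> R 1" for R :: "nat \<Rightarrow> bool"
    by (auto simp: numeral_2_eq_2 less_Suc_eq)
  have cone: "is_cone C 2 D E L \<pi>"
    using lim unfolding is_limit_def by simp
  then have L: "L \<in> Obj C" "\<pi> 0 \<in> Hom C L (Dom C f)" "f \<cdot> \<pi> 0 = \<pi> 1" "g \<cdot> \<pi> 0 = \<pi> 1"
    by (auto simp: is_cone_def 2 D_def E_def)
  have ex: "\<exists>!u. u \<in> Hom C t L \<and> \<pi> 0 \<cdot> u = x"
    if x: "x \<in> Hom C t (Dom C f)" "f \<cdot> x = g \<cdot> x" for t x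
  proof -
    define \<rho> where "\<rho> = (\<lambda>i::nat. if i = 0 then x else f \<cdot> x)"
    have "is_cone C 2 D E t \<rho>"
      using x assms by (auto simp: is_cone_def 2 D_def E_def \<rho>_def)
    then have "\<exists>!u. u \<in> Hom C t L \<and> (\<forall>i<2. \<pi> i \<cdot> u = \<rho> i)"
      using lim unfolding is_limit_def by blast
    moreover have "(u \<in> Hom C t L \<and> (\<forall>i<2. \<pi> i \<cdot> u = \<rho> i)) \<longleftrightarrow>
      (u \<in> Hom C t L \<and> \<pi> 0 \<cdot> u = x)" for u
    proof -
      have "f \<cdot> (\<pi> 0 \<cdot> u) = \<pi> 1 \<cdot> u" if "u \<in> Hom C t L"
        by (rule extend[OF L(3)]) (use L assms that in simp_all)
      then show ?thesis by (auto simp: 2 \<rho>_def)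
    qed
    ultimately show ?thesis by simp
  qed
  have eq: "f \<cdot> (\<pi> 0 \<cdot> x) = g \<cdot> (\<pi> 0 \<cdot> x)" if "x \<in> Arr C" "Cod C x = L" for x
    using L assms that by (simp add: extend[OF L(3)] extend[OF L(4)])
  have "monic C (\<pi> 0)"
    unfolding monic_def
  proof (intro conjI ballI impI)
    fix x y assume xy: "x \<in> Arr C" "y \<in> Arr C" "Dom C x = Dom C y \<and> Cod C x = Dom C (\<pi> 0) \<and>
      Cod C y = Dom C (\<pi> 0) \<and> \<pi> 0 \<cdot> x = \<pi> 0 \<cdot> y"
    have "\<exists>!u. u \<in> Hom C (Dom C x) L \<and> \<pi> 0 \<cdot> u = \<pi> 0 \<cdot> x"
      by (rule ex) (use eq[of x] xy L in simp_all)
    moreover have "x \<in> Hom C (Dom C x) L \<and> \<pi> 0 \<cdot> x = \<pi> 0 \<cdot> x"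
      "y \<in> Hom C (Dom C x) L \<and> \<pi> 0 \<cdot> y = \<pi> 0 \<cdot> x"
      using xy L by simp_all
    ultimately show "x = y" by blast
  qed (use L in auto)
  then show thesis
  proof (rule that)
    fix x assume x: "x \<in> Arr C" "Cod C x = Dom C f" "f \<cdot> x = g \<cdot> x"
    then have "\<exists>!u. u \<in> Hom C (Dom C x) L \<and> \<pi> 0 \<cdot> u = x"
      by (intro ex) simp_all
    then obtain u where "u \<in> Hom C (Dom C x) L" "\<pi> 0 \<cdot> u = x" by blast
    then show "\<exists>u \<in> Arr C. Dom C u = Dom C x \<and> Cod C u = Dom C (\<pi> 0) \<and> \<pi> 0 \<cdot> u = x"
      using L by (intro bexI[of _ u]) simp_all
  qed (use L in auto)
qed

lemma product_exists:
  assumes "a \<in> Obj C" "b \<in> Obj C"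
  shows "\<exists>p q. is_product C a b p q"
proof -
  define D where "D = (\<lambda>i::nat. if i = 0 then a else b)"
  have "finite_diagram C 2 D {}"
    using assms by (auto simp: finite_diagram_def D_def)
  then obtain L \<pi> where lim: "is_limit C 2 D {} L \<pi>"
    using finitely_complete unfolding finitely_complete_def by blast
  have 2: "(\<forall>i<2. R i) \<longleftrightarrow> R 0 \<and> R 1" for R :: "nat \<Rightarrow> bool"
    by (auto simp: numeral_2_eq_2 less_Suc_eq)
  have cone: "is_cone C 2 D {} L \<pi>"
    using lim unfolding is_limit_def by simp
  then have L: "L \<in> Obj C" "\<pi> 0 \<in> Hom C L a" "\<pi> 1 \<in> Hom C L b"
    by (auto simp: is_cone_def 2 D_def)
  have ex: "\<exists>!u. u \<in> Hom C t L \<and> \<pi> 0 \<cdot> u = x \<and> \<pi> 1 \<cdot> u = y"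
    if xy: "x \<in> Hom C t a" "y \<in> Hom C t b" for t x y
  proof -
    define \<rho> where "\<rho> = (\<lambda>i::nat. if i = 0 then x else y)"
    have "is_cone C 2 D {} t \<rho>"
      using xy assms by (auto simp: is_cone_def 2 D_def \<rho>_def)
    then have "\<exists>!u. u \<in> Hom C t L \<and> (\<forall>i<2. \<pi> i \<cdot> u = \<rho> i)"
      using lim unfolding is_limit_def by blast
    then show ?thesis by (simp add: 2 \<rho>_def)
  qed
  have D: "Dom C (\<pi> 0) = L" using L by simp
  have "is_product C a b (\<pi> 0) (\<pi> 1)"
    unfolding is_product_def D by (intro conjI allI ballI impI ex) (use L in simp_all)
  then show ?thesis by blast
qed

section \<open>Zero arrows\<close>

lemma zero_arr_eqI:
  assumes "zero_object C z" "u \<in> Arr C" "v \<in> Arr C" "Cod C u = z" "Dom C v = z"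
  shows "\<zero> (Dom C u) (Cod C v) = v \<cdot> u"
  unfolding zero_arr_def
proof (rule the_equality)
  show "\<exists>z. zero_object C z \<and> (\<exists>u' \<in> Hom C (Dom C u) z. \<exists>v' \<in> Hom C z (Cod C v). v \<cdot> u = v' \<cdot> u')"
    using assms by (intro exI[of _ z] conjI bexI[of _ u] bexI[of _ v]) simp_all
next
  fix f assume "\<exists>z. zero_object C z \<and> (\<exists>u' \<in> Hom C (Dom C u) z. \<exists>v' \<in> Hom C z (Cod C v). f = v' \<cdot> u')"
  then obtain z' u' v' where z': "zero_object C z'" "u' \<in> Hom C (Dom C u) z'" "v' \<in> Hom C z' (Cod C v)"
    "f = v' \<cdot> u'" by blast
  have z'o: "z' \<in> Obj C" "z \<in> Obj C" using z' assms by (auto simp: zero_object_def)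
  obtain i where i: "i \<in> Hom C z z'" using assms(1) z'o unfolding zero_object_def by blast
  have "\<exists>!x. x \<in> Hom C (Dom C u) z'" "\<exists>!x. x \<in> Hom C z (Cod C v)"
    using z'(1) assms unfolding zero_object_def by auto
  moreover have "i \<cdot> u \<in> Hom C (Dom C u) z'" "v' \<cdot> i \<in> Hom C z (Cod C v)" "v \<in> Hom C z (Cod C v)"
    using i z'(2,3) assms by simp_all
  ultimately have uv: "u' = i \<cdot> u" "v = v' \<cdot> i" using z'(2) by blast+
  show "f = v \<cdot> u" unfolding z'(4) uv using i z'(2,3) assms by simp
qed

lemma zero_factor:
  assumes "a \<in> Obj C" "b \<in> Obj C"
  obtains z u v where "zero_object C z" "u \<in> Arr C" "v \<in> Arr C" "Cod C u = z" "Dom C v = z"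
    "Dom C u = a" "Cod C v = b" "\<zero> a b = v \<cdot> u"
proof -
  obtain z where z: "zero_object C z" using pointed by (auto simp: pointed_def)
  obtain u v where "u \<in> Hom C a z" "v \<in> Hom C z b"
    using z assms unfolding zero_object_def by metis
  then show thesis using that z zero_arr_eqI by auto
qed

lemma zero_typing [simp]:
  assumes "a \<in> Obj C" "b \<in> Obj C"
  shows "\<zero> a b \<in> Arr C" "Dom C (\<zero> a b) = a" "Cod C (\<zero> a b) = b"
  using zero_factor[OF assms] by (metis Comp_typing)+

lemma Comp_zero [simp]:
  assumes "f \<in> Arr C" "a \<in> Obj C" "Dom C f = b"
  shows "f \<cdot> \<zero> a b = \<zero> a (Cod C f)"
proof -
  have "b \<in> Obj C" using assms by auto
  then obtain z u v where zuv: "zero_object C z" "u \<in> Arr C" "v \<in> Arr C" "Cod C u = z" "Dom C v = z"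
    "Dom C u = a" "Cod C v = b" "\<zero> a b = v \<cdot> u" using zero_factor assms by metis
  then show ?thesis using zero_arr_eqI[of z u "f \<cdot> v"] assms by simp
qed

lemma zero_Comp [simp]:
  assumes "f \<in> Arr C" "b \<in> Obj C" "Cod C f = a"
  shows "\<zero> a b \<cdot> f = \<zero> (Dom C f) b"
proof -
  have "a \<in> Obj C" using assms by auto
  then obtain z u v where zuv: "zero_object C z" "u \<in> Arr C" "v \<in> Arr C" "Cod C u = z" "Dom C v = z"
    "Dom C u = a" "Cod C v = b" "\<zero> a b = v \<cdot> u" using zero_factor assms by metis
  then show ?thesis using zero_arr_eqI[of z "u \<cdot> f" v] assms by simp
qed

section \<open>Kernels\<close>

lemma is_kernelD:
  assumes "is_kernel C k f"
  shows "f \<in> Arr C" "k \<in> Arr C" "Cod C k = Dom C f" "f \<cdot> k = \<zero> (Dom C k) (Cod C f)"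
  using assms by (simp_all add: is_kernel_def)

lemma kernel_lift:
  assumes "is_kernel C k f" "x \<in> Arr C" "Cod C x = Dom C f" "f \<cdot> x = \<zero> (Dom C x) (Cod C f)"
  obtains u where "u \<in> Arr C" "Dom C u = Dom C x" "Cod C u = Dom C k" "k \<cdot> u = x"
proof -
  have "\<forall>t. \<forall>x \<in> Hom C t (Dom C f). f \<cdot> x = \<zero> t (Cod C f) \<longrightarrow>
      (\<exists>!u. u \<in> Hom C t (Dom C k) \<and> k \<cdot> u = x)"
    using assms(1) unfolding is_kernel_def by (elim conjE)
  then have "\<exists>!u. u \<in> Hom C (Dom C x) (Dom C k) \<and> k \<cdot> u = x"
    using assms(2-) by (metis in_Hom)
  then show thesis using that unfolding in_Hom by blast
qed

lemma kernel_monic: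
  assumes "is_kernel C k f"
  shows "monic C k"
  unfolding monic_def
proof (intro conjI ballI impI)
  note [simp] = is_kernelD(1-3)[OF assms]
  show "k \<in> Arr C" by simp
  fix x y assume xy: "x \<in> Arr C" "y \<in> Arr C"
    "Dom C x = Dom C y \<and> Cod C x = Dom C k \<and> Cod C y = Dom C k \<and> k \<cdot> x = k \<cdot> y"
  have "\<forall>t. \<forall>x \<in> Hom C t (Dom C f). f \<cdot> x = \<zero> t (Cod C f) \<longrightarrow>
      (\<exists>!u. u \<in> Hom C t (Dom C k) \<and> k \<cdot> u = x)"
    using assms unfolding is_kernel_def by (elim conjE)
  moreover have "k \<cdot> x \<in> Hom C (Dom C x) (Dom C f)" using xy by simp
  moreover have "f \<cdot> (k \<cdot> x) = \<zero> (Dom C x) (Cod C f)"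
    using xy by (simp add: extend[OF is_kernelD(4)[OF assms]])
  ultimately have "\<exists>!u. u \<in> Hom C (Dom C x) (Dom C k) \<and> k \<cdot> u = k \<cdot> x"
    by blast
  moreover have "x \<in> Hom C (Dom C x) (Dom C k) \<and> k \<cdot> x = k \<cdot> x"
    "y \<in> Hom C (Dom C x) (Dom C k) \<and> k \<cdot> y = k \<cdot> x"
    using xy by simp_all
  ultimately show "x = y" by blast
qed

lemma is_kernelI:
  assumes "monic C k" "f \<in> Arr C" "Cod C k = Dom C f" "f \<cdot> k = \<zero> (Dom C k) (Cod C f)"
    and lift: "\<And>x. x \<in> Arr C \<Longrightarrow> Cod C x = Dom C f \<Longrightarrow> f \<cdot> x = \<zero> (Dom C x) (Cod C f) \<Longrightarrow>
      \<exists>u \<in> Arr C. Dom C u = Dom C x \<and> Cod C u = Dom C k \<and> k \<cdot> u = x"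
  shows "is_kernel C k f"
  unfolding is_kernel_def
proof (intro conjI allI ballI impI)
  fix t x assume x: "x \<in> Hom C t (Dom C f)" "f \<cdot> x = \<zero> t (Cod C f)"
  then obtain u where "u \<in> Arr C" "Dom C u = t" "Cod C u = Dom C k" "k \<cdot> u = x"
    using lift[of x] by auto
  then show "\<exists>!u. u \<in> Hom C t (Dom C k) \<and> k \<cdot> u = x"
    by (intro ex1I[of _ u]) (auto intro: monicD[OF assms(1)])
qed (use assms monic_Arr in auto)

lemma kernel_exists:
  assumes "f \<in> Arr C"
  obtains k where "is_kernel C k f"
proof -
  obtain k where k: "monic C k" "Cod C k = Dom C f" "f \<cdot> k = \<zero> (Dom C f) (Cod C f) \<cdot> k"
    "\<And>x. x \<in> Arr C \<Longrightarrow> Cod C x = Dom C f \<Longrightarrow> f \<cdot> x = \<zero> (Dom C f) (Cod C f) \<cdot> x \<Longrightarrow>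
      \<exists>u \<in> Arr C. Dom C u = Dom C x \<and> Cod C u = Dom C k \<and> k \<cdot> u = x"
    by (rule equalizer_exists[of f "\<zero> (Dom C f) (Cod C f)"]) (use assms in auto)
  have "is_kernel C k f"
    by (rule is_kernelI) (use k assms monic_Arr[OF k(1)] in auto)
  then show thesis by (rule that)
qed

section \<open>Image factorizations\<close>

text \<open>The coequalizer \<open>q\<close> of the kernel pair of \<open>f\<close> leaves a monic arrow \<open>m\<close>: two arrows into the image
  lift along \<open>q\<close> after passing to a regular cover of their domain, by pulling back \<open>q\<close> twice. If \<open>m\<close> identifies
  them, their lifts form an arrow into the kernel pair, on which \<open>q\<close> agrees.\<close>

lemma image_factorization:
  assumes "f \<in> Arr C"
  obtains q m where "regular_epi C q" "monic C m" "Dom C q = Dom C f" "Cod C m = Cod C f"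
    "Cod C q = Dom C m" "m \<cdot> q = f"
proof -
  obtain r s where R: "is_pullback C f f r s"
    using pullback_exists assms by blast
  then obtain q where q: "is_coequalizer C r s q"
    using kernel_pair_coequalizer[of f r s] unfolding is_kernel_pair_def by blast
  note [simp] = assms is_pullbackD(4-8)[OF R] is_coequalizerD(5,6)[OF q]
  have reg: "regular_epi C q" using q by (auto simp: regular_epi_def)
  obtain m where m: "m \<in> Arr C" "Dom C m = Cod C q" "Cod C m = Cod C f" and mq: "m \<cdot> q = f"
    by (rule coequalizer_factor[OF q, of f]) (simp_all add: is_pullbackD(9)[OF R])
  note [simp] = m
  have "monic C m"
    unfolding monic_def
  proof (intro conjI ballI impI)
    fix x y assume "x \<in> Arr C" "y \<in> Arr C"
      and xy: "Dom C x = Dom C y \<and> Cod C x = Dom C m \<and> Cod C y = Dom C m \<and> m \<cdot> x = m \<cdot> y"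
    then have [simp]: "x \<in> Arr C" "y \<in> Arr C" "Dom C x = Dom C y" "Cod C x = Cod C q" "Cod C y = Cod C q"
      by simp_all
    obtain x1 t1 where 1: "is_pullback C q x x1 t1" using pullback_exists[of q x] by auto
    have t1: "regular_epi C t1" using pullback_regular_epi[OF 1 reg] .
    have [simp]: "x1 \<in> Arr C" "t1 \<in> Arr C" "Dom C x1 = Dom C t1" "Cod C x1 = Dom C f"
        "Cod C t1 = Dom C y"
      using is_pullbackD(4-8)[OF 1] by simp_all
    obtain x2 t2 where 2: "is_pullback C q (y \<cdot> t1) x2 t2"
      using pullback_exists[of q "y \<cdot> t1"] by auto
    have t2: "regular_epi C t2" using pullback_regular_epi[OF 2 reg] .
    have [simp]: "x2 \<in> Arr C" "t2 \<in> Arr C" "Dom C x2 = Dom C t2" "Cod C x2 = Dom C f"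
        "Cod C t2 = Dom C t1"
      using is_pullbackD(4-8)[OF 2] by simp_all
    have e1: "q \<cdot> (x1 \<cdot> t2) = x \<cdot> (t1 \<cdot> t2)"
      by (rule extend2[OF is_pullbackD(9)[OF 1]]) simp_all
    have e2: "q \<cdot> x2 = y \<cdot> (t1 \<cdot> t2)"
      using is_pullbackD(9)[OF 2] by simp
    have f: "f \<cdot> z = m \<cdot> (q \<cdot> z)" if "z \<in> Arr C" "Cod C z = Dom C f" for z
      by (rule extend[OF mq, symmetric]) (use that in simp_all)
    have "f \<cdot> (x1 \<cdot> t2) = m \<cdot> (x \<cdot> (t1 \<cdot> t2))"
      by (simp add: f e1)
    also have "\<dots> = m \<cdot> (y \<cdot> (t1 \<cdot> t2))"
      by (rule extend2) (use xy in simp_all)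
    also have "\<dots> = f \<cdot> x2"
      by (simp add: f e2)
    finally obtain u where u: "u \<in> Arr C" "Cod C u = Dom C r" "r \<cdot> u = x1 \<cdot> t2" "s \<cdot> u = x2"
      by (rule pullback_lift[OF R, rotated 5]) simp_all
    have "q \<cdot> (r \<cdot> u) = q \<cdot> (s \<cdot> u)"
      by (rule extend2[OF is_coequalizerD(7)[OF q]]) (use u in simp_all)
    then have "(x \<cdot> t1) \<cdot> t2 = (y \<cdot> t1) \<cdot> t2"
      by (simp add: u(3,4) e1 e2)
    then have "x \<cdot> t1 = y \<cdot> t1"
      by (rule regular_epi_epic[OF t2]) simp_all
    then show "x = y"
      by (rule regular_epi_epic[OF t1]) simp_all
  qed simp
  then show thesis using that reg mq by auto
qed

text \<open>Extremal epimorphisms are regular: apply extremality to the image.\<close>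

lemma regular_epiI:
  assumes "f \<in> Arr C"
    and ext: "\<And>m g. monic C m \<Longrightarrow> g \<in> Arr C \<Longrightarrow> Cod C g = Dom C m \<Longrightarrow> Cod C m = Cod C f \<Longrightarrow>
      Dom C g = Dom C f \<Longrightarrow> m \<cdot> g = f \<Longrightarrow>
      \<exists>w \<in> Arr C. Dom C w = Cod C m \<and> Cod C w = Dom C m \<and> m \<cdot> w = \<one>(Cod C m)"
  shows "regular_epi C f"
proof -
  obtain q m where q: "regular_epi C q" "monic C m" "Dom C q = Dom C f" "Cod C m = Cod C f"
    "Cod C q = Dom C m" "m \<cdot> q = f"
    using image_factorization[OF assms(1)] .
  then obtain w where "w \<in> Arr C" "Dom C w = Cod C m" "Cod C w = Dom C m" "m \<cdot> w = \<one>(Cod C m)"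
    using ext[of m q] regular_epi_Arr by auto
  then show ?thesis using regular_epi_Comp_iso[of q m w] q by auto
qed

end

section \<open>Split extensions in a protomodular category\<close>

lemma Pt_Obj: "(E, p, s) \<in> Obj (Pt C B) \<longleftrightarrow> p \<in> Hom C E B \<and> s \<in> Hom C B E \<and> p \<cdot> s = \<one>B"
  for C (structure)
  by (simp add: Pt_def Let_def)

lemma Pt_Arr: "((E, p, s), g, (E', p', s')) \<in> Arr (Pt C B) \<longleftrightarrow>
    (E, p, s) \<in> Obj (Pt C B) \<and> (E', p', s') \<in> Obj (Pt C B) \<and> g \<in> Hom C E E' \<and> p' \<cdot> g = p \<and> g \<cdot> s = s'"
  for C (structure)
  by (auto simp: Pt_def Let_def)

lemma Pt_simps:
  "Dom (Pt C B) (x, g, y) = x" "Cod (Pt C B) (x, g, y) = y"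
  "Id (Pt C B) (E, p, s) = ((E, p, s), \<one>E, (E, p, s))"
  "Comp (Pt C B) (y, g', z) (x, g, y') = (x, g' \<cdot> g, z)"
  for C (structure)
  by (simp_all add: Pt_def Let_def)

lemma (in category) split_extensionsD:
  assumes "(X, E, k, p, s) \<in> split_extensions C B"
  shows "k \<in> Arr C" "Dom C k = X" "Cod C k = E" "p \<in> Arr C" "Dom C p = E" "Cod C p = B"
    "s \<in> Arr C" "Dom C s = B" "Cod C s = E" "p \<cdot> s = \<one>B" "is_kernel C k p"
    "X \<in> Obj C" "E \<in> Obj C" "B \<in> Obj C"
  using assms Hom_Obj[of k X E] Hom_Obj[of s B E] by (simp_all add: split_extensions_def)

context semi_abelian
begin

lemma split_extension_zero: "(X, E, k, p, s) \<in> split_extensions C B \<Longrightarrow> p \<cdot> k = \<zero> X B"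
  using split_extensionsD[of X E k p s B] is_kernelD(4)[of k p] by simp

lemmas split_ext_simps = split_extensionsD(1-10,12-14) split_extension_zero

lemma split_extensionsI:
  assumes "is_kernel C k p" "p \<cdot> s = \<one>B" "s \<in> Arr C" "Dom C s = B" "Cod C s = E" "Dom C k = X"
    "Cod C p = B" "Dom C p = E"
  shows "(X, E, k, p, s) \<in> split_extensions C B"
  using assms is_kernelD[OF assms(1)] by (simp add: split_extensions_def)

lemma zero_object_unique:
  assumes "zero_object C z" "x \<in> Arr C" "y \<in> Arr C" "Dom C x = Dom C y" "Cod C x = Cod C y"
    "Dom C x = z \<or> Cod C x = z"
  shows "x = y"
proof -
  have "\<exists>!f. f \<in> Hom C (Dom C x) (Cod C x)"
    using assms unfolding zero_object_def by (metis Dom_in_Obj Cod_in_Obj)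
  moreover have "x \<in> Hom C (Dom C x) (Cod C x)" "y \<in> Hom C (Dom C x) (Cod C x)"
    using assms by simp_all
  ultimately show ?thesis by blast
qed

text \<open>Taking kernels is change of base along an arrow from the zero object; in this form kernels are
  accessible to protomodularity.\<close>

lemma kernel_is_pullback:
  assumes "is_kernel C k f" "zero_object C z" "v \<in> Hom C z (Cod C f)" "t \<in> Hom C (Dom C k) z"
  shows "is_pullback C f v k t"
proof -
  note [simp] = is_kernelD(1-3)[OF assms(1)]
  have [simp]: "v \<in> Arr C" "t \<in> Arr C" "Dom C v = z" "Cod C v = Cod C f" "Dom C t = Dom C k" "Cod C t = z"
    using assms(3,4) by simp_all
  have z: "v \<cdot> y = \<zero> (Dom C y) (Cod C f)" if "y \<in> Arr C" "Cod C y = z" for y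
    using zero_arr_eqI[OF assms(2), of y v] that by simp
  have fk: "f \<cdot> k = v \<cdot> t" using is_kernelD(4)[OF assms(1)] z[of t] by simp
  have ex: "\<exists>!u. u \<in> Hom C r (Dom C k) \<and> k \<cdot> u = x \<and> t \<cdot> u = y"
    if x: "x \<in> Hom C r (Dom C f)" and y: "y \<in> Hom C r (Dom C v)" and eq: "f \<cdot> x = v \<cdot> y" for r x y
  proof -
    have xy: "x \<in> Arr C" "Dom C x = r" "Cod C x = Dom C f" "y \<in> Arr C" "Dom C y = r" "Cod C y = z"
      using x y by simp_all
    then obtain u where u: "u \<in> Arr C" "Dom C u = r" "Cod C u = Dom C k" "k \<cdot> u = x"
      using kernel_lift[OF assms(1), of x] eq z[of y] by auto
    have tu: "t \<cdot> u = y"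
      by (rule zero_object_unique[OF assms(2)]) (use u xy in simp_all)
    show ?thesis
    proof (rule ex1I[of _ u])
      show "u \<in> Hom C r (Dom C k) \<and> k \<cdot> u = x \<and> t \<cdot> u = y" using u tu by simp
      fix u' assume "u' \<in> Hom C r (Dom C k) \<and> k \<cdot> u' = x \<and> t \<cdot> u' = y"
      then show "u' = u"
        by (intro monicD[OF kernel_monic[OF assms(1)], of u' u]) (use u in simp_all)
    qed
  qed
  show ?thesis
    unfolding is_pullback_def by (intro conjI allI ballI impI ex) (simp_all add: fk)
qed

text \<open>The arrow \<open>m\<close> is a morphism of points over \<open>B\<close>, and its restriction to kernels is the identity of \<open>X\<close>.
  As change of base along \<open>z \<rightarrow> B\<close>, for the zero object \<open>z\<close>, reflects isomorphisms, \<open>m\<close> is invertible.\<close>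

lemma split_extension_extremal:
  assumes S: "(X, E, k, p, s) \<in> split_extensions C B"
    and m: "monic C m" "Cod C m = E"
    and k': "k' \<in> Arr C" "Cod C k' = Dom C m" "m \<cdot> k' = k"
    and s': "s' \<in> Arr C" "Cod C s' = Dom C m" "m \<cdot> s' = s"
  obtains w where "w \<in> Arr C" "Dom C w = E" "Cod C w = Dom C m" "m \<cdot> w = \<one>E"
proof -
  note [simp] = split_ext_simps[OF S] monic_Arr[OF m(1)] k'(1,2) s'(1,2) m(2)
  have [simp]: "Dom C k' = X" "Dom C s' = B"
    using arg_cong[OF k'(3), of "Dom C"] arg_cong[OF s'(3), of "Dom C"] by simp_all
  obtain z where z: "zero_object C z" using pointed by (auto simp: pointed_def)
  then have [simp]: "z \<in> Obj C" by (simp add: zero_object_def)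
  obtain v where v: "v \<in> Hom C z B" using z unfolding zero_object_def by (metis split_ext_simps(13)[OF S])
  obtain t where t: "t \<in> Hom C X z" using z unfolding zero_object_def by (metis split_ext_simps(11)[OF S])
  obtain i where i: "i \<in> Hom C z X" using z unfolding zero_object_def by (metis split_ext_simps(11)[OF S])
  have [simp]: "v \<in> Arr C" "Dom C v = z" "Cod C v = B" "t \<in> Arr C" "Dom C t = X" "Cod C t = z"
      "i \<in> Arr C" "Dom C i = z" "Cod C i = X"
    using v t i by simp_all
  have ti: "t \<cdot> i = \<one>z" by (rule zero_object_unique[OF z]) simp_all
  have "monic C k'"
    by (rule monic_right_factor[of m]) (simp_all add: k'(3) kernel_monic[OF split_extensionsD(11)[OF S]])
  then have ker: "is_kernel C k' (p \<cdot> m)"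
  proof (rule is_kernelI)
    fix x assume x: "x \<in> Arr C" "Cod C x = Dom C (p \<cdot> m)" "(p \<cdot> m) \<cdot> x = \<zero> (Dom C x) (Cod C (p \<cdot> m))"
    obtain u where u: "u \<in> Arr C" "Dom C u = Dom C x" "Cod C u = X" "k \<cdot> u = m \<cdot> x"
      by (rule kernel_lift[OF split_extensionsD(11)[OF S], of "m \<cdot> x"]) (use x in simp_all)
    have "m \<cdot> (k' \<cdot> u) = k \<cdot> u"
      by (rule extend[OF k'(3)]) (use u in simp_all)
    then have "m \<cdot> (k' \<cdot> u) = m \<cdot> x" using u by simp
    then have "k' \<cdot> u = x"
      by (rule monicD[OF m(1)]) (use u x in simp_all)
    then show "\<exists>u \<in> Arr C. Dom C u = Dom C x \<and> Cod C u = Dom C k' \<and> k' \<cdot> u = x"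
      using u by (intro bexI[of _ u]) simp_all
  qed (use k'(3) in simp_all)
  have s: "(p \<cdot> m) \<cdot> s' = \<one>B" using s'(3) by simp
  have "is_base_change C v (Dom C m, p \<cdot> m, s') (X, t, i) k'"
    unfolding is_base_change_def
  proof (simp add: Pt_Obj ti s'(3), intro conjI)
    show "is_pullback C (p \<cdot> m) v k' t" by (rule kernel_is_pullback[OF ker z]) simp_all
    show "k' \<cdot> i = s' \<cdot> v" by (rule zero_object_unique[OF z]) simp_all
  qed
  moreover have "is_base_change C v (E, p, s) (X, t, i) k"
    unfolding is_base_change_def
  proof (simp add: Pt_Obj ti, intro conjI)
    show "is_pullback C p v k t"
      by (rule kernel_is_pullback[OF split_extensionsD(11)[OF S] z]) simp_all
    show "k \<cdot> i = s \<cdot> v" by (rule zero_object_unique[OF z]) simp_all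
  qed
  moreover have "((Dom C m, p \<cdot> m, s'), m, (E, p, s)) \<in> Arr (Pt C (Cod C v))"
    by (simp add: Pt_Arr Pt_Obj s'(3))
  moreover have y: "((X, t, i), \<one>X, (X, t, i)) \<in> Arr (Pt C (Dom C v))"
    by (simp add: Pt_Arr Pt_Obj ti)
  moreover have "is_iso (Pt C (Dom C v)) ((X, t, i), \<one>X, (X, t, i))"
    unfolding is_iso_def
    by (rule conjI[OF y], rule bexI[of _ "((X, t, i), \<one>X, (X, t, i))"])
      (use y in \<open>simp_all add: Pt_simps Hom_def\<close>)
  moreover have "k \<cdot> \<one>X = m \<cdot> k'" using k'(3) by simp
  ultimately have "is_iso (Pt C (Cod C v)) ((Dom C m, p \<cdot> m, s'), m, (E, p, s))"
    using protomodular unfolding protomodular_def by (metis \<open>v \<in> Arr C\<close>)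
  then obtain g where g: "g \<in> Hom (Pt C B) (E, p, s) (Dom C m, p \<cdot> m, s')"
    "Comp (Pt C B) ((Dom C m, p \<cdot> m, s'), m, (E, p, s)) g = Id (Pt C B) (E, p, s)"
    unfolding is_iso_def by (auto simp: Pt_simps)
  obtain x w y where gw: "g = (x, w, y)" by (cases g)
  with g(1) have "x = (E, p, s)" "y = (Dom C m, p \<cdot> m, s')" by (auto simp: Hom_def Pt_simps)
  then have "w \<in> Hom C E (Dom C m)" "m \<cdot> w = \<one>E"
    using g gw by (simp_all add: Pt_simps Hom_def Pt_Arr)
  then show thesis using that unfolding in_Hom by blast
qed

text \<open>The equalizer of \<open>f\<close> and \<open>g\<close> contains the kernel and the section.\<close>

lemma split_extension_ext:
  assumes S: "(X, E, k, p, s) \<in> split_extensions C B"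
    and "f \<in> Arr C" "g \<in> Arr C" "Dom C f = E" "Dom C g = E" "f \<cdot> k = g \<cdot> k" "f \<cdot> s = g \<cdot> s"
  shows "f = g"
proof -
  note [simp] = split_ext_simps[OF S] assms(2-5)
  have [simp]: "Cod C f = Cod C g" using arg_cong[OF assms(6), of "Cod C"] by simp
  obtain e where e: "monic C e" "Cod C e = E" "f \<cdot> e = g \<cdot> e"
    "\<And>x. x \<in> Arr C \<Longrightarrow> Cod C x = E \<Longrightarrow> f \<cdot> x = g \<cdot> x \<Longrightarrow>
      \<exists>u \<in> Arr C. Dom C u = Dom C x \<and> Cod C u = Dom C e \<and> e \<cdot> u = x"
    by (rule equalizer_exists[of f g]) simp_all
  obtain k' where k': "k' \<in> Arr C" "Cod C k' = Dom C e" "e \<cdot> k' = k"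
    using e(4)[of k] assms(6) by auto
  obtain s' where s': "s' \<in> Arr C" "Cod C s' = Dom C e" "e \<cdot> s' = s"
    using e(4)[of s] assms(7) by auto
  obtain w where w: "w \<in> Arr C" "Dom C w = E" "Cod C w = Dom C e" "e \<cdot> w = \<one>E"
    by (rule split_extension_extremal[OF S e(1,2) k' s'])
  have "f \<cdot> (e \<cdot> w) = g \<cdot> (e \<cdot> w)"
    by (rule extend2[OF e(3)]) (use w e(2) monic_Arr[OF e(1)] in simp_all)
  then show ?thesis using w(4) by simp
qed

text \<open>The first projection of a kernel pair is split by the diagonal, and its kernel consists of the
  pairs \<open>(0, n)\<close>.\<close>

lemma kernel_pair_split_extension:
  assumes n: "is_kernel C n e" and R: "is_pullback C e e r\<^sub>1 r\<^sub>2"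
  obtains \<nu> \<delta> where "(Dom C n, Dom C r\<^sub>1, \<nu>, r\<^sub>1, \<delta>) \<in> split_extensions C (Dom C e)"
    "r\<^sub>2 \<cdot> \<delta> = \<one>(Dom C e)" "r\<^sub>2 \<cdot> \<nu> = n"
proof -
  note [simp] = is_kernelD(1-3)[OF n] is_pullbackD(4-8)[OF R]
  obtain \<delta> where d: "\<delta> \<in> Arr C" "Dom C \<delta> = Dom C e" "Cod C \<delta> = Dom C r\<^sub>1" "r\<^sub>1 \<cdot> \<delta> = \<one>(Dom C e)"
      "r\<^sub>2 \<cdot> \<delta> = \<one>(Dom C e)"
    by (rule pullback_lift[OF R, of "\<one>(Dom C e)" "\<one>(Dom C e)"]) simp_all
  obtain \<nu> where nu: "\<nu> \<in> Arr C" "Dom C \<nu> = Dom C n" "Cod C \<nu> = Dom C r\<^sub>1"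
      "r\<^sub>1 \<cdot> \<nu> = \<zero> (Dom C n) (Dom C e)" "r\<^sub>2 \<cdot> \<nu> = n"
    by (rule pullback_lift[OF R, of "\<zero> (Dom C n) (Dom C e)" n]) (simp_all add: is_kernelD(4)[OF n])
  note [simp] = d nu
  have "is_kernel C \<nu> r\<^sub>1"
  proof (rule is_kernelI)
    show "monic C \<nu>"
      by (rule monic_right_factor[of r\<^sub>2]) (simp_all add: kernel_monic[OF n])
    fix x assume x: "x \<in> Arr C" "Cod C x = Dom C r\<^sub>1" "r\<^sub>1 \<cdot> x = \<zero> (Dom C x) (Cod C r\<^sub>1)"
    have "e \<cdot> (r\<^sub>2 \<cdot> x) = e \<cdot> (r\<^sub>1 \<cdot> x)"
      by (rule extend2[OF is_pullbackD(9)[OF R, symmetric]]) (use x in simp_all)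
    then have ex: "e \<cdot> (r\<^sub>2 \<cdot> x) = \<zero> (Dom C x) (Cod C e)" using x by simp
    obtain u where u: "u \<in> Arr C" "Dom C u = Dom C x" "Cod C u = Dom C n" "n \<cdot> u = r\<^sub>2 \<cdot> x"
      by (rule kernel_lift[OF n, of "r\<^sub>2 \<cdot> x"]) (use x ex in simp_all)
    have "\<nu> \<cdot> u = x"
      by (rule pullback_ext[OF R]) (use x u in \<open>simp_all add: extend[OF nu(4)] extend[OF nu(5)]\<close>)
    then show "\<exists>u \<in> Arr C. Dom C u = Dom C x \<and> Cod C u = Dom C \<nu> \<and> \<nu> \<cdot> u = x"
      using u by (intro bexI[of _ u]) simp_all
  qed simp_all
  then have "(Dom C n, Dom C r\<^sub>1, \<nu>, r\<^sub>1, \<delta>) \<in> split_extensions C (Dom C e)"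
    by (rule split_extensionsI) simp_all
  then show thesis by (rule that) simp_all
qed

text \<open>A regular epimorphism is the cokernel of its kernel: two arrows from its kernel pair that
  agree on the diagonal and on the kernel are equal, because the kernel pair is a split extension.\<close>

lemma regular_epi_cokernel:
  assumes e: "regular_epi C e" and n: "is_kernel C n e"
    and t: "t \<in> Arr C" "Dom C t = Dom C e" "t \<cdot> n = \<zero> (Dom C n) (Cod C t)"
  obtains u where "u \<in> Arr C" "Dom C u = Cod C e" "Cod C u = Cod C t" "u \<cdot> e = t"
proof -
  note [simp] = regular_epi_Arr[OF e] is_kernelD(2,3)[OF n] t(1,2)
  obtain r1 r2 where R: "is_pullback C e e r1 r2" using pullback_exists[of e e] by auto
  note [simp] = is_pullbackD(4-8)[OF R]
  obtain \<nu> \<delta> where S: "(Dom C n, Dom C r1, \<nu>, r1, \<delta>) \<in> split_extensions C (Dom C e)"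
    and r2: "r2 \<cdot> \<delta> = \<one>(Dom C e)" "r2 \<cdot> \<nu> = n"
    by (rule kernel_pair_split_extension[OF n R])
  note [simp] = split_extensionsD(1-3,7-10)[OF S] split_extension_zero[OF S]
  have "t \<cdot> r1 = t \<cdot> r2"
    by (rule split_extension_ext[OF S]) (simp_all add: t(3) r2)
  then show thesis
    using coequalizer_factor[OF regular_epi_kernel_pair[OF e R] t(1,2)] that by blast
qed

text \<open>The pullback \<open>W\<close> of \<open>g\<close> along \<open>k'\<close> is again a split extension, with kernel \<open>X\<close>, over the kernel
  of \<open>a\<close>; the section of the latter is killed by \<open>W \<rightarrow> X'\<close>. So a subobject through which \<open>f\<close> factors
  contains the image of the regular epimorphism \<open>W \<rightarrow> X'\<close>.\<close>

lemma kernel_map_regular_epi: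
  assumes S: "(X, E, k, p, s) \<in> split_extensions C A"
    and S': "(X', E', k', p', s') \<in> split_extensions C A'"
    and g: "regular_epi C g" "g \<in> Hom C E E'" and f: "f \<in> Hom C X X'" and a: "a \<in> Hom C A A'"
    and gk: "g \<cdot> k = k' \<cdot> f" and pg: "p' \<cdot> g = a \<cdot> p" and gs: "g \<cdot> s = s' \<cdot> a"
  shows "regular_epi C f"
proof -
  note [simp] = split_ext_simps[OF S] split_ext_simps[OF S']
  have [simp]: "g \<in> Arr C" "Dom C g = E" "Cod C g = E'" "f \<in> Arr C" "Dom C f = X" "Cod C f = X'"
      "a \<in> Arr C" "Dom C a = A" "Cod C a = A'"
    using g(2) f a by simp_all
  note kmono = kernel_monic[OF split_extensionsD(11)[OF S]]
    and kmono' = kernel_monic[OF split_extensionsD(11)[OF S']]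
  obtain n where n: "is_kernel C n a" using kernel_exists[of a] by auto
  note [simp] = is_kernelD(2,3)[OF n] and nmono = kernel_monic[OF n]
  have an [simp]: "a \<cdot> n = \<zero> (Dom C n) A'" using is_kernelD(4)[OF n] by simp
  obtain w1 w2 where W: "is_pullback C g k' w1 w2" using pullback_exists[of g k'] by auto
  have [simp]: "w1 \<in> Arr C" "w2 \<in> Arr C" "Dom C w1 = Dom C w2" "Cod C w1 = E" "Cod C w2 = X'"
    using is_pullbackD(4-8)[OF W] by simp_all
  note gw = is_pullbackD(9)[OF W]
  have "a \<cdot> (p \<cdot> w1) = p' \<cdot> (g \<cdot> w1)"
    by (rule extend2[OF pg, symmetric]) simp_all
  also have "\<dots> = \<zero> (Dom C w2) A'"
    by (simp add: gw extend[OF split_extension_zero[OF S']])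
  finally have apw: "a \<cdot> (p \<cdot> w1) = \<zero> (Dom C w2) A'" .
  obtain \<pi> where pi: "\<pi> \<in> Arr C" "Dom C \<pi> = Dom C w2" "Cod C \<pi> = Dom C n" "n \<cdot> \<pi> = p \<cdot> w1"
    by (rule kernel_lift[OF n, of "p \<cdot> w1"]) (simp_all add: apw)
  have gsn: "g \<cdot> (s \<cdot> n) = s' \<cdot> (a \<cdot> n)"
    by (rule extend2[OF gs]) simp_all
  obtain \<sigma> where sg: "\<sigma> \<in> Arr C" "Dom C \<sigma> = Dom C n" "Cod C \<sigma> = Dom C w2" "w1 \<cdot> \<sigma> = s \<cdot> n"
      "w2 \<cdot> \<sigma> = \<zero> (Dom C n) X'"
    by (rule pullback_lift[OF W, of "s \<cdot> n" "\<zero> (Dom C n) X'"]) (simp_all add: gsn)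
  obtain \<kappa> where ka: "\<kappa> \<in> Arr C" "Dom C \<kappa> = X" "Cod C \<kappa> = Dom C w2" "w1 \<cdot> \<kappa> = k" "w2 \<cdot> \<kappa> = f"
    by (rule pullback_lift[OF W, of k f]) (simp_all add: gk)
  note [simp] = pi(1-3) sg(1-3) ka(1-3)
  have "is_kernel C \<kappa> \<pi>"
  proof (rule is_kernelI)
    show "monic C \<kappa>"
      by (rule monic_right_factor[of w1]) (simp_all add: ka(4) kmono)
    have "n \<cdot> (\<pi> \<cdot> \<kappa>) = p \<cdot> (w1 \<cdot> \<kappa>)"
      by (rule extend2[OF pi(4)]) simp_all
    then have "n \<cdot> (\<pi> \<cdot> \<kappa>) = n \<cdot> \<zero> X (Dom C n)" by (simp add: ka)
    then show "\<pi> \<cdot> \<kappa> = \<zero> (Dom C \<kappa>) (Cod C \<pi>)"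
      by (intro monicD[OF nmono, of "\<pi> \<cdot> \<kappa>"]) simp_all
    fix x assume x: "x \<in> Arr C" "Cod C x = Dom C \<pi>" "\<pi> \<cdot> x = \<zero> (Dom C x) (Cod C \<pi>)"
    have "p \<cdot> (w1 \<cdot> x) = n \<cdot> (\<pi> \<cdot> x)"
      by (rule extend2[OF pi(4)[symmetric]]) (use x in simp_all)
    then have pwx: "p \<cdot> (w1 \<cdot> x) = \<zero> (Dom C x) A" using x by simp
    obtain u where u: "u \<in> Arr C" "Dom C u = Dom C x" "Cod C u = X" "k \<cdot> u = w1 \<cdot> x"
      by (rule kernel_lift[OF split_extensionsD(11)[OF S], of "w1 \<cdot> x"]) (use x pwx in simp_all)
    have "k' \<cdot> (f \<cdot> u) = g \<cdot> (k \<cdot> u)"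
      by (rule extend2[OF gk[symmetric]]) (use u in simp_all)
    also have "\<dots> = k' \<cdot> (w2 \<cdot> x)"
      unfolding u(4) by (rule extend2[OF gw]) (use x in simp_all)
    finally have "f \<cdot> u = w2 \<cdot> x"
      by (rule monicD[OF kmono']) (use u x in simp_all)
    then have "\<kappa> \<cdot> u = x"
      by (intro pullback_ext[OF W, of "\<kappa> \<cdot> u" x])
        (use x u in \<open>simp_all add: extend[OF ka(4)] extend[OF ka(5)]\<close>)
    then show "\<exists>u \<in> Arr C. Dom C u = Dom C x \<and> Cod C u = Dom C \<kappa> \<and> \<kappa> \<cdot> u = x"
      using u by (intro bexI[of _ u]) simp_all
  qed simp_all
  moreover have "\<pi> \<cdot> \<sigma> = \<one>(Dom C n)"
  proof -
    have "n \<cdot> (\<pi> \<cdot> \<sigma>) = p \<cdot> (w1 \<cdot> \<sigma>)"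
      by (rule extend2[OF pi(4)]) simp_all
    also have "\<dots> = n \<cdot> \<one>(Dom C n)" by (simp add: sg extend[OF split_extensionsD(10)[OF S]])
    finally show ?thesis by (rule monicD[OF nmono]) simp_all
  qed
  ultimately have SW: "(X, Dom C w2, \<kappa>, \<pi>, \<sigma>) \<in> split_extensions C (Dom C n)"
    by (rule split_extensionsI) simp_all
  show ?thesis
  proof (rule regular_epiI)
    fix m f0 assume m: "monic C m" "f0 \<in> Arr C" "Cod C f0 = Dom C m" "Cod C m = Cod C f"
      "Dom C f0 = Dom C f" "m \<cdot> f0 = f"
    note [simp] = monic_Arr[OF m(1)] m(2,3)
    have [simp]: "Cod C m = X'" "Dom C f0 = X" using m by simp_all
    \<comment> \<open>The pullback of \<open>m\<close> to \<open>W\<close> contains the kernel and the section, so it is all of \<open>W\<close>.\<close>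
    obtain v1 v2 where V: "is_pullback C m w2 v1 v2" using pullback_exists[of m w2] by auto
    have [simp]: "v1 \<in> Arr C" "v2 \<in> Arr C" "Dom C v1 = Dom C v2" "Cod C v1 = Dom C m"
        "Cod C v2 = Dom C w2"
      using is_pullbackD(4-8)[OF V] by simp_all
    obtain k2 where k2: "k2 \<in> Arr C" "Cod C k2 = Dom C v2" "v2 \<cdot> k2 = \<kappa>"
      by (rule pullback_lift[OF V, of f0 \<kappa>]) (simp_all add: ka m(6))
    obtain s2 where s2: "s2 \<in> Arr C" "Cod C s2 = Dom C v2" "v2 \<cdot> s2 = \<sigma>"
      by (rule pullback_lift[OF V, of "\<zero> (Dom C n) (Dom C m)" \<sigma>]) (simp_all add: sg)
    obtain w where w: "w \<in> Arr C" "Dom C w = Dom C w2" "Cod C w = Dom C v2" "v2 \<cdot> w = \<one>(Dom C w2)"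
      by (rule split_extension_extremal[OF SW pullback_monic[OF V m(1)] _ k2 s2]) simp_all
    have "m \<cdot> (v1 \<cdot> w) = w2 \<cdot> (v2 \<cdot> w)"
      by (rule extend2[OF is_pullbackD(9)[OF V]]) (use w in simp_all)
    then have "m \<cdot> (v1 \<cdot> w) = w2" using w by simp
    then obtain d where "d \<in> Arr C" "Dom C d = Cod C m" "Cod C d = Dom C m" "m \<cdot> d = \<one>(Cod C m)"
      by (rule regular_epi_extremal[OF pullback_regular_epi[OF W g(1)] m(1)]) (use w in simp_all)
    then show "\<exists>w \<in> Arr C. Dom C w = Cod C m \<and> Cod C w = Dom C m \<and> m \<cdot> w = \<one>(Cod C m)"
      by blast
  qed simp
qed

section \<open>Coproducts and cosmash products\<close>

lemma injs_coproduct: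
  assumes "a \<in> Obj C" "b \<in> Obj C"
  shows "is_coproduct C a b (in\<^sub>1 C a b) (in\<^sub>2 C a b)"
proof -
  have "\<exists>x. case x of (i, j) \<Rightarrow> is_coproduct C a b i j"
    using binary_coproducts assms unfolding has_binary_coproducts_def by auto
  then have "case injs C a b of (i, j) \<Rightarrow> is_coproduct C a b i j"
    unfolding injs_def by (rule someI_ex)
  then show ?thesis by (simp add: in\<^sub>1_def in\<^sub>2_def split_beta)
qed

lemma in_typing [simp]:
  assumes "a \<in> Obj C" "b \<in> Obj C"
  shows "in\<^sub>1 C a b \<in> Arr C" "Dom C (in\<^sub>1 C a b) = a" "Cod C (in\<^sub>1 C a b) = a \<oplus> b"
    "in\<^sub>2 C a b \<in> Arr C" "Dom C (in\<^sub>2 C a b) = b" "Cod C (in\<^sub>2 C a b) = a \<oplus> b" "a \<oplus> b \<in> Obj C"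
  using injs_coproduct[OF assms] unfolding is_coproduct_def coprod_obj_def by auto

lemma cotuple_ex1:
  assumes "f \<in> Arr C" "g \<in> Arr C" "Cod C f = Cod C g"
  shows "\<exists>!u. u \<in> Hom C (Dom C f \<oplus> Dom C g) (Cod C f) \<and>
    u \<cdot> in\<^sub>1 C (Dom C f) (Dom C g) = f \<and> u \<cdot> in\<^sub>2 C (Dom C f) (Dom C g) = g"
proof -
  have "\<forall>c. \<forall>x \<in> Hom C (Dom C f) c. \<forall>y \<in> Hom C (Dom C g) c.
      \<exists>!u. u \<in> Hom C (Cod C (in\<^sub>1 C (Dom C f) (Dom C g))) c \<and>
        u \<cdot> in\<^sub>1 C (Dom C f) (Dom C g) = x \<and> u \<cdot> in\<^sub>2 C (Dom C f) (Dom C g) = y"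
    using injs_coproduct[of "Dom C f" "Dom C g"] assms unfolding is_coproduct_def by (metis Dom_Obj)
  moreover have "f \<in> Hom C (Dom C f) (Cod C f)" "g \<in> Hom C (Dom C g) (Cod C f)"
    using assms by simp_all
  ultimately show ?thesis using assms unfolding coprod_obj_def by blast
qed

lemma cotuple_props:
  assumes "f \<in> Arr C" "g \<in> Arr C" "Cod C f = Cod C g"
  shows "cotuple C f g \<in> Hom C (Dom C f \<oplus> Dom C g) (Cod C f) \<and>
    cotuple C f g \<cdot> in\<^sub>1 C (Dom C f) (Dom C g) = f \<and> cotuple C f g \<cdot> in\<^sub>2 C (Dom C f) (Dom C g) = g"
  unfolding cotuple_def by (rule theI'[OF cotuple_ex1[OF assms]])

lemma cotuple_typing [simp]:
  assumes "f \<in> Arr C" "g \<in> Arr C" "Cod C f = Cod C g"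
  shows "cotuple C f g \<in> Arr C" "Dom C (cotuple C f g) = Dom C f \<oplus> Dom C g"
    "Cod C (cotuple C f g) = Cod C f"
  using cotuple_props[OF assms] by simp_all

lemma cotuple_in [simp]:
  assumes "f \<in> Arr C" "g \<in> Arr C" "Cod C f = Cod C g" "Dom C f = a" "Dom C g = b"
  shows "cotuple C f g \<cdot> in\<^sub>1 C a b = f" "cotuple C f g \<cdot> in\<^sub>2 C a b = g"
  using cotuple_props[OF assms(1-3)] assms(4,5) by simp_all

lemma cotuple_in_Comp [simp]:
  assumes "f \<in> Arr C" "g \<in> Arr C" "Cod C f = Cod C g" "Dom C f = a" "Dom C g = b" "x \<in> Arr C"
  shows "Cod C x = a \<Longrightarrow> cotuple C f g \<cdot> (in\<^sub>1 C a b \<cdot> x) = f \<cdot> x"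
    "Cod C x = b \<Longrightarrow> cotuple C f g \<cdot> (in\<^sub>2 C a b \<cdot> x) = g \<cdot> x"
  using assms(1-3,6) assms(4,5)[symmetric] by (simp_all add: extend[OF cotuple_in(1)] extend[OF cotuple_in(2)])

lemma coprod_ext:
  assumes "u \<in> Arr C" "v \<in> Arr C" "a \<in> Obj C" "b \<in> Obj C" "Dom C u = a \<oplus> b" "Dom C v = a \<oplus> b"
    and eq: "u \<cdot> in\<^sub>1 C a b = v \<cdot> in\<^sub>1 C a b" "u \<cdot> in\<^sub>2 C a b = v \<cdot> in\<^sub>2 C a b"
  shows "u = v"
proof -
  note [simp] = assms(1-6)
  have cod: "Cod C u = Cod C v" using arg_cong[OF eq(1), of "Cod C"] by simp
  have "\<exists>!w. w \<in> Hom C (Dom C (u \<cdot> in\<^sub>1 C a b) \<oplus> Dom C (u \<cdot> in\<^sub>2 C a b)) (Cod C (u \<cdot> in\<^sub>1 C a b)) \<and>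
    w \<cdot> in\<^sub>1 C (Dom C (u \<cdot> in\<^sub>1 C a b)) (Dom C (u \<cdot> in\<^sub>2 C a b)) = u \<cdot> in\<^sub>1 C a b \<and>
    w \<cdot> in\<^sub>2 C (Dom C (u \<cdot> in\<^sub>1 C a b)) (Dom C (u \<cdot> in\<^sub>2 C a b)) = u \<cdot> in\<^sub>2 C a b"
    by (rule cotuple_ex1) simp_all
  then have "\<exists>!w. w \<in> Hom C (a \<oplus> b) (Cod C u) \<and> w \<cdot> in\<^sub>1 C a b = u \<cdot> in\<^sub>1 C a b \<and>
    w \<cdot> in\<^sub>2 C a b = u \<cdot> in\<^sub>2 C a b"
    by simp
  moreover have "u \<in> Hom C (a \<oplus> b) (Cod C u)" "v \<in> Hom C (a \<oplus> b) (Cod C u)"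
    using cod by simp_all
  ultimately show ?thesis using eq by metis
qed

lemma Comp_cotuple [simp]:
  assumes "t \<in> Arr C" "f \<in> Arr C" "g \<in> Arr C" "Cod C f = Cod C g" "Dom C t = Cod C f"
  shows "t \<cdot> cotuple C f g = cotuple C (t \<cdot> f) (t \<cdot> g)"
  by (rule coprod_ext[of _ _ "Dom C f" "Dom C g"]) (use assms in simp_all)

lemma Comp_cotuple_Comp [simp]:
  assumes "t \<in> Arr C" "f \<in> Arr C" "g \<in> Arr C" "Cod C f = Cod C g" "Dom C t = Cod C f" "x \<in> Arr C"
    "Cod C x = Dom C f \<oplus> Dom C g"
  shows "t \<cdot> (cotuple C f g \<cdot> x) = cotuple C (t \<cdot> f) (t \<cdot> g) \<cdot> x"
  by (rule extend[OF Comp_cotuple]) (use assms in simp_all)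

lemma cotuple_eta [simp]:
  assumes "a \<in> Obj C" "b \<in> Obj C"
  shows "cotuple C (in\<^sub>1 C a b) (in\<^sub>2 C a b) = \<one>(a \<oplus> b)"
  by (rule coprod_ext[of _ _ a b]) (use assms in simp_all)

lemma coprod_map_typing [simp]:
  assumes "f \<in> Arr C" "g \<in> Arr C"
  shows "coprod_map C f g \<in> Arr C" "Dom C (coprod_map C f g) = Dom C f \<oplus> Dom C g"
    "Cod C (coprod_map C f g) = Cod C f \<oplus> Cod C g"
  using assms by (simp_all add: coprod_map_def)

lemma projs_product:
  assumes "a \<in> Obj C" "b \<in> Obj C"
  shows "is_product C a b (fst (projs C a b)) (snd (projs C a b))"
proof -
  have "\<exists>x. case x of (i, j) \<Rightarrow> is_product C a b i j"
    using product_exists[OF assms] by auto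
  then have "case projs C a b of (i, j) \<Rightarrow> is_product C a b i j"
    unfolding projs_def by (rule someI_ex)
  then show ?thesis by (simp add: split_beta)
qed

lemma projs_typing [simp]:
  assumes "a \<in> Obj C" "b \<in> Obj C"
  shows "fst (projs C a b) \<in> Arr C" "Dom C (fst (projs C a b)) = a \<otimes> b" "Cod C (fst (projs C a b)) = a"
    "snd (projs C a b) \<in> Arr C" "Dom C (snd (projs C a b)) = a \<otimes> b" "Cod C (snd (projs C a b)) = b"
    "a \<otimes> b \<in> Obj C"
  using projs_product[OF assms] unfolding is_product_def prod_obj_def by auto

lemma tuple_ex1:
  assumes "f \<in> Arr C" "g \<in> Arr C" "Dom C f = Dom C g"
  shows "\<exists>!u. u \<in> Hom C (Dom C f) (Cod C f \<otimes> Cod C g) \<and>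
    fst (projs C (Cod C f) (Cod C g)) \<cdot> u = f \<and> snd (projs C (Cod C f) (Cod C g)) \<cdot> u = g"
proof -
  have "\<forall>c. \<forall>x \<in> Hom C c (Cod C f). \<forall>y \<in> Hom C c (Cod C g).
      \<exists>!u. u \<in> Hom C c (Dom C (fst (projs C (Cod C f) (Cod C g)))) \<and>
        fst (projs C (Cod C f) (Cod C g)) \<cdot> u = x \<and> snd (projs C (Cod C f) (Cod C g)) \<cdot> u = y"
    using projs_product[of "Cod C f" "Cod C g"] assms unfolding is_product_def by (metis Cod_Obj)
  moreover have "f \<in> Hom C (Dom C f) (Cod C f)" "g \<in> Hom C (Dom C f) (Cod C g)"
    using assms by simp_all
  ultimately show ?thesis using assms unfolding prod_obj_def by blast
qed

lemma tuple_props: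
  assumes "f \<in> Arr C" "g \<in> Arr C" "Dom C f = Dom C g"
  shows "tuple C f g \<in> Hom C (Dom C f) (Cod C f \<otimes> Cod C g) \<and>
    fst (projs C (Cod C f) (Cod C g)) \<cdot> tuple C f g = f \<and> snd (projs C (Cod C f) (Cod C g)) \<cdot> tuple C f g = g"
  unfolding tuple_def by (rule theI'[OF tuple_ex1[OF assms]])

lemma tuple_typing [simp]:
  assumes "f \<in> Arr C" "g \<in> Arr C" "Dom C f = Dom C g"
  shows "tuple C f g \<in> Arr C" "Dom C (tuple C f g) = Dom C g"
    "Cod C (tuple C f g) = Cod C f \<otimes> Cod C g"
  using tuple_props[OF assms] assms by simp_all

lemma tuple_Comp_zero_iff:
  assumes "f \<in> Arr C" "g \<in> Arr C" "Dom C f = Dom C g" "x \<in> Arr C" "Cod C x = Dom C g"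
  shows "tuple C f g \<cdot> x = \<zero> (Dom C x) (Cod C f \<otimes> Cod C g) \<longleftrightarrow>
    f \<cdot> x = \<zero> (Dom C x) (Cod C f) \<and> g \<cdot> x = \<zero> (Dom C x) (Cod C g)"
proof -
  let ?p = "fst (projs C (Cod C f) (Cod C g))" and ?q = "snd (projs C (Cod C f) (Cod C g))"
  note [simp] = assms
  have pq: "?p \<cdot> tuple C f g = f" "?q \<cdot> tuple C f g = g"
    using tuple_props[OF assms(1-3)] by simp_all
  have f: "?p \<cdot> (tuple C f g \<cdot> x) = f \<cdot> x" by (rule extend[OF pq(1)]) simp_all
  have g: "?q \<cdot> (tuple C f g \<cdot> x) = g \<cdot> x" by (rule extend[OF pq(2)]) simp_all
  show ?thesis
  proof
    assume "tuple C f g \<cdot> x = \<zero> (Dom C x) (Cod C f \<otimes> Cod C g)"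
    then show "f \<cdot> x = \<zero> (Dom C x) (Cod C f) \<and> g \<cdot> x = \<zero> (Dom C x) (Cod C g)"
      using f g by simp
  next
    assume 0: "f \<cdot> x = \<zero> (Dom C x) (Cod C f) \<and> g \<cdot> x = \<zero> (Dom C x) (Cod C g)"
    have "\<exists>!u. u \<in> Hom C (Dom C (f \<cdot> x)) (Cod C (f \<cdot> x) \<otimes> Cod C (g \<cdot> x)) \<and>
        fst (projs C (Cod C (f \<cdot> x)) (Cod C (g \<cdot> x))) \<cdot> u = f \<cdot> x \<and>
        snd (projs C (Cod C (f \<cdot> x)) (Cod C (g \<cdot> x))) \<cdot> u = g \<cdot> x"
      by (rule tuple_ex1) simp_all
    then have "\<exists>!u. u \<in> Hom C (Dom C x) (Cod C f \<otimes> Cod C g) \<and> ?p \<cdot> u = f \<cdot> x \<and> ?q \<cdot> u = g \<cdot> x"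
      by simp
    moreover have "tuple C f g \<cdot> x \<in> Hom C (Dom C x) (Cod C f \<otimes> Cod C g)"
      "\<zero> (Dom C x) (Cod C f \<otimes> Cod C g) \<in> Hom C (Dom C x) (Cod C f \<otimes> Cod C g)"
      "?p \<cdot> \<zero> (Dom C x) (Cod C f \<otimes> Cod C g) = f \<cdot> x" "?q \<cdot> \<zero> (Dom C x) (Cod C f \<otimes> Cod C g) = g \<cdot> x"
      using 0 by simp_all
    ultimately show "tuple C f g \<cdot> x = \<zero> (Dom C x) (Cod C f \<otimes> Cod C g)"
      using f g by blast
  qed
qed

lemma kernel_Eps: "f \<in> Arr C \<Longrightarrow> is_kernel C (SOME k. is_kernel C k f) f"
  using kernel_exists by (metis someI_ex)

lemma h\<^sub>2_kernel:
  assumes "a \<in> Obj C" "b \<in> Obj C"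
  shows "is_kernel C (h\<^sub>2 C a b) (\<Sigma>\<^sub>2 C a b)"
  unfolding h\<^sub>2_def by (rule kernel_Eps) (use assms in \<open>simp add: \<Sigma>\<^sub>2_def\<close>)

lemma h\<^sub>2_typing [simp]:
  assumes "a \<in> Obj C" "b \<in> Obj C"
  shows "h\<^sub>2 C a b \<in> Arr C" "Dom C (h\<^sub>2 C a b) = a \<diamond> b" "Cod C (h\<^sub>2 C a b) = a \<oplus> b" "a \<diamond> b \<in> Obj C"
proof -
  note h = is_kernelD[OF h\<^sub>2_kernel[OF assms]]
  show 1: "h\<^sub>2 C a b \<in> Arr C" "Dom C (h\<^sub>2 C a b) = a \<diamond> b" using h by (simp_all add: cosmash_def)
  show "Cod C (h\<^sub>2 C a b) = a \<oplus> b" using h(3) assms by (simp add: \<Sigma>\<^sub>2_def)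
  show "a \<diamond> b \<in> Obj C" using Dom_in_Obj[OF 1(1)] 1(2) by simp
qed

lemma h\<^sub>2_cancel:
  assumes "h\<^sub>2 C a b \<cdot> u = h\<^sub>2 C a b \<cdot> v" "a \<in> Obj C" "b \<in> Obj C" "u \<in> Arr C" "v \<in> Arr C"
    "Dom C u = Dom C v" "Cod C u = a \<diamond> b" "Cod C v = a \<diamond> b"
  shows "u = v"
  by (rule monicD[OF kernel_monic[OF h\<^sub>2_kernel] assms(1)]) (use assms in simp_all)

lemma h\<^sub>2_lift:
  assumes "a \<in> Obj C" "b \<in> Obj C" "x \<in> Arr C" "Cod C x = a \<oplus> b"
    "cotuple C (\<one>a) (\<zero> b a) \<cdot> x = \<zero> (Dom C x) a" "cotuple C (\<zero> a b) (\<one>b) \<cdot> x = \<zero> (Dom C x) b"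
  obtains u where "u \<in> Arr C" "Dom C u = Dom C x" "Cod C u = a \<diamond> b" "h\<^sub>2 C a b \<cdot> u = x"
proof -
  have "\<Sigma>\<^sub>2 C a b \<cdot> x = \<zero> (Dom C x) (Cod C (\<Sigma>\<^sub>2 C a b))"
    using assms tuple_Comp_zero_iff[of "cotuple C (\<one>a) (\<zero> b a)" "cotuple C (\<zero> a b) (\<one>b)" x]
    by (simp add: \<Sigma>\<^sub>2_def)
  then show thesis
    by (rule kernel_lift[OF h\<^sub>2_kernel[OF assms(1,2)] assms(3), rotated 1])
      (use assms that in \<open>simp_all add: \<Sigma>\<^sub>2_def\<close>)
qed

lemma \<Sigma>_h\<^sub>2:
  assumes "a \<in> Obj C" "b \<in> Obj C"
  shows "cotuple C (\<one>a) (\<zero> b a) \<cdot> h\<^sub>2 C a b = \<zero> (a \<diamond> b) a"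
    "cotuple C (\<zero> a b) (\<one>b) \<cdot> h\<^sub>2 C a b = \<zero> (a \<diamond> b) b"
proof -
  have "\<Sigma>\<^sub>2 C a b \<cdot> h\<^sub>2 C a b = \<zero> (a \<diamond> b) (a \<otimes> b)"
    using is_kernelD(4)[OF h\<^sub>2_kernel[OF assms]] assms by (simp add: \<Sigma>\<^sub>2_def)
  then show "cotuple C (\<one>a) (\<zero> b a) \<cdot> h\<^sub>2 C a b = \<zero> (a \<diamond> b) a"
    "cotuple C (\<zero> a b) (\<one>b) \<cdot> h\<^sub>2 C a b = \<zero> (a \<diamond> b) b"
    using assms tuple_Comp_zero_iff[of "cotuple C (\<one>a) (\<zero> b a)" "cotuple C (\<zero> a b) (\<one>b)" "h\<^sub>2 C a b"]
    by (simp_all add: \<Sigma>\<^sub>2_def)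
qed

text \<open>Such an arrow factors through a component of \<open>\<Sigma>\<^sub>2\<close>.\<close>

lemma cotuple_zero_h\<^sub>2 [simp]:
  assumes "f \<in> Arr C" "Dom C f = a" "Cod C f = c" "b \<in> Obj C"
  shows "cotuple C f (\<zero> b c) \<cdot> h\<^sub>2 C a b = \<zero> (a \<diamond> b) c"
    "cotuple C (\<zero> b c) f \<cdot> h\<^sub>2 C b a = \<zero> (b \<diamond> a) c"
proof -
  have [simp]: "a \<in> Obj C" "c \<in> Obj C" using assms by auto
  have "f \<cdot> (cotuple C (\<one>a) (\<zero> b a) \<cdot> h\<^sub>2 C a b) = \<zero> (a \<diamond> b) c"
    "f \<cdot> (cotuple C (\<zero> b a) (\<one>a) \<cdot> h\<^sub>2 C b a) = \<zero> (b \<diamond> a) c"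
    by (subst \<Sigma>_h\<^sub>2; use assms in simp)+
  then show "cotuple C f (\<zero> b c) \<cdot> h\<^sub>2 C a b = \<zero> (a \<diamond> b) c"
    "cotuple C (\<zero> b c) f \<cdot> h\<^sub>2 C b a = \<zero> (b \<diamond> a) c"
    using assms by simp_all
qed

lemma cotuple_zero_h\<^sub>2_Comp [simp]:
  assumes "f \<in> Arr C" "Dom C f = a" "Cod C f = c" "b \<in> Obj C" "x \<in> Arr C"
  shows "Cod C x = a \<diamond> b \<Longrightarrow> cotuple C f (\<zero> b c) \<cdot> (h\<^sub>2 C a b \<cdot> x) = \<zero> (Dom C x) c"
    "Cod C x = b \<diamond> a \<Longrightarrow> cotuple C (\<zero> b c) f \<cdot> (h\<^sub>2 C b a \<cdot> x) = \<zero> (Dom C x) c"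
proof -
  have [simp]: "a \<in> Obj C" "c \<in> Obj C" using assms by auto
  show "Cod C x = a \<diamond> b \<Longrightarrow> cotuple C f (\<zero> b c) \<cdot> (h\<^sub>2 C a b \<cdot> x) = \<zero> (Dom C x) c"
    "Cod C x = b \<diamond> a \<Longrightarrow> cotuple C (\<zero> b c) f \<cdot> (h\<^sub>2 C b a \<cdot> x) = \<zero> (Dom C x) c"
    using assms by (simp_all add: extend[OF cotuple_zero_h\<^sub>2(1)] extend[OF cotuple_zero_h\<^sub>2(2)])
qed

lemma h\<^sub>3_kernel:
  assumes "a \<in> Obj C" "b \<in> Obj C" "c \<in> Obj C"
  shows "is_kernel C (h\<^sub>3 C a b c) (\<Sigma>\<^sub>3 C a b c)"
  unfolding h\<^sub>3_def
  by (rule kernel_Eps) (use assms in \<open>simp add: \<Sigma>\<^sub>3_def tuple3_def cotuple3_def\<close>)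

lemma h\<^sub>3_typing [simp]:
  assumes "a \<in> Obj C" "b \<in> Obj C" "c \<in> Obj C"
  shows "h\<^sub>3 C a b c \<in> Arr C" "Dom C (h\<^sub>3 C a b c) = cosmash3 C a b c"
    "Cod C (h\<^sub>3 C a b c) = a \<oplus> b \<oplus> c" "cosmash3 C a b c \<in> Obj C"
proof -
  note h = is_kernelD[OF h\<^sub>3_kernel[OF assms]]
  show 1: "h\<^sub>3 C a b c \<in> Arr C" "Dom C (h\<^sub>3 C a b c) = cosmash3 C a b c"
    using h by (simp_all add: cosmash3_def)
  show "Cod C (h\<^sub>3 C a b c) = a \<oplus> b \<oplus> c"
    using h(3) assms by (simp add: \<Sigma>\<^sub>3_def tuple3_def cotuple3_def)
  show "cosmash3 C a b c \<in> Obj C" using Dom_in_Obj[OF 1(1)] 1(2) by simp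
qed

lemma \<Sigma>\<^sub>3_zero_iff:
  assumes "a \<in> Obj C" "b \<in> Obj C" "c \<in> Obj C" "x \<in> Arr C" "Cod C x = a \<oplus> b \<oplus> c"
  shows "\<Sigma>\<^sub>3 C a b c \<cdot> x = \<zero> (Dom C x) (Cod C (\<Sigma>\<^sub>3 C a b c)) \<longleftrightarrow>
    cotuple C (\<one>(a \<oplus> b)) (\<zero> c (a \<oplus> b)) \<cdot> x = \<zero> (Dom C x) (a \<oplus> b) \<and>
    cotuple C (cotuple C (in\<^sub>1 C a c) (\<zero> b (a \<oplus> c))) (in\<^sub>2 C a c) \<cdot> x = \<zero> (Dom C x) (a \<oplus> c) \<and>
    cotuple C (cotuple C (\<zero> a (b \<oplus> c)) (in\<^sub>1 C b c)) (in\<^sub>2 C b c) \<cdot> x = \<zero> (Dom C x) (b \<oplus> c)"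
  using assms
    tuple_Comp_zero_iff[of "tuple C (cotuple C (\<one>(a \<oplus> b)) (\<zero> c (a \<oplus> b)))
      (cotuple C (cotuple C (in\<^sub>1 C a c) (\<zero> b (a \<oplus> c))) (in\<^sub>2 C a c))"
      "cotuple C (cotuple C (\<zero> a (b \<oplus> c)) (in\<^sub>1 C b c)) (in\<^sub>2 C b c)" x]
    tuple_Comp_zero_iff[of "cotuple C (\<one>(a \<oplus> b)) (\<zero> c (a \<oplus> b))"
      "cotuple C (cotuple C (in\<^sub>1 C a c) (\<zero> b (a \<oplus> c))) (in\<^sub>2 C a c)" x]
  by (simp add: \<Sigma>\<^sub>3_def tuple3_def cotuple3_def)

lemma h\<^sub>3_zero:
  assumes "a \<in> Obj C" "b \<in> Obj C" "c \<in> Obj C"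
  shows "cotuple C (\<one>(a \<oplus> b)) (\<zero> c (a \<oplus> b)) \<cdot> h\<^sub>3 C a b c = \<zero> (cosmash3 C a b c) (a \<oplus> b)"
    "cotuple C (cotuple C (in\<^sub>1 C a c) (\<zero> b (a \<oplus> c))) (in\<^sub>2 C a c) \<cdot> h\<^sub>3 C a b c = \<zero> (cosmash3 C a b c) (a \<oplus> c)"
    "cotuple C (cotuple C (\<zero> a (b \<oplus> c)) (in\<^sub>1 C b c)) (in\<^sub>2 C b c) \<cdot> h\<^sub>3 C a b c = \<zero> (cosmash3 C a b c) (b \<oplus> c)"
  using is_kernelD(4)[OF h\<^sub>3_kernel[OF assms]] \<Sigma>\<^sub>3_zero_iff[of a b c "h\<^sub>3 C a b c"] assms by simp_all

text \<open>An arrow that vanishes on one of the three summands factors through a component of \<open>\<Sigma>\<^sub>3\<close>.\<close>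

lemma cotuple_zero_h\<^sub>3 [simp]:
  assumes "f \<in> Arr C" "g \<in> Arr C" "Cod C f = d" "Cod C g = d" "Dom C f = a" "Dom C g = b" "c \<in> Obj C"
  shows "cotuple C (cotuple C f g) (\<zero> c d) \<cdot> h\<^sub>3 C a b c = \<zero> (cosmash3 C a b c) d"
    "cotuple C (cotuple C f (\<zero> c d)) g \<cdot> h\<^sub>3 C a c b = \<zero> (cosmash3 C a c b) d"
    "cotuple C (cotuple C (\<zero> c d) f) g \<cdot> h\<^sub>3 C c a b = \<zero> (cosmash3 C c a b) d"
proof -
  have [simp]: "a \<in> Obj C" "b \<in> Obj C" "d \<in> Obj C" using assms by auto
  note [simp] = assms(1-7)
  have "cotuple C f g \<cdot> (cotuple C (\<one>(a \<oplus> b)) (\<zero> c (a \<oplus> b)) \<cdot> h\<^sub>3 C a b c) = \<zero> (cosmash3 C a b c) d"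
    "cotuple C f g \<cdot> (cotuple C (cotuple C (in\<^sub>1 C a b) (\<zero> c (a \<oplus> b))) (in\<^sub>2 C a b) \<cdot> h\<^sub>3 C a c b) = \<zero> (cosmash3 C a c b) d"
    "cotuple C f g \<cdot> (cotuple C (cotuple C (\<zero> c (a \<oplus> b)) (in\<^sub>1 C a b)) (in\<^sub>2 C a b) \<cdot> h\<^sub>3 C c a b) = \<zero> (cosmash3 C c a b) d"
    by (subst h\<^sub>3_zero; simp)+
  then show "cotuple C (cotuple C f g) (\<zero> c d) \<cdot> h\<^sub>3 C a b c = \<zero> (cosmash3 C a b c) d"
    "cotuple C (cotuple C f (\<zero> c d)) g \<cdot> h\<^sub>3 C a c b = \<zero> (cosmash3 C a c b) d"
    "cotuple C (cotuple C (\<zero> c d) f) g \<cdot> h\<^sub>3 C c a b = \<zero> (cosmash3 C c a b) d"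
    by simp_all
qed

lemma h\<^sub>3_lift:
  assumes "a \<in> Obj C" "b \<in> Obj C" "c \<in> Obj C" "x \<in> Arr C" "Cod C x = a \<oplus> b \<oplus> c"
    "cotuple C (\<one>(a \<oplus> b)) (\<zero> c (a \<oplus> b)) \<cdot> x = \<zero> (Dom C x) (a \<oplus> b)"
    "cotuple C (cotuple C (in\<^sub>1 C a c) (\<zero> b (a \<oplus> c))) (in\<^sub>2 C a c) \<cdot> x = \<zero> (Dom C x) (a \<oplus> c)"
    "cotuple C (cotuple C (\<zero> a (b \<oplus> c)) (in\<^sub>1 C b c)) (in\<^sub>2 C b c) \<cdot> x = \<zero> (Dom C x) (b \<oplus> c)"
  obtains u where "u \<in> Arr C" "Dom C u = Dom C x" "Cod C u = cosmash3 C a b c" "h\<^sub>3 C a b c \<cdot> u = x"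
proof -
  have "\<Sigma>\<^sub>3 C a b c \<cdot> x = \<zero> (Dom C x) (Cod C (\<Sigma>\<^sub>3 C a b c))"
    using \<Sigma>\<^sub>3_zero_iff[OF assms(1-5)] assms(6-8) by simp
  moreover have "Cod C x = Dom C (\<Sigma>\<^sub>3 C a b c)"
    using assms(1-5) by (simp add: \<Sigma>\<^sub>3_def tuple3_def cotuple3_def)
  ultimately obtain u where "u \<in> Arr C" "Dom C u = Dom C x" "Cod C u = Dom C (h\<^sub>3 C a b c)"
      "h\<^sub>3 C a b c \<cdot> u = x"
    using kernel_lift[OF h\<^sub>3_kernel[OF assms(1-3)] assms(4)] by blast
  then show thesis using that assms(1-3) by simp
qed

lemma h\<^sub>3_cancel:
  assumes "h\<^sub>3 C a b c \<cdot> u = h\<^sub>3 C a b c \<cdot> v" "a \<in> Obj C" "b \<in> Obj C" "c \<in> Obj C" "u \<in> Arr C" "v \<in> Arr C"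
    "Dom C u = Dom C v" "Cod C u = cosmash3 C a b c" "Cod C v = cosmash3 C a b c"
  shows "u = v"
  by (rule monicD[OF kernel_monic[OF h\<^sub>3_kernel] assms(1)]) (use assms in simp_all)

lemma the_h\<^sub>2_lift:
  assumes "a \<in> Obj C" "b \<in> Obj C" "x \<in> Arr C" "Cod C x = a \<oplus> b" "Dom C x = t"
    "cotuple C (\<one>a) (\<zero> b a) \<cdot> x = \<zero> t a" "cotuple C (\<zero> a b) (\<one>b) \<cdot> x = \<zero> t b"
  shows "(THE u. u \<in> Hom C t (a \<diamond> b) \<and> h\<^sub>2 C a b \<cdot> u = x) \<in> Hom C t (a \<diamond> b) \<and>
    h\<^sub>2 C a b \<cdot> (THE u. u \<in> Hom C t (a \<diamond> b) \<and> h\<^sub>2 C a b \<cdot> u = x) = x"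
proof (rule theI')
  obtain u where u: "u \<in> Arr C" "Dom C u = Dom C x" "Cod C u = a \<diamond> b" "h\<^sub>2 C a b \<cdot> u = x"
    by (rule h\<^sub>2_lift[of a b x]) (use assms in simp_all)
  show "\<exists>!u. u \<in> Hom C t (a \<diamond> b) \<and> h\<^sub>2 C a b \<cdot> u = x"
  proof (rule ex1I[of _ u])
    show "u \<in> Hom C t (a \<diamond> b) \<and> h\<^sub>2 C a b \<cdot> u = x"
      using u assms(5) by simp
    fix v assume "v \<in> Hom C t (a \<diamond> b) \<and> h\<^sub>2 C a b \<cdot> v = x"
    then show "v = u"
      by (intro h\<^sub>2_cancel[of a b v u]) (use u assms in simp_all)
  qed
qed

lemma cosmash_map_props:
  assumes "f \<in> Arr C" "g \<in> Arr C"
  shows "cosmash_map C f g \<in> Hom C (Dom C f \<diamond> Dom C g) (Cod C f \<diamond> Cod C g) \<and>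
    h\<^sub>2 C (Cod C f) (Cod C g) \<cdot> cosmash_map C f g = coprod_map C f g \<cdot> h\<^sub>2 C (Dom C f) (Dom C g)"
  unfolding cosmash_map_def by (rule the_h\<^sub>2_lift) (use assms in \<open>simp_all add: coprod_map_def\<close>)

lemma cosmash_map_typing [simp]:
  assumes "f \<in> Arr C" "g \<in> Arr C"
  shows "cosmash_map C f g \<in> Arr C" "Dom C (cosmash_map C f g) = Dom C f \<diamond> Dom C g"
    "Cod C (cosmash_map C f g) = Cod C f \<diamond> Cod C g"
  using cosmash_map_props[OF assms] by simp_all

lemma h\<^sub>2_cosmash_map [simp]:
  assumes "f \<in> Arr C" "g \<in> Arr C" "Cod C f = a" "Cod C g = b"
  shows "h\<^sub>2 C a b \<cdot> cosmash_map C f g = coprod_map C f g \<cdot> h\<^sub>2 C (Dom C f) (Dom C g)"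
  using cosmash_map_props[OF assms(1,2)] assms(3,4) by simp

lemma h\<^sub>2_cosmash_map_Comp [simp]:
  assumes "f \<in> Arr C" "g \<in> Arr C" "Cod C f = a" "Cod C g = b" "x \<in> Arr C" "Cod C x = Dom C f \<diamond> Dom C g"
  shows "h\<^sub>2 C a b \<cdot> (cosmash_map C f g \<cdot> x) = coprod_map C f g \<cdot> (h\<^sub>2 C (Dom C f) (Dom C g) \<cdot> x)"
  by (rule extend2[OF h\<^sub>2_cosmash_map]) (use assms in auto)

lemma cosmash_map_Comp [simp]:
  assumes "f \<in> Arr C" "g \<in> Arr C" "f' \<in> Arr C" "g' \<in> Arr C" "Dom C f = Cod C f'" "Dom C g = Cod C g'"
  shows "cosmash_map C f g \<cdot> cosmash_map C f' g' = cosmash_map C (f \<cdot> f') (g \<cdot> g')"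
  by (rule h\<^sub>2_cancel[of "Cod C f" "Cod C g"]) (use assms in \<open>simp_all add: coprod_map_def\<close>)

lemma cosmash_map_Id [simp]:
  assumes "a \<in> Obj C" "b \<in> Obj C"
  shows "cosmash_map C (\<one>a) (\<one>b) = \<one>(a \<diamond> b)"
  by (rule h\<^sub>2_cancel[of a b]) (use assms in \<open>simp_all add: coprod_map_def\<close>)

lemma cosmash_map_zero [simp]:
  assumes "a \<in> Obj C" "a' \<in> Obj C" "g \<in> Arr C"
  shows "cosmash_map C (\<zero> a a') g = \<zero> (a \<diamond> Dom C g) (a' \<diamond> Cod C g)"
proof (rule h\<^sub>2_cancel[of a' "Cod C g"])
  show "h\<^sub>2 C a' (Cod C g) \<cdot> cosmash_map C (\<zero> a a') g =
      h\<^sub>2 C a' (Cod C g) \<cdot> \<zero> (a \<diamond> Dom C g) (a' \<diamond> Cod C g)"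
    using assms by (simp add: coprod_map_def)
qed (use assms in simp_all)

lemma cosmash_map3_props:
  assumes "f \<in> Arr C" "g \<in> Arr C" "l \<in> Arr C"
  shows "cosmash_map3 C f g l \<in> Hom C (cosmash3 C (Dom C f) (Dom C g) (Dom C l))
      (cosmash3 C (Cod C f) (Cod C g) (Cod C l)) \<and>
    h\<^sub>3 C (Cod C f) (Cod C g) (Cod C l) \<cdot> cosmash_map3 C f g l =
      coprod_map3 C f g l \<cdot> h\<^sub>3 C (Dom C f) (Dom C g) (Dom C l)"
  unfolding cosmash_map3_def
proof (rule theI')
  obtain u where u: "u \<in> Arr C" "Dom C u = Dom C (coprod_map3 C f g l \<cdot> h\<^sub>3 C (Dom C f) (Dom C g) (Dom C l))"
      "Cod C u = cosmash3 C (Cod C f) (Cod C g) (Cod C l)"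
      "h\<^sub>3 C (Cod C f) (Cod C g) (Cod C l) \<cdot> u = coprod_map3 C f g l \<cdot> h\<^sub>3 C (Dom C f) (Dom C g) (Dom C l)"
    by (rule h\<^sub>3_lift[of "Cod C f" "Cod C g" "Cod C l" "coprod_map3 C f g l \<cdot> h\<^sub>3 C (Dom C f) (Dom C g) (Dom C l)"])
      (use assms in \<open>simp_all add: coprod_map3_def coprod_map_def\<close>)
  show "\<exists>!u. u \<in> Hom C (cosmash3 C (Dom C f) (Dom C g) (Dom C l))
      (cosmash3 C (Cod C f) (Cod C g) (Cod C l)) \<and>
    h\<^sub>3 C (Cod C f) (Cod C g) (Cod C l) \<cdot> u =
      coprod_map3 C f g l \<cdot> h\<^sub>3 C (Dom C f) (Dom C g) (Dom C l)" (is "\<exists>!u. ?P u")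
  proof (rule ex1I[of _ u])
    show "?P u" using u assms by (simp add: coprod_map3_def)
    fix v assume "?P v"
    then show "v = u"
      by (intro h\<^sub>3_cancel[of "Cod C f" "Cod C g" "Cod C l" v u])
        (use u assms in \<open>simp_all add: coprod_map3_def\<close>)
  qed
qed

lemma cosmash_map3_typing [simp]:
  assumes "f \<in> Arr C" "g \<in> Arr C" "l \<in> Arr C"
  shows "cosmash_map3 C f g l \<in> Arr C" "Dom C (cosmash_map3 C f g l) = cosmash3 C (Dom C f) (Dom C g) (Dom C l)"
    "Cod C (cosmash_map3 C f g l) = cosmash3 C (Cod C f) (Cod C g) (Cod C l)"
  using cosmash_map3_props[OF assms] by simp_all

lemma h\<^sub>3_cosmash_map3 [simp]:
  assumes "f \<in> Arr C" "g \<in> Arr C" "l \<in> Arr C" "Cod C f = a" "Cod C g = b" "Cod C l = c"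
  shows "h\<^sub>3 C a b c \<cdot> cosmash_map3 C f g l = coprod_map3 C f g l \<cdot> h\<^sub>3 C (Dom C f) (Dom C g) (Dom C l)"
  using cosmash_map3_props[OF assms(1-3)] assms(4-6) by simp

lemma h\<^sub>3_cosmash_map3_Comp [simp]:
  assumes "f \<in> Arr C" "g \<in> Arr C" "l \<in> Arr C" "Cod C f = a" "Cod C g = b" "Cod C l = c" "x \<in> Arr C"
    "Cod C x = cosmash3 C (Dom C f) (Dom C g) (Dom C l)"
  shows "h\<^sub>3 C a b c \<cdot> (cosmash_map3 C f g l \<cdot> x) =
    coprod_map3 C f g l \<cdot> (h\<^sub>3 C (Dom C f) (Dom C g) (Dom C l) \<cdot> x)"
  by (rule extend2[OF h\<^sub>3_cosmash_map3]) (use assms in \<open>auto simp: coprod_map3_def\<close>)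

lemma S_props:
  assumes "a \<in> Obj C" "b \<in> Obj C"
  shows "S\<^sub>2\<^sub>1 C a b \<in> Hom C (cosmash3 C a a b) (a \<diamond> b) \<and>
      h\<^sub>2 C a b \<cdot> S\<^sub>2\<^sub>1 C a b = coprod_map C (cotuple C (\<one>a) (\<one>a)) (\<one>b) \<cdot> h\<^sub>3 C a a b"
    "S\<^sub>1\<^sub>2 C a b \<in> Hom C (cosmash3 C a b b) (a \<diamond> b) \<and>
      h\<^sub>2 C a b \<cdot> S\<^sub>1\<^sub>2 C a b = cotuple3 C (in\<^sub>1 C a b) (in\<^sub>2 C a b) (in\<^sub>2 C a b) \<cdot> h\<^sub>3 C a b b"
  unfolding S\<^sub>2\<^sub>1_def S\<^sub>1\<^sub>2_def
  by (rule the_h\<^sub>2_lift; use assms in \<open>simp add: coprod_map_def cotuple3_def\<close>)+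

lemma S_simps [simp]:
  assumes "a \<in> Obj C" "b \<in> Obj C"
  shows "S\<^sub>2\<^sub>1 C a b \<in> Arr C" "Dom C (S\<^sub>2\<^sub>1 C a b) = cosmash3 C a a b" "Cod C (S\<^sub>2\<^sub>1 C a b) = a \<diamond> b"
    "h\<^sub>2 C a b \<cdot> S\<^sub>2\<^sub>1 C a b = coprod_map C (cotuple C (\<one>a) (\<one>a)) (\<one>b) \<cdot> h\<^sub>3 C a a b"
    "S\<^sub>1\<^sub>2 C a b \<in> Arr C" "Dom C (S\<^sub>1\<^sub>2 C a b) = cosmash3 C a b b" "Cod C (S\<^sub>1\<^sub>2 C a b) = a \<diamond> b"
    "h\<^sub>2 C a b \<cdot> S\<^sub>1\<^sub>2 C a b = cotuple3 C (in\<^sub>1 C a b) (in\<^sub>2 C a b) (in\<^sub>2 C a b) \<cdot> h\<^sub>3 C a b b"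
  using S_props[OF assms] by simp_all

lemma h\<^sub>2_S_Comp [simp]:
  assumes "a \<in> Obj C" "b \<in> Obj C" "x \<in> Arr C"
  shows "Cod C x = cosmash3 C a a b \<Longrightarrow> h\<^sub>2 C a b \<cdot> (S\<^sub>2\<^sub>1 C a b \<cdot> x) =
      coprod_map C (cotuple C (\<one>a) (\<one>a)) (\<one>b) \<cdot> (h\<^sub>3 C a a b \<cdot> x)"
    "Cod C x = cosmash3 C a b b \<Longrightarrow> h\<^sub>2 C a b \<cdot> (S\<^sub>1\<^sub>2 C a b \<cdot> x) =
      cotuple3 C (in\<^sub>1 C a b) (in\<^sub>2 C a b) (in\<^sub>2 C a b) \<cdot> (h\<^sub>3 C a b b \<cdot> x)"
  by (rule extend2[OF S_simps(4)] extend2[OF S_simps(8)]; use assms in \<open>simp add: cotuple3_def\<close>)+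


lemma injection_split_extension:
  assumes "a \<in> Obj C" "b \<in> Obj C" "is_kernel C \<kappa> (cotuple C (\<one>a) (\<zero> b a))"
  shows "(Dom C \<kappa>, a \<oplus> b, \<kappa>, cotuple C (\<one>a) (\<zero> b a), in\<^sub>1 C a b) \<in> split_extensions C a"
  by (rule split_extensionsI[OF assms(3)]) (use assms(1,2) in simp_all)

text \<open>The domain of \<open>\<kappa>\<close> is the object usually written \<open>a \<flat> b\<close>. It contains the summand \<open>b\<close>, and the
  cosmash product is the part on which the other component of \<open>\<Sigma>\<^sub>2\<close> vanishes as well.\<close>

lemma cosmash_split_extension:
  assumes "a \<in> Obj C" "b \<in> Obj C" and \<kappa>: "is_kernel C \<kappa> (cotuple C (\<one>a) (\<zero> b a))"
  obtains j \<eta> where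
    "(a \<diamond> b, Dom C \<kappa>, j, cotuple C (\<zero> a b) (\<one>b) \<cdot> \<kappa>, \<eta>) \<in> split_extensions C b"
    "\<kappa> \<cdot> j = h\<^sub>2 C a b" "\<kappa> \<cdot> \<eta> = in\<^sub>2 C a b"
proof -
  note [simp] = assms(1,2)
  have [simp]: "\<kappa> \<in> Arr C" "Cod C \<kappa> = a \<oplus> b"
    using is_kernelD[OF \<kappa>] by simp_all
  have \<kappa>0: "cotuple C (\<one>a) (\<zero> b a) \<cdot> \<kappa> = \<zero> (Dom C \<kappa>) a"
    using is_kernelD(4)[OF \<kappa>] by simp
  obtain j where j: "j \<in> Arr C" "Dom C j = a \<diamond> b" "Cod C j = Dom C \<kappa>" "\<kappa> \<cdot> j = h\<^sub>2 C a b"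
    by (rule kernel_lift[OF \<kappa>, of "h\<^sub>2 C a b"]) simp_all
  obtain \<eta> where \<eta>: "\<eta> \<in> Arr C" "Dom C \<eta> = b" "Cod C \<eta> = Dom C \<kappa>" "\<kappa> \<cdot> \<eta> = in\<^sub>2 C a b"
    by (rule kernel_lift[OF \<kappa>, of "in\<^sub>2 C a b"]) simp_all
  note [simp] = j \<eta>
  have "is_kernel C j (cotuple C (\<zero> a b) (\<one>b) \<cdot> \<kappa>)"
  proof (rule is_kernelI)
    show "monic C j"
      by (rule monic_right_factor[of \<kappa>]) (simp_all add: kernel_monic[OF h\<^sub>2_kernel])
    fix x assume x: "x \<in> Arr C" "Cod C x = Dom C (cotuple C (\<zero> a b) (\<one>b) \<cdot> \<kappa>)"
      "(cotuple C (\<zero> a b) (\<one>b) \<cdot> \<kappa>) \<cdot> x = \<zero> (Dom C x) (Cod C (cotuple C (\<zero> a b) (\<one>b) \<cdot> \<kappa>))"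
    obtain u where u: "u \<in> Arr C" "Dom C u = Dom C x" "Cod C u = a \<diamond> b" "h\<^sub>2 C a b \<cdot> u = \<kappa> \<cdot> x"
      by (rule h\<^sub>2_lift[of a b "\<kappa> \<cdot> x"]) (use x in \<open>simp_all add: extend[OF \<kappa>0]\<close>)
    have "\<kappa> \<cdot> (j \<cdot> u) = \<kappa> \<cdot> x"
      using u(1,3,4) by (simp add: extend[OF j(4)])
    then have "j \<cdot> u = x"
      by (rule monicD[OF kernel_monic[OF \<kappa>]]) (use u x in simp_all)
    then show "\<exists>u \<in> Arr C. Dom C u = Dom C x \<and> Cod C u = Dom C j \<and> j \<cdot> u = x"
      using u by (intro bexI[of _ u]) simp_all
  qed simp_all
  then have "(a \<diamond> b, Dom C \<kappa>, j, cotuple C (\<zero> a b) (\<one>b) \<cdot> \<kappa>, \<eta>) \<in> split_extensions C b"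
    by (rule split_extensionsI) simp_all
  then show thesis by (rule that) simp_all
qed

lemma split_extension_cotuple_regular_epi:
  assumes S: "(X, E, k, p, s) \<in> split_extensions C B"
  shows "regular_epi C (cotuple C s k)"
proof (rule regular_epiI)
  note [simp] = split_ext_simps[OF S]
  show "cotuple C s k \<in> Arr C" by simp
  fix m g assume m: "monic C m" "g \<in> Arr C" "Cod C g = Dom C m" "Cod C m = Cod C (cotuple C s k)"
    "Dom C g = Dom C (cotuple C s k)" "m \<cdot> g = cotuple C s k"
  note [simp] = monic_Arr[OF m(1)] m(2,3)
  have [simp]: "Cod C m = E" "Dom C g = B \<oplus> X" using m(4,5) by simp_all
  obtain w where "w \<in> Arr C" "Dom C w = E" "Cod C w = Dom C m" "m \<cdot> w = \<one>E"
    by (rule split_extension_extremal[OF S m(1), of "g \<cdot> in\<^sub>2 C B X" "g \<cdot> in\<^sub>1 C B X"])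
      (simp_all add: extend[OF m(6)])
  then show "\<exists>w \<in> Arr C. Dom C w = Cod C m \<and> Cod C w = Dom C m \<and> m \<cdot> w = \<one>(Cod C m)"
    by auto
qed

section \<open>Action cores\<close>

lemma split_extension_core:
  assumes S: "(X, E, k, p, s) \<in> split_extensions C A"
  obtains \<psi> where "\<psi> \<in> Arr C" "Dom C \<psi> = A \<diamond> X" "Cod C \<psi> = X"
    "k \<cdot> \<psi> = cotuple C s k \<cdot> h\<^sub>2 C A X"
proof -
  note [simp] = split_ext_simps[OF S]
  show thesis
    by (rule kernel_lift[OF split_extensionsD(11)[OF S], of "cotuple C s k \<cdot> h\<^sub>2 C A X"])
      (simp_all add: that)
qed

text \<open>The middle object \<open>E\<close> is the quotient of \<open>A \<oplus> X\<close> by the relation \<open>h = in\<^sub>2 \<cdot> \<psi>\<close>. The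
  kernel of \<open>\<langle>s, k\<rangle>\<close> lies in the kernel of \<open>\<langle>\<one>, \<zero>\<rangle>\<close>, which is generated by \<open>A \<diamond> X\<close> and \<open>X\<close>; on
  these the two ways of mapping to the target agree.\<close>

lemma action_core_universal:
  assumes S: "(X, E, k, p, s) \<in> split_extensions C A"
    and \<psi>: "\<psi> \<in> Hom C (A \<diamond> X) X" "k \<cdot> \<psi> = cotuple C s k \<cdot> h\<^sub>2 C A X"
    and f: "f \<in> Hom C A T" and g: "g \<in> Hom C X T"
    and fg: "cotuple C f g \<cdot> h\<^sub>2 C A X = g \<cdot> \<psi>"
  obtains u where "u \<in> Arr C" "Dom C u = E" "Cod C u = T" "u \<cdot> s = f" "u \<cdot> k = g"
proof -
  note [simp] = split_ext_simps[OF S]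
  have [simp]: "\<psi> \<in> Arr C" "Dom C \<psi> = A \<diamond> X" "Cod C \<psi> = X" "f \<in> Arr C" "Dom C f = A" "Cod C f = T"
      "g \<in> Arr C" "Dom C g = X" "Cod C g = T"
    using \<psi>(1) f g by simp_all
  have [simp]: "T \<in> Obj C" using Hom_Obj[OF f] by simp
  note kmono = kernel_monic[OF split_extensionsD(11)[OF S]]
  define \<rho> where "\<rho> = cotuple C s k"
  have \<rho>: "regular_epi C \<rho>" unfolding \<rho>_def by (rule split_extension_cotuple_regular_epi[OF S])
  have p\<rho>: "p \<cdot> \<rho> = cotuple C (\<one>A) (\<zero> X A)" by (simp add: \<rho>_def)
  have [simp]: "\<rho> \<in> Arr C" "Dom C \<rho> = A \<oplus> X" "Cod C \<rho> = E" by (simp_all add: \<rho>_def)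
  obtain n where n: "is_kernel C n \<rho>" using kernel_exists[of \<rho>] by auto
  have [simp]: "n \<in> Arr C" "Cod C n = A \<oplus> X" using is_kernelD[OF n] by simp_all
  have \<rho>n: "\<rho> \<cdot> n = \<zero> (Dom C n) E" using is_kernelD(4)[OF n] by simp
  obtain \<kappa> where \<kappa>: "is_kernel C \<kappa> (cotuple C (\<one>A) (\<zero> X A))"
    using kernel_exists[of "cotuple C (\<one>A) (\<zero> X A)"] by auto
  have [simp]: "\<kappa> \<in> Arr C" "Cod C \<kappa> = A \<oplus> X" using is_kernelD[OF \<kappa>] by simp_all
  have p\<rho>\<kappa>: "p \<cdot> (\<rho> \<cdot> \<kappa>) = \<zero> (Dom C \<kappa>) A"
    using is_kernelD(4)[OF \<kappa>] by (simp add: extend[OF p\<rho>])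
  have p\<rho>n: "cotuple C (\<one>A) (\<zero> X A) \<cdot> n = \<zero> (Dom C n) A"
  proof -
    have "cotuple C (\<one>A) (\<zero> X A) \<cdot> n = p \<cdot> (\<rho> \<cdot> n)"
      by (rule extend[OF p\<rho>, symmetric]) simp_all
    then show ?thesis by (simp add: \<rho>n)
  qed
  obtain n' where n': "n' \<in> Arr C" "Dom C n' = Dom C n" "Cod C n' = Dom C \<kappa>" "\<kappa> \<cdot> n' = n"
    by (rule kernel_lift[OF \<kappa>, of n]) (simp_all add: p\<rho>n)
  \<comment> \<open>The restriction of \<open>\<rho>\<close> to the kernels over \<open>A\<close>. It has the section \<open>\<eta>\<close>, and the kernel of \<open>\<rho>\<close>
    is the kernel of \<open>\<xi>\<close>.\<close>
  obtain \<xi> where \<xi>: "\<xi> \<in> Arr C" "Dom C \<xi> = Dom C \<kappa>" "Cod C \<xi> = X" "k \<cdot> \<xi> = \<rho> \<cdot> \<kappa>"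
    by (rule kernel_lift[OF split_extensionsD(11)[OF S], of "\<rho> \<cdot> \<kappa>"]) (simp_all add: p\<rho>\<kappa>)
  obtain j \<eta> where F: "(A \<diamond> X, Dom C \<kappa>, j, cotuple C (\<zero> A X) (\<one>X) \<cdot> \<kappa>, \<eta>) \<in> split_extensions C X"
    and j: "\<kappa> \<cdot> j = h\<^sub>2 C A X" and \<eta>: "\<kappa> \<cdot> \<eta> = in\<^sub>2 C A X"
    by (rule cosmash_split_extension[OF _ _ \<kappa>]) simp_all
  note [simp] = split_extensionsD(1-3,7-9)[OF F] n'(1-3) \<xi>(1-3)
  have k\<xi>: "k \<cdot> (\<xi> \<cdot> x) = \<rho> \<cdot> (\<kappa> \<cdot> x)" if "x \<in> Arr C" "Cod C x = Dom C \<kappa>" for x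
    by (rule extend2[OF \<xi>(4)]) (use that in simp_all)
  have "k \<cdot> (\<xi> \<cdot> j) = k \<cdot> \<psi>" by (simp add: k\<xi> j \<psi>(2)) (simp add: \<rho>_def)
  then have \<xi>j: "\<xi> \<cdot> j = \<psi>" by (rule monicD[OF kmono]) simp_all
  have "k \<cdot> (\<xi> \<cdot> \<eta>) = k \<cdot> \<one>X" by (simp add: k\<xi> \<eta>) (simp add: \<rho>_def)
  then have \<xi>\<eta>: "\<xi> \<cdot> \<eta> = \<one>X" by (rule monicD[OF kmono]) simp_all
  have "k \<cdot> (\<xi> \<cdot> n') = k \<cdot> \<zero> (Dom C n) X" by (simp add: k\<xi> n'(4) \<rho>n)
  then have \<xi>n: "\<xi> \<cdot> n' = \<zero> (Dom C n) X" by (rule monicD[OF kmono]) simp_all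
  have t\<kappa>: "cotuple C f g \<cdot> \<kappa> = g \<cdot> \<xi>"
    by (rule split_extension_ext[OF F]) (simp_all add: j \<eta> \<xi>j \<xi>\<eta> fg)
  have "cotuple C f g \<cdot> (\<kappa> \<cdot> n') = g \<cdot> (\<xi> \<cdot> n')"
    by (rule extend2[OF t\<kappa>]) simp_all
  then have tn: "cotuple C f g \<cdot> n = \<zero> (Dom C n) T" by (simp add: n'(4) \<xi>n)
  obtain u where u: "u \<in> Arr C" "Dom C u = E" "Cod C u = T" "u \<cdot> \<rho> = cotuple C f g"
    by (rule regular_epi_cokernel[OF \<rho> n, of "cotuple C f g"]) (simp_all add: tn)
  have "u \<cdot> s = (u \<cdot> \<rho>) \<cdot> in\<^sub>1 C A X" "u \<cdot> k = (u \<cdot> \<rho>) \<cdot> in\<^sub>2 C A X"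
    using u(1-3) by (simp_all add: \<rho>_def)
  then have "u \<cdot> s = f" "u \<cdot> k = g"
    unfolding u(4) by simp_all
  then show thesis by (rule that[OF u(1-3)])
qed

lemma coprod_map_regular_epi:
  assumes "regular_epi C r" "b \<in> Obj C"
  shows "regular_epi C (coprod_map C r (\<one>b))"
proof (rule regular_epiI)
  note [simp] = regular_epi_Arr[OF assms(1)] assms(2)
  show "coprod_map C r (\<one>b) \<in> Arr C" by simp
  fix m g assume m: "monic C m" "g \<in> Arr C" "Cod C g = Dom C m" "Cod C m = Cod C (coprod_map C r (\<one>b))"
    "Dom C g = Dom C (coprod_map C r (\<one>b))" "m \<cdot> g = coprod_map C r (\<one>b)"
  note [simp] = monic_Arr[OF m(1)] m(2,3)
  have [simp]: "Cod C m = Cod C r \<oplus> b" "Dom C g = Dom C r \<oplus> b" using m(4,5) by simp_all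
  have mg: "m \<cdot> (g \<cdot> x) = coprod_map C r (\<one>b) \<cdot> x" if "x \<in> Arr C" "Cod C x = Dom C r \<oplus> b" for x
    by (rule extend[OF m(6)]) (use that in simp_all)
  obtain d where d: "d \<in> Arr C" "Dom C d = Cod C r" "Cod C d = Dom C m" "m \<cdot> d = in\<^sub>1 C (Cod C r) b"
    by (rule diagonal_fill_in[OF assms(1) m(1), of "g \<cdot> in\<^sub>1 C (Dom C r) b" "in\<^sub>1 C (Cod C r) b"])
      (simp_all add: mg, simp add: coprod_map_def)
  have "m \<cdot> cotuple C d (g \<cdot> in\<^sub>2 C (Dom C r) b) = \<one>(Cod C m)"
    using d by (simp add: mg) (simp add: coprod_map_def)
  then show "\<exists>w \<in> Arr C. Dom C w = Cod C m \<and> Cod C w = Dom C m \<and> m \<cdot> w = \<one>(Cod C m)"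
    using d by (intro bexI[of _ "cotuple C d (g \<cdot> in\<^sub>2 C (Dom C r) b)"]) simp_all
qed

text \<open>By \<open>cosmash_split_extension\<close> the cosmash product is an iterated kernel, so that
  \<open>kernel_map_regular_epi\<close> applies twice: over \<open>r\<close>, and then over the identity of \<open>b\<close>.\<close>

lemma cosmash_map_regular_epi:
  assumes r: "regular_epi C r" and b: "b \<in> Obj C"
  shows "regular_epi C (cosmash_map C r (\<one>b))"
proof -
  note [simp] = regular_epi_Arr[OF r] b
  define A A' where "A = Dom C r" and "A' = Cod C r"
  have [simp]: "A \<in> Obj C" "A' \<in> Obj C" "Dom C r = A" "Cod C r = A'" by (simp_all add: A_def A'_def)
  obtain \<kappa> where \<kappa>: "is_kernel C \<kappa> (cotuple C (\<one>A) (\<zero> b A))"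
    using kernel_exists[of "cotuple C (\<one>A) (\<zero> b A)"] by auto
  obtain \<kappa>' where \<kappa>': "is_kernel C \<kappa>' (cotuple C (\<one>A') (\<zero> b A'))"
    using kernel_exists[of "cotuple C (\<one>A') (\<zero> b A')"] by auto
  have [simp]: "\<kappa> \<in> Arr C" "Cod C \<kappa> = A \<oplus> b" "\<kappa>' \<in> Arr C" "Cod C \<kappa>' = A' \<oplus> b"
    using is_kernelD[OF \<kappa>] is_kernelD[OF \<kappa>'] by simp_all
  have \<kappa>0: "cotuple C (\<one>A) (\<zero> b A) \<cdot> \<kappa> = \<zero> (Dom C \<kappa>) A"
    using is_kernelD(4)[OF \<kappa>] by simp
  have \<kappa>r: "cotuple C r (\<zero> b A') \<cdot> \<kappa> = \<zero> (Dom C \<kappa>) A'"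
  proof -
    have "r \<cdot> (cotuple C (\<one>A) (\<zero> b A) \<cdot> \<kappa>) = \<zero> (Dom C \<kappa>) A'" by (subst \<kappa>0) simp
    then show ?thesis by simp
  qed
  obtain \<phi> where \<phi>: "\<phi> \<in> Arr C" "Dom C \<phi> = Dom C \<kappa>" "Cod C \<phi> = Dom C \<kappa>'"
      "\<kappa>' \<cdot> \<phi> = coprod_map C r (\<one>b) \<cdot> \<kappa>"
    by (rule kernel_lift[OF \<kappa>', of "coprod_map C r (\<one>b) \<cdot> \<kappa>"]) (simp_all add: coprod_map_def \<kappa>r)
  note [simp] = \<phi>(1-3)
  have \<phi>_reg: "regular_epi C \<phi>"
    by (rule kernel_map_regular_epi[OF injection_split_extension[OF _ _ \<kappa>]
          injection_split_extension[OF _ _ \<kappa>'] coprod_map_regular_epi[OF r b], where a = r])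
      (simp_all add: \<phi>(4), simp_all add: coprod_map_def)
  obtain j \<eta> where F: "(A \<diamond> b, Dom C \<kappa>, j, cotuple C (\<zero> A b) (\<one>b) \<cdot> \<kappa>, \<eta>) \<in> split_extensions C b"
    and j: "\<kappa> \<cdot> j = h\<^sub>2 C A b" and \<eta>: "\<kappa> \<cdot> \<eta> = in\<^sub>2 C A b"
    by (rule cosmash_split_extension[OF _ _ \<kappa>]) simp_all
  obtain j' \<eta>' where F': "(A' \<diamond> b, Dom C \<kappa>', j', cotuple C (\<zero> A' b) (\<one>b) \<cdot> \<kappa>', \<eta>') \<in> split_extensions C b"
    and j': "\<kappa>' \<cdot> j' = h\<^sub>2 C A' b" and \<eta>': "\<kappa>' \<cdot> \<eta>' = in\<^sub>2 C A' b"
    by (rule cosmash_split_extension[OF _ _ \<kappa>']) simp_all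
  note [simp] = split_extensionsD(1-3,7-9)[OF F] split_extensionsD(1-3,7-9)[OF F']
  have \<kappa>\<phi>: "\<kappa>' \<cdot> (\<phi> \<cdot> x) = coprod_map C r (\<one>b) \<cdot> (\<kappa> \<cdot> x)" if "x \<in> Arr C" "Cod C x = Dom C \<kappa>" for x
    by (rule extend2[OF \<phi>(4)]) (use that in simp_all)
  have "\<kappa>' \<cdot> (\<phi> \<cdot> j) = \<kappa>' \<cdot> (j' \<cdot> cosmash_map C r (\<one>b))"
    by (simp add: \<kappa>\<phi> j extend[OF j'])
  then have \<phi>j: "\<phi> \<cdot> j = j' \<cdot> cosmash_map C r (\<one>b)"
    by (rule monicD[OF kernel_monic[OF \<kappa>']]) simp_all
  have "\<kappa>' \<cdot> (\<phi> \<cdot> \<eta>) = \<kappa>' \<cdot> \<eta>'"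
    by (simp add: \<kappa>\<phi> \<eta> \<eta>') (simp add: coprod_map_def)
  then have \<phi>\<eta>: "\<phi> \<cdot> \<eta> = \<eta>'"
    by (rule monicD[OF kernel_monic[OF \<kappa>']]) simp_all
  show ?thesis
    by (rule kernel_map_regular_epi[OF F F' \<phi>_reg, where a = "\<one>b"])
      (simp_all add: \<phi>j \<phi>\<eta> \<phi>(4), simp_all add: coprod_map_def)
qed

text \<open>The object \<open>(a \<oplus> y) \<diamond> x\<close> is an iterated split extension. Omitting the summand \<open>y\<close> maps it to
  \<open>a \<diamond> x\<close>; the kernel is mapped to \<open>y \<diamond> x\<close> by omitting \<open>a\<close>; what is left is the part of \<open>a \<oplus> y \<oplus> x\<close> on which
  the omission of any one summand vanishes. Both steps are split, hence the three pieces are jointly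
  epic.\<close>

lemma cosmash_coprod_ext:
  assumes "a \<in> Obj C" "y \<in> Obj C" "x \<in> Obj C"
    and \<theta>: "\<theta> \<in> Hom C (cosmash3 C a y x) ((a \<oplus> y) \<diamond> x)" "h\<^sub>2 C (a \<oplus> y) x \<cdot> \<theta> = h\<^sub>3 C a y x"
    and fg: "f \<in> Arr C" "g \<in> Arr C" "Dom C f = (a \<oplus> y) \<diamond> x" "Dom C g = (a \<oplus> y) \<diamond> x"
    and eq1: "f \<cdot> cosmash_map C (in\<^sub>1 C a y) (\<one>x) = g \<cdot> cosmash_map C (in\<^sub>1 C a y) (\<one>x)"
    and eq2: "f \<cdot> cosmash_map C (in\<^sub>2 C a y) (\<one>x) = g \<cdot> cosmash_map C (in\<^sub>2 C a y) (\<one>x)"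
    and eq3: "f \<cdot> \<theta> = g \<cdot> \<theta>"
  shows "f = g"
proof -
  note [simp] = assms(1-3) fg
  have [simp]: "\<theta> \<in> Arr C" "Dom C \<theta> = cosmash3 C a y x" "Cod C \<theta> = (a \<oplus> y) \<diamond> x"
    using \<theta>(1) by simp_all
  define p1 where "p1 = cosmash_map C (cotuple C (\<one>a) (\<zero> y a)) (\<one>x)"
  define p2 where "p2 = cosmash_map C (cotuple C (\<zero> a y) (\<one>y)) (\<one>x)"
  have [simp]: "p1 \<in> Arr C" "Dom C p1 = (a \<oplus> y) \<diamond> x" "Cod C p1 = a \<diamond> x"
    "p2 \<in> Arr C" "Dom C p2 = (a \<oplus> y) \<diamond> x" "Cod C p2 = y \<diamond> x"
    by (simp_all add: p1_def p2_def)
  have h1: "h\<^sub>2 C a x \<cdot> (p1 \<cdot> t) =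
      cotuple C (cotuple C (in\<^sub>1 C a x) (\<zero> y (a \<oplus> x))) (in\<^sub>2 C a x) \<cdot> (h\<^sub>2 C (a \<oplus> y) x \<cdot> t)"
    and h2: "h\<^sub>2 C y x \<cdot> (p2 \<cdot> t) =
      cotuple C (cotuple C (\<zero> a (y \<oplus> x)) (in\<^sub>1 C y x)) (in\<^sub>2 C y x) \<cdot> (h\<^sub>2 C (a \<oplus> y) x \<cdot> t)"
    if "t \<in> Arr C" "Cod C t = (a \<oplus> y) \<diamond> x" for t
    using that by (simp_all add: p1_def p2_def coprod_map_def)
  obtain k1 where k1: "is_kernel C k1 p1" using kernel_exists[of p1] by auto
  have [simp]: "k1 \<in> Arr C" "Cod C k1 = (a \<oplus> y) \<diamond> x" using is_kernelD[OF k1] by simp_all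
  have p1k1: "p1 \<cdot> k1 = \<zero> (Dom C k1) (a \<diamond> x)" using is_kernelD(4)[OF k1] by simp
  have S1: "(Dom C k1, (a \<oplus> y) \<diamond> x, k1, p1, cosmash_map C (in\<^sub>1 C a y) (\<one>x)) \<in> split_extensions C (a \<diamond> x)"
    by (rule split_extensionsI[OF k1]) (simp_all add: p1_def)
  have "h\<^sub>2 C a x \<cdot> (p1 \<cdot> \<theta>) = h\<^sub>2 C a x \<cdot> \<zero> (cosmash3 C a y x) (a \<diamond> x)"
    by (simp add: h1 \<theta>(2))
  then have p1\<theta>: "p1 \<cdot> \<theta> = \<zero> (cosmash3 C a y x) (a \<diamond> x)" by (rule h\<^sub>2_cancel) simp_all
  have "h\<^sub>2 C y x \<cdot> (p2 \<cdot> \<theta>) = h\<^sub>2 C y x \<cdot> \<zero> (cosmash3 C a y x) (y \<diamond> x)"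
    by (simp add: h2 \<theta>(2))
  then have p2\<theta>: "p2 \<cdot> \<theta> = \<zero> (cosmash3 C a y x) (y \<diamond> x)" by (rule h\<^sub>2_cancel) simp_all
  obtain k2 where k2: "k2 \<in> Arr C" "Dom C k2 = cosmash3 C a y x" "Cod C k2 = Dom C k1" "k1 \<cdot> k2 = \<theta>"
    by (rule kernel_lift[OF k1, of \<theta>]) (simp_all add: p1\<theta>)
  obtain s2 where s2: "s2 \<in> Arr C" "Dom C s2 = y \<diamond> x" "Cod C s2 = Dom C k1"
      "k1 \<cdot> s2 = cosmash_map C (in\<^sub>2 C a y) (\<one>x)"
    by (rule kernel_lift[OF k1, of "cosmash_map C (in\<^sub>2 C a y) (\<one>x)"]) (simp_all add: p1_def)
  note [simp] = k2(1-3) s2(1-3)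
  have "is_kernel C k2 (p2 \<cdot> k1)"
  proof (rule is_kernelI)
    show "monic C k2"
    proof (rule monic_right_factor[of "h\<^sub>2 C (a \<oplus> y) x \<cdot> k1"])
      show "monic C ((h\<^sub>2 C (a \<oplus> y) x \<cdot> k1) \<cdot> k2)"
        by (simp add: k2(4) \<theta>(2) kernel_monic[OF h\<^sub>3_kernel])
    qed simp_all
    show "(p2 \<cdot> k1) \<cdot> k2 = \<zero> (Dom C k2) (Cod C (p2 \<cdot> k1))"
      by (simp add: k2(4) p2\<theta>)
    fix t assume t: "t \<in> Arr C" "Cod C t = Dom C (p2 \<cdot> k1)"
      "(p2 \<cdot> k1) \<cdot> t = \<zero> (Dom C t) (Cod C (p2 \<cdot> k1))"
    then have [simp]: "Cod C t = Dom C k1" "t \<in> Arr C" by simp_all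
    have p2t: "p2 \<cdot> (k1 \<cdot> t) = \<zero> (Dom C t) (y \<diamond> x)" using t(3) by simp
    obtain u where u: "u \<in> Arr C" "Dom C u = Dom C t" "Cod C u = cosmash3 C a y x"
        "h\<^sub>3 C a y x \<cdot> u = h\<^sub>2 C (a \<oplus> y) x \<cdot> (k1 \<cdot> t)"
      by (rule h\<^sub>3_lift[of a y x "h\<^sub>2 C (a \<oplus> y) x \<cdot> (k1 \<cdot> t)"])
        (simp_all flip: h1 h2 add: extend[OF p1k1] p2t)
    have "h\<^sub>2 C (a \<oplus> y) x \<cdot> (\<theta> \<cdot> u) = h\<^sub>2 C (a \<oplus> y) x \<cdot> (k1 \<cdot> t)"
      using u(1-3) by (simp add: extend[OF \<theta>(2)] u(4))
    then have "\<theta> \<cdot> u = k1 \<cdot> t" by (rule h\<^sub>2_cancel) (use u in simp_all)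
    then have "k1 \<cdot> (k2 \<cdot> u) = k1 \<cdot> t" using u by (simp add: extend[OF k2(4)])
    then have "k2 \<cdot> u = t"
      by (rule monicD[OF kernel_monic[OF k1]]) (use u in simp_all)
    then show "\<exists>u \<in> Arr C. Dom C u = Dom C t \<and> Cod C u = Dom C k2 \<and> k2 \<cdot> u = t"
      using u by (intro bexI[of _ u]) simp_all
  qed simp_all
  then have S2: "(cosmash3 C a y x, Dom C k1, k2, p2 \<cdot> k1, s2) \<in> split_extensions C (y \<diamond> x)"
    by (rule split_extensionsI) (simp_all add: s2(4), simp add: p2_def)
  have "f \<cdot> k1 = g \<cdot> k1"
    by (rule split_extension_ext[OF S2]) (simp_all add: k2(4) s2(4) eq2 eq3)
  then show ?thesis
    by (rule split_extension_ext[OF S1, rotated -2]) (simp_all add: eq1)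
qed


text \<open>Equivariant pairs are morphisms of semidirect products.\<close>

lemma core_morphism:
  assumes S: "(X, E, k, p, s) \<in> split_extensions C A"
    and \<psi>: "\<psi> \<in> Hom C (A \<diamond> X) X" "k \<cdot> \<psi> = cotuple C s k \<cdot> h\<^sub>2 C A X"
    and S': "(X', E', k', p', s') \<in> split_extensions C A'"
    and \<psi>': "\<psi>' \<in> Hom C (A' \<diamond> X') X'" "k' \<cdot> \<psi>' = cotuple C s' k' \<cdot> h\<^sub>2 C A' X'"
    and f: "f \<in> Hom C X X'" and g: "g \<in> Hom C A A'"
    and equivariant: "f \<cdot> \<psi> = \<psi>' \<cdot> cosmash_map C g f"
  obtains u where "u \<in> Arr C" "Dom C u = E" "Cod C u = E'" "u \<cdot> k = k' \<cdot> f" "u \<cdot> s = s' \<cdot> g"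
    "p' \<cdot> u = g \<cdot> p"
proof -
  note [simp] = split_ext_simps[OF S] split_ext_simps[OF S']
  have [simp]: "\<psi> \<in> Arr C" "Dom C \<psi> = A \<diamond> X" "Cod C \<psi> = X" "\<psi>' \<in> Arr C" "Dom C \<psi>' = A' \<diamond> X'"
      "Cod C \<psi>' = X'" "f \<in> Arr C" "Dom C f = X" "Cod C f = X'" "g \<in> Arr C" "Dom C g = A" "Cod C g = A'"
    using \<psi>(1) \<psi>'(1) f g by simp_all
  have eq: "cotuple C (s' \<cdot> g) (k' \<cdot> f) \<cdot> h\<^sub>2 C A X = (k' \<cdot> f) \<cdot> \<psi>"
    by (simp add: equivariant extend[OF \<psi>'(2)]) (simp add: coprod_map_def)
  obtain u where u: "u \<in> Arr C" "Dom C u = E" "Cod C u = E'" "u \<cdot> s = s' \<cdot> g" "u \<cdot> k = k' \<cdot> f"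
    by (rule action_core_universal[OF S \<psi> _ _ eq, where T = E']) simp_all
  have "p' \<cdot> u = g \<cdot> p"
    by (rule split_extension_ext[OF S])
      (use u in \<open>simp_all add: extend[OF split_ext_simps(10)[OF S']] extend[OF split_extension_zero[OF S']]\<close>)
  then show thesis using that u by blast
qed

section \<open>Crossed modules\<close>

lemma crossed_modulesD:
  assumes "(X, A, \<psi>, d) \<in> crossed_modules C"
  shows "d \<in> Arr C" "Dom C d = X" "Cod C d = A" "\<psi> \<in> Arr C" "Dom C \<psi> = A \<diamond> X" "Cod C \<psi> = X"
    "X \<in> Obj C" "A \<in> Obj C"
    "d \<cdot> \<psi> = conjugation_core C A \<cdot> cosmash_map C (\<one>A) d"
    "\<psi> \<cdot> cosmash_map C d (\<one>X) = conjugation_core C X"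
    "\<psi> \<cdot> S\<^sub>1\<^sub>2 C A X = \<psi> \<cdot> S\<^sub>2\<^sub>1 C A X \<cdot> cosmash_map3 C (\<one>A) d (\<one>X)"
  using assms Hom_Obj[of d X A] unfolding crossed_modules_def is_action_core_def by auto

lemma crossed_module_core:
  assumes "(X, A, \<psi>, d) \<in> crossed_modules C"
  obtains E k p s where "(X, E, k, p, s) \<in> split_extensions C A" "k \<cdot> \<psi> = cotuple C s k \<cdot> h\<^sub>2 C A X"
  using assms unfolding crossed_modules_def is_action_core_def by auto

lemma conjugation_core_typing [simp]:
  assumes "a \<in> Obj C"
  shows "conjugation_core C a \<in> Arr C" "Dom C (conjugation_core C a) = a \<diamond> a"
    "Cod C (conjugation_core C a) = a"
  using assms by (simp_all add: conjugation_core_def)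

lemma conjugation_core_cosmash_map:
  assumes "f \<in> Arr C" "g \<in> Arr C" "Cod C f = a" "Cod C g = a"
  shows "conjugation_core C a \<cdot> cosmash_map C f g = cotuple C f g \<cdot> h\<^sub>2 C (Dom C f) (Dom C g)"
proof -
  have "a \<in> Obj C" using assms by auto
  then show ?thesis using assms by (simp add: conjugation_core_def coprod_map_def)
qed

lemma conjugation_core_natural:
  assumes "f \<in> Arr C" "Dom C f = a" "Cod C f = b"
  shows "conjugation_core C b \<cdot> cosmash_map C f f = f \<cdot> conjugation_core C a"
proof -
  have "a \<in> Obj C" "b \<in> Obj C" using assms by auto
  then show ?thesis using assms by (simp add: conjugation_core_def coprod_map_def)
qed

lemma S\<^sub>2\<^sub>1_natural:
  assumes "f \<in> Arr C" "g \<in> Arr C" "Dom C f = a" "Dom C g = b" "Cod C f = a'" "Cod C g = b'"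
  shows "S\<^sub>2\<^sub>1 C a' b' \<cdot> cosmash_map3 C f f g = cosmash_map C f g \<cdot> S\<^sub>2\<^sub>1 C a b"
proof -
  have [simp]: "a \<in> Obj C" "b \<in> Obj C" "a' \<in> Obj C" "b' \<in> Obj C" using assms by auto
  show ?thesis
    by (rule h\<^sub>2_cancel[of a' b'])
      (use assms in \<open>simp_all add: coprod_map3_def coprod_map_def cotuple3_def\<close>)
qed

lemma S\<^sub>1\<^sub>2_natural:
  assumes "f \<in> Arr C" "g \<in> Arr C" "Dom C f = a" "Dom C g = b" "Cod C f = a'" "Cod C g = b'"
  shows "S\<^sub>1\<^sub>2 C a' b' \<cdot> cosmash_map3 C f g g = cosmash_map C f g \<cdot> S\<^sub>1\<^sub>2 C a b"
proof -
  have [simp]: "a \<in> Obj C" "b \<in> Obj C" "a' \<in> Obj C" "b' \<in> Obj C" using assms by auto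
  show ?thesis
    by (rule h\<^sub>2_cancel[of a' b'])
      (use assms in \<open>simp_all add: coprod_map3_def coprod_map_def cotuple3_def\<close>)
qed

lemma cosmash_map3_Comp:
  assumes "f \<in> Arr C" "g \<in> Arr C" "l \<in> Arr C" "f' \<in> Arr C" "g' \<in> Arr C" "l' \<in> Arr C"
    "Dom C f = Cod C f'" "Dom C g = Cod C g'" "Dom C l = Cod C l'"
  shows "cosmash_map3 C f g l \<cdot> cosmash_map3 C f' g' l' = cosmash_map3 C (f \<cdot> f') (g \<cdot> g') (l \<cdot> l')"
  by (rule h\<^sub>3_cancel[of "Cod C f" "Cod C g" "Cod C l"])
    (use assms in \<open>simp_all add: coprod_map3_def coprod_map_def\<close>)

section \<open>Normal subobjects as crossed modules\<close>

text \<open>The conjugation action on the kernel of \<open>p\<close> belongs to the kernel pair of \<open>p\<close>, split by its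
  diagonal: composing its defining equation with the second projection gives the one of \<open>kernel_core\<close>.\<close>

lemma kernel_core_props:
  assumes d: "is_kernel C d p"
  shows "kernel_core C d \<in> Arr C" "Dom C (kernel_core C d) = Cod C d \<diamond> Dom C d"
    "Cod C (kernel_core C d) = Dom C d"
    "d \<cdot> kernel_core C d = cotuple C (\<one>(Cod C d)) d \<cdot> h\<^sub>2 C (Cod C d) (Dom C d)"
    "is_action_core C (Cod C d) (Dom C d) (kernel_core C d)"
proof -
  note [simp] = is_kernelD(1,2)[OF d]
  define Q Z where "Q = Dom C d" and "Z = Cod C d"
  have [simp]: "Dom C d = Q" "Cod C d = Z" "Dom C p = Z" "Q \<in> Obj C" "Z \<in> Obj C"
    using is_kernelD(3)[OF d] by (simp_all add: Q_def Z_def)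
  obtain r1 r2 where R: "is_pullback C p p r1 r2" using pullback_exists[of p p] by auto
  have [simp]: "r2 \<in> Arr C" "Dom C r2 = Dom C r1" "Cod C r2 = Z" using is_pullbackD[OF R] by simp_all
  obtain \<nu> \<delta> where S0: "(Dom C d, Dom C r1, \<nu>, r1, \<delta>) \<in> split_extensions C (Dom C p)"
    and r2: "r2 \<cdot> \<delta> = \<one>(Dom C p)" "r2 \<cdot> \<nu> = d"
    by (rule kernel_pair_split_extension[OF d R])
  have S: "(Q, Dom C r1, \<nu>, r1, \<delta>) \<in> split_extensions C Z" using S0 by simp
  note [simp] = split_extensionsD(1-3,7-9)[OF S]
  obtain \<chi> where \<chi>: "\<chi> \<in> Arr C" "Dom C \<chi> = Z \<diamond> Q" "Cod C \<chi> = Q"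
      "\<nu> \<cdot> \<chi> = cotuple C \<delta> \<nu> \<cdot> h\<^sub>2 C Z Q"
    by (rule split_extension_core[OF S])
  have "r2 \<cdot> (\<nu> \<cdot> \<chi>) = cotuple C (\<one>Z) d \<cdot> h\<^sub>2 C Z Q"
    unfolding \<chi>(4) by (simp add: r2)
  moreover have "r2 \<cdot> (\<nu> \<cdot> \<chi>) = d \<cdot> \<chi>"
    by (rule extend[OF r2(2)]) (simp_all add: \<chi>)
  ultimately have d\<chi>: "d \<cdot> \<chi> = cotuple C (\<one>Z) d \<cdot> h\<^sub>2 C Z Q" by simp
  have "kernel_core C d = \<chi>"
    unfolding kernel_core_def
  proof (rule the_equality)
    show "\<chi> \<in> Hom C (Cod C d \<diamond> Dom C d) (Dom C d) \<and>
        d \<cdot> \<chi> = conjugation_core C (Cod C d) \<cdot> cosmash_map C (\<one>(Cod C d)) d"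
      by (simp add: \<chi> d\<chi> conjugation_core_cosmash_map)
    fix \<chi>' assume "\<chi>' \<in> Hom C (Cod C d \<diamond> Dom C d) (Dom C d) \<and>
        d \<cdot> \<chi>' = conjugation_core C (Cod C d) \<cdot> cosmash_map C (\<one>(Cod C d)) d"
    then show "\<chi>' = \<chi>"
      by (intro monicD[OF kernel_monic[OF d], of \<chi>' \<chi>])
        (simp_all add: \<chi> d\<chi> conjugation_core_cosmash_map)
  qed
  moreover have "is_action_core C Z Q \<chi>"
    unfolding is_action_core_def using S \<chi> by auto
  ultimately show "kernel_core C d \<in> Arr C" "Dom C (kernel_core C d) = Cod C d \<diamond> Dom C d"
    "Cod C (kernel_core C d) = Dom C d"
    "d \<cdot> kernel_core C d = cotuple C (\<one>(Cod C d)) d \<cdot> h\<^sub>2 C (Cod C d) (Dom C d)"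
    "is_action_core C (Cod C d) (Dom C d) (kernel_core C d)"
    using \<chi> d\<chi> by simp_all
qed

text \<open>All equations may be checked after composition with the monic arrow \<open>d\<close>, where they are
  equations between arrows out of coproducts; in the third axiom both sides become the cotuple with
  components \<open>\<one>Z\<close>, \<open>d\<close>, \<open>d\<close>, restricted along \<open>h\<^sub>3\<close>.\<close>

lemma kernel_crossed_module:
  assumes d: "is_kernel C d p"
  shows "(Dom C d, Cod C d, kernel_core C d, d) \<in> crossed_modules C"
proof -
  note [simp] = is_kernelD(1,2)[OF d] kernel_core_props(1-3)[OF d]
  define Q Z where "Q = Dom C d" and "Z = Cod C d"
  have [simp]: "Dom C d = Q" "Cod C d = Z" "Q \<in> Obj C" "Z \<in> Obj C"
    by (simp_all add: Q_def Z_def)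
  note d\<chi> = kernel_core_props(4)[OF d, simplified]
  have "d \<cdot> (kernel_core C d \<cdot> cosmash_map C d (\<one>Q)) = d \<cdot> conjugation_core C Q"
    by (simp add: extend[OF d\<chi>]) (simp add: conjugation_core_def coprod_map_def)
  then have "kernel_core C d \<cdot> cosmash_map C d (\<one>Q) = conjugation_core C Q"
    by (rule monicD[OF kernel_monic[OF d]]) simp_all
  moreover have "d \<cdot> (kernel_core C d \<cdot> S\<^sub>1\<^sub>2 C Z Q) =
      d \<cdot> (kernel_core C d \<cdot> (S\<^sub>2\<^sub>1 C Z Q \<cdot> cosmash_map3 C (\<one>Z) d (\<one>Q)))"
    by (simp add: extend[OF d\<chi>]) (simp add: cotuple3_def coprod_map_def coprod_map3_def)
  then have "kernel_core C d \<cdot> S\<^sub>1\<^sub>2 C Z Q =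
      kernel_core C d \<cdot> (S\<^sub>2\<^sub>1 C Z Q \<cdot> cosmash_map3 C (\<one>Z) d (\<one>Q))"
    by (rule monicD[OF kernel_monic[OF d]]) simp_all
  ultimately show ?thesis
    using kernel_core_props(5)[OF d]
    by (simp add: crossed_modules_def d\<chi> conjugation_core_cosmash_map)
qed

section \<open>Images of crossed modules\<close>

text \<open>The axioms hold after composition with the monic arrows \<open>m\<close> and \<open>l\<close>, by naturality.\<close>

lemma sub_crossed_module:
  assumes M: "(X, A, \<psi>, d) \<in> crossed_modules C"
    and m: "monic C m" "m \<in> Hom C Y X" and l: "monic C l" "l \<in> Hom C B A"
    and b: "b \<in> Hom C Y B" "l \<cdot> b = d \<cdot> m"
    and \<theta>: "is_action_core C B Y \<theta>" "m \<cdot> \<theta> = \<psi> \<cdot> cosmash_map C l m"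
  shows "(Y, B, \<theta>, b) \<in> crossed_modules C"
proof -
  note [simp] = crossed_modulesD(1-8)[OF M]
  have [simp]: "m \<in> Arr C" "Dom C m = Y" "Cod C m = X" "l \<in> Arr C" "Dom C l = B" "Cod C l = A"
      "b \<in> Arr C" "Dom C b = Y" "Cod C b = B" "\<theta> \<in> Arr C" "Dom C \<theta> = B \<diamond> Y" "Cod C \<theta> = Y"
    using m(2) l(2) b(1) \<theta>(1) unfolding is_action_core_def by simp_all
  have [simp]: "Y \<in> Obj C" "B \<in> Obj C" using Hom_Obj[OF b(1)] by simp_all
  note m\<theta> = extend2[OF \<theta>(2), simplified] and lb = extend2[OF b(2), simplified]
  have "l \<cdot> (b \<cdot> \<theta>) = l \<cdot> (conjugation_core C B \<cdot> cosmash_map C (\<one>B) b)"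
  proof -
    have "l \<cdot> (b \<cdot> \<theta>) = d \<cdot> (\<psi> \<cdot> cosmash_map C l m)"
      by (simp add: lb \<theta>(2))
    also have "\<dots> = conjugation_core C A \<cdot> cosmash_map C l (d \<cdot> m)"
      by (simp add: extend2[OF crossed_modulesD(9)[OF M]])
    also have "\<dots> = conjugation_core C A \<cdot> (cosmash_map C l l \<cdot> cosmash_map C (\<one>B) b)"
      by (simp add: b(2))
    also have "\<dots> = l \<cdot> (conjugation_core C B \<cdot> cosmash_map C (\<one>B) b)"
      by (rule extend2[OF conjugation_core_natural]) simp_all
    finally show ?thesis .
  qed
  then have 1: "b \<cdot> \<theta> = conjugation_core C B \<cdot> cosmash_map C (\<one>B) b"
    by (rule monicD[OF l(1)]) simp_all
  have "m \<cdot> (\<theta> \<cdot> cosmash_map C b (\<one>Y)) = m \<cdot> conjugation_core C Y"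
  proof -
    have "m \<cdot> (\<theta> \<cdot> cosmash_map C b (\<one>Y)) = \<psi> \<cdot> cosmash_map C (d \<cdot> m) m"
      by (simp add: m\<theta> b(2))
    also have "\<dots> = \<psi> \<cdot> (cosmash_map C d (\<one>X) \<cdot> cosmash_map C m m)" by simp
    also have "\<dots> = conjugation_core C X \<cdot> cosmash_map C m m"
      by (rule extend[OF crossed_modulesD(10)[OF M]]) simp_all
    also have "\<dots> = m \<cdot> conjugation_core C Y" by (rule conjugation_core_natural) simp_all
    finally show ?thesis .
  qed
  then have 2: "\<theta> \<cdot> cosmash_map C b (\<one>Y) = conjugation_core C Y"
    by (rule monicD[OF m(1)]) simp_all
  have "m \<cdot> (\<theta> \<cdot> S\<^sub>1\<^sub>2 C B Y) = m \<cdot> (\<theta> \<cdot> (S\<^sub>2\<^sub>1 C B Y \<cdot> cosmash_map3 C (\<one>B) b (\<one>Y)))"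
  proof -
    have "m \<cdot> (\<theta> \<cdot> S\<^sub>1\<^sub>2 C B Y) = \<psi> \<cdot> (S\<^sub>1\<^sub>2 C A X \<cdot> cosmash_map3 C l m m)"
      by (simp add: m\<theta> S\<^sub>1\<^sub>2_natural[of l m B Y A X])
    also have "\<dots> = (\<psi> \<cdot> S\<^sub>2\<^sub>1 C A X \<cdot> cosmash_map3 C (\<one>A) d (\<one>X)) \<cdot> cosmash_map3 C l m m"
      by (rule extend[OF crossed_modulesD(11)[OF M]]) simp_all
    also have "\<dots> = \<psi> \<cdot> (S\<^sub>2\<^sub>1 C A X \<cdot> (cosmash_map3 C l l m \<cdot> cosmash_map3 C (\<one>B) b (\<one>Y)))"
      by (simp add: cosmash_map3_Comp b(2))
    also have "\<dots> = \<psi> \<cdot> (cosmash_map C l m \<cdot> (S\<^sub>2\<^sub>1 C B Y \<cdot> cosmash_map3 C (\<one>B) b (\<one>Y)))"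
      by (rule arg_cong[of _ _ "\<lambda>x. \<psi> \<cdot> x"], rule extend2[OF S\<^sub>2\<^sub>1_natural]) simp_all
    also have "\<dots> = m \<cdot> (\<theta> \<cdot> (S\<^sub>2\<^sub>1 C B Y \<cdot> cosmash_map3 C (\<one>B) b (\<one>Y)))"
      by (simp add: m\<theta>)
    finally show ?thesis .
  qed
  then have "\<theta> \<cdot> S\<^sub>1\<^sub>2 C B Y = \<theta> \<cdot> S\<^sub>2\<^sub>1 C B Y \<cdot> cosmash_map3 C (\<one>B) b (\<one>Y)"
    by (rule monicD[OF m(1)]) simp_all
  with 1 2 \<theta>(1) show ?thesis by (simp add: crossed_modules_def)
qed

text \<open>The image has to carry an action core, so it is formed at the level of semidirect products: the
  image \<open>I\<close> of the induced arrow between middle objects is a split extension over the image \<open>B\<close> of \<open>g\<close>.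
  Its kernel \<open>Y\<close> is the image of \<open>f\<close>, by \<open>kernel_map_regular_epi\<close>.\<close>

lemma crossed_module_image:
  assumes M: "(X, A, \<psi>, d) \<in> crossed_modules C" and M': "(X', A', \<psi>', d') \<in> crossed_modules C"
    and f: "f \<in> Hom C X X'" and g: "g \<in> Hom C A A'"
    and gd: "g \<cdot> d = d' \<cdot> f" and f\<psi>: "f \<cdot> \<psi> = \<psi>' \<cdot> cosmash_map C g f"
  obtains Y B \<theta> b q r m l where "(Y, B, \<theta>, b) \<in> crossed_modules C"
    "regular_epi C q" "q \<in> Hom C X Y" "regular_epi C r" "r \<in> Hom C A B"
    "r \<cdot> d = b \<cdot> q" "q \<cdot> \<psi> = \<theta> \<cdot> cosmash_map C r q"
    "monic C m" "m \<in> Hom C Y X'" "monic C l" "l \<in> Hom C B A'"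
    "l \<cdot> b = d' \<cdot> m" "m \<cdot> \<theta> = \<psi>' \<cdot> cosmash_map C l m" "m \<cdot> q = f" "l \<cdot> r = g"
proof -
  note [simp] = crossed_modulesD(1-8)[OF M] crossed_modulesD(1-8)[OF M']
  have [simp]: "f \<in> Arr C" "Dom C f = X" "Cod C f = X'" "g \<in> Arr C" "Dom C g = A" "Cod C g = A'"
    using f g by simp_all
  obtain E k p s where S: "(X, E, k, p, s) \<in> split_extensions C A"
    and k\<psi>: "k \<cdot> \<psi> = cotuple C s k \<cdot> h\<^sub>2 C A X" by (rule crossed_module_core[OF M])
  obtain E' k' p' s' where S': "(X', E', k', p', s') \<in> split_extensions C A'"
    and k'\<psi>': "k' \<cdot> \<psi>' = cotuple C s' k' \<cdot> h\<^sub>2 C A' X'" by (rule crossed_module_core[OF M'])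
  note [simp] = split_ext_simps[OF S] split_ext_simps[OF S']
  obtain \<phi> where \<phi>: "\<phi> \<in> Arr C" "Dom C \<phi> = E" "Cod C \<phi> = E'" "\<phi> \<cdot> k = k' \<cdot> f" "\<phi> \<cdot> s = s' \<cdot> g"
      "p' \<cdot> \<phi> = g \<cdot> p"
    by (rule core_morphism[OF S _ k\<psi> S' _ k'\<psi>' f g f\<psi>]) simp_all
  note [simp] = \<phi>(1-3)
  obtain r l where r: "regular_epi C r" "Dom C r = A" and l: "monic C l" "Cod C l = A'" "Cod C r = Dom C l"
    and lr: "l \<cdot> r = g" by (rule image_factorization[of g]) simp_all
  obtain v n where v: "regular_epi C v" "Dom C v = E" and n: "monic C n" "Cod C n = E'" "Cod C v = Dom C n"
    and nv: "n \<cdot> v = \<phi>" by (rule image_factorization[of \<phi>]) simp_all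
  define B I where "B = Dom C l" and "I = Dom C n"
  have [simp]: "r \<in> Arr C" "Dom C r = A" "Cod C r = B" "l \<in> Arr C" "Dom C l = B" "Cod C l = A'"
      "v \<in> Arr C" "Dom C v = E" "Cod C v = I" "n \<in> Arr C" "Dom C n = I" "Cod C n = E'"
    using r l v n regular_epi_Arr monic_Arr by (simp_all add: B_def I_def)
  have [simp]: "B \<in> Obj C" "I \<in> Obj C"
    unfolding B_def I_def by (rule Dom_in_Obj[OF monic_Arr], rule l n)+
  have lr': "l \<cdot> (r \<cdot> x) = g \<cdot> x" if "x \<in> Arr C" "Cod C x = A" for x
    by (rule extend[OF lr]) (use that in simp_all)
  have nv': "n \<cdot> (v \<cdot> x) = \<phi> \<cdot> x" if "x \<in> Arr C" "Cod C x = E" for x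
    by (rule extend[OF nv]) (use that in simp_all)
  obtain \<pi> where \<pi>: "\<pi> \<in> Arr C" "Dom C \<pi> = I" "Cod C \<pi> = B" "\<pi> \<cdot> v = r \<cdot> p" "l \<cdot> \<pi> = p' \<cdot> n"
    by (rule diagonal_fill_in[OF v(1) l(1), of "r \<cdot> p" "p' \<cdot> n"]) (simp_all add: lr' nv \<phi>(6))
  obtain \<sigma> where \<sigma>: "\<sigma> \<in> Arr C" "Dom C \<sigma> = B" "Cod C \<sigma> = I" "\<sigma> \<cdot> r = v \<cdot> s" "n \<cdot> \<sigma> = s' \<cdot> l"
    by (rule diagonal_fill_in[OF r(1) n(1), of "v \<cdot> s" "s' \<cdot> l"]) (simp_all add: lr nv' \<phi>(5))
  note [simp] = \<pi>(1-3) \<sigma>(1-3)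
  have l\<pi>: "l \<cdot> (\<pi> \<cdot> x) = p' \<cdot> (n \<cdot> x)" if "x \<in> Arr C" "Cod C x = I" for x
    by (rule extend2[OF \<pi>(5)]) (use that in simp_all)
  have "l \<cdot> (\<pi> \<cdot> \<sigma>) = l \<cdot> \<one>B"
    by (simp add: l\<pi> \<sigma>(5) extend[OF split_ext_simps(10)[OF S']])
  then have \<pi>\<sigma>: "\<pi> \<cdot> \<sigma> = \<one>B" by (rule monicD[OF l(1)]) simp_all
  obtain j where j: "is_kernel C j \<pi>" using kernel_exists[of \<pi>] by auto
  define Y where "Y = Dom C j"
  have [simp]: "j \<in> Arr C" "Dom C j = Y" "Cod C j = I" using is_kernelD[OF j] by (simp_all add: Y_def)
  have [simp]: "Y \<in> Obj C" unfolding Y_def by (rule Dom_in_Obj) simp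
  have \<pi>j: "\<pi> \<cdot> j = \<zero> Y B" using is_kernelD(4)[OF j] by simp
  have SI: "(Y, I, j, \<pi>, \<sigma>) \<in> split_extensions C B"
    by (rule split_extensionsI[OF j \<pi>\<sigma>]) simp_all
  obtain q where q: "q \<in> Arr C" "Dom C q = X" "Cod C q = Y" "j \<cdot> q = v \<cdot> k"
    by (rule kernel_lift[OF j, of "v \<cdot> k"]) (simp_all add: extend2[OF \<pi>(4)])
  have "p' \<cdot> (n \<cdot> j) = l \<cdot> (\<pi> \<cdot> j)" by (simp add: l\<pi>)
  then have pnj: "p' \<cdot> (n \<cdot> j) = \<zero> Y A'" by (simp add: \<pi>j)
  obtain m where m: "m \<in> Arr C" "Dom C m = Y" "Cod C m = X'" "k' \<cdot> m = n \<cdot> j"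
    by (rule kernel_lift[OF split_extensionsD(11)[OF S'], of "n \<cdot> j"]) (simp_all add: pnj)
  note [simp] = q(1-3) m(1-3) and kmono' = kernel_monic[OF split_extensionsD(11)[OF S']]
  have km: "k' \<cdot> (m \<cdot> x) = n \<cdot> (j \<cdot> x)" if "x \<in> Arr C" "Cod C x = Y" for x
    by (rule extend2[OF m(4)]) (use that in simp_all)
  have m_monic: "monic C m"
    unfolding monic_def
  proof (intro conjI ballI impI)
    fix x y assume xy: "x \<in> Arr C" "y \<in> Arr C"
      "Dom C x = Dom C y \<and> Cod C x = Dom C m \<and> Cod C y = Dom C m \<and> m \<cdot> x = m \<cdot> y"
    then have "n \<cdot> (j \<cdot> x) = n \<cdot> (j \<cdot> y)" by (simp flip: km)
    then have "j \<cdot> x = j \<cdot> y" by (rule monicD[OF n(1)]) (use xy in simp_all)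
    then show "x = y" by (rule monicD[OF kernel_monic[OF j]]) (use xy in simp_all)
  qed simp
  have "k' \<cdot> (m \<cdot> q) = k' \<cdot> f" by (simp add: km q(4) nv' \<phi>(4))
  then have mq: "m \<cdot> q = f" by (rule monicD[OF kmono']) simp_all
  have q_reg: "regular_epi C q"
    by (rule kernel_map_regular_epi[OF S SI v(1), where a = r]) (simp_all add: q(4) \<pi>(4) \<sigma>(4))
  obtain \<theta> where \<theta>: "\<theta> \<in> Arr C" "Dom C \<theta> = B \<diamond> Y" "Cod C \<theta> = Y" "j \<cdot> \<theta> = cotuple C \<sigma> j \<cdot> h\<^sub>2 C B Y"
    by (rule split_extension_core[OF SI])
  note [simp] = \<theta>(1-3)
  have "k' \<cdot> (m \<cdot> \<theta>) = k' \<cdot> (\<psi>' \<cdot> cosmash_map C l m)"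
    by (simp add: km \<theta>(4) extend[OF k'\<psi>'] \<sigma>(5)) (simp add: coprod_map_def m(4))
  then have m\<theta>: "m \<cdot> \<theta> = \<psi>' \<cdot> cosmash_map C l m" by (rule monicD[OF kmono']) simp_all
  obtain b where b: "b \<in> Arr C" "Dom C b = Y" "Cod C b = B" "b \<cdot> q = r \<cdot> d" "l \<cdot> b = d' \<cdot> m"
    by (rule diagonal_fill_in[OF q_reg l(1), of "r \<cdot> d" "d' \<cdot> m"]) (simp_all add: lr' gd mq)
  have I: "(Y, B, \<theta>, b) \<in> crossed_modules C"
  proof (rule sub_crossed_module[OF M' m_monic _ l(1) _ _ b(5) _ m\<theta>])
    show "is_action_core C B Y \<theta>" unfolding is_action_core_def using SI \<theta> by auto
  qed (simp_all add: b)
  have "m \<cdot> (q \<cdot> \<psi>) = f \<cdot> \<psi>" by (rule extend[OF mq]) simp_all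
  also have "\<dots> = \<psi>' \<cdot> (cosmash_map C l m \<cdot> cosmash_map C r q)" by (simp add: f\<psi> lr mq)
  also have "\<dots> = m \<cdot> (\<theta> \<cdot> cosmash_map C r q)"
    by (rule extend2[OF m\<theta>[symmetric]]) simp_all
  finally have q\<psi>: "q \<cdot> \<psi> = \<theta> \<cdot> cosmash_map C r q" by (rule monicD[OF m_monic]) simp_all
  show thesis
    by (rule that[OF I q_reg _ r(1) _ b(4)[symmetric] q\<psi> m_monic _ l(1) _ b(5) m\<theta> mq lr]) simp_all
qed

end

section \<open>Regular epimorphisms of crossed modules and of split extensions\<close>

lemma XMod_simps:
  "Obj (XMod C) = crossed_modules C" "Dom (XMod C) (x, fg, y) = x" "Cod (XMod C) (x, fg, y) = y"
  "Id (XMod C) (X, A, \<psi>, d) = ((X, A, \<psi>, d), (\<one>X, \<one>A), (X, A, \<psi>, d))"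
  "Comp (XMod C) (y, (f', g'), z) (x, (f, g), y') = (x, (f' \<cdot> f, g' \<cdot> g), z)"
  for C (structure)
  by (simp_all add: XMod_def)

lemma XMod_Arr:
  "((X, A, \<psi>, d), (f, g), (X', A', \<psi>', d')) \<in> Arr (XMod C) \<longleftrightarrow>
    (X, A, \<psi>, d) \<in> crossed_modules C \<and> (X', A', \<psi>', d') \<in> crossed_modules C \<and>
    f \<in> Hom C X X' \<and> g \<in> Hom C A A' \<and> g \<cdot> d = d' \<cdot> f \<and> f \<cdot> \<psi> = \<psi>' \<cdot> cosmash_map C g f"
  for C (structure)
  by (auto simp: XMod_def)

lemma XMod_ArrE:
  assumes "\<alpha> \<in> Arr (XMod C)"
  obtains X A \<psi> d f g X' A' \<psi>' d' where "\<alpha> = ((X, A, \<psi>, d), (f, g), (X', A', \<psi>', d'))"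
  using assms by (auto simp: XMod_def)

lemma SSE_simps:
  "Obj (SSE C B) = split_extensions C B" "Dom (SSE C B) (x, fg, y) = x" "Cod (SSE C B) (x, fg, y) = y"
  "Comp (SSE C B) (y, (f', g'), z) (x, (f, g), y') = (x, (f' \<cdot> f, g' \<cdot> g), z)"
  for C (structure)
  by (simp_all add: SSE_def)

lemma SSE_Arr:
  "((X, E, k, p, s), (f, g), (X', E', k', p', s')) \<in> Arr (SSE C B) \<longleftrightarrow>
    (X, E, k, p, s) \<in> split_extensions C B \<and> (X', E', k', p', s') \<in> split_extensions C B \<and>
    f \<in> Hom C X X' \<and> g \<in> Hom C E E' \<and> g \<cdot> k = k' \<cdot> f \<and> p' \<cdot> g = p \<and> g \<cdot> s = s'"
  for C (structure)
  by (auto simp: SSE_def)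

lemma SSE_ArrE:
  assumes "\<alpha> \<in> Arr (SSE C B)"
  obtains X E k p s f g X' E' k' p' s' where "\<alpha> = ((X, E, k, p, s), (f, g), (X', E', k', p', s'))"
  using assms by (auto simp: SSE_def)

context semi_abelian
begin

text \<open>Factor the given arrow through its image. The first factor coequalizes the same pair as the whole
  arrow, because the second one is componentwise monic; hence it factors through the whole arrow, which provides a
  section of the second factor.\<close>

lemma regular_epi_XMod:
  assumes "regular_epi (XMod C) ((X, A, \<psi>, d), (f, g), (X', A', \<psi>', d'))"
  shows "regular_epi C f" "regular_epi C g"
proof -
  let ?e = "((X, A, \<psi>, d), (f, g), (X', A', \<psi>', d'))"
  obtain \<alpha> \<beta> where c: "is_coequalizer (XMod C) \<alpha> \<beta> ?e"
    using assms by (auto simp: regular_epi_def)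
  have e: "?e \<in> Arr (XMod C)" using c by (simp add: is_coequalizer_def)
  then have M: "(X, A, \<psi>, d) \<in> crossed_modules C" and M': "(X', A', \<psi>', d') \<in> crossed_modules C"
    and f: "f \<in> Hom C X X'" and g: "g \<in> Hom C A A'"
    and gd: "g \<cdot> d = d' \<cdot> f" and f\<psi>: "f \<cdot> \<psi> = \<psi>' \<cdot> cosmash_map C g f"
    unfolding XMod_Arr by blast+
  note [simp] = crossed_modulesD(1-8)[OF M] crossed_modulesD(1-8)[OF M']
  obtain Y B \<theta> b q r m l where I: "(Y, B, \<theta>, b) \<in> crossed_modules C"
    and q: "regular_epi C q" "q \<in> Hom C X Y" and r: "regular_epi C r" "r \<in> Hom C A B"
    and rd: "r \<cdot> d = b \<cdot> q" and q\<psi>: "q \<cdot> \<psi> = \<theta> \<cdot> cosmash_map C r q"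
    and m: "monic C m" "m \<in> Hom C Y X'" and l: "monic C l" "l \<in> Hom C B A'"
    and lb: "l \<cdot> b = d' \<cdot> m" and m\<theta>: "m \<cdot> \<theta> = \<psi>' \<cdot> cosmash_map C l m"
    and mq: "m \<cdot> q = f" and lr: "l \<cdot> r = g"
    by (rule crossed_module_image[OF M M' f g gd f\<psi>])
  note [simp] = crossed_modulesD(1-8)[OF I]
  have [simp]: "f \<in> Arr C" "Dom C f = X" "Cod C f = X'" "g \<in> Arr C" "Dom C g = A" "Cod C g = A'"
      "q \<in> Arr C" "Dom C q = X" "Cod C q = Y" "r \<in> Arr C" "Dom C r = A" "Cod C r = B"
      "m \<in> Arr C" "Dom C m = Y" "Cod C m = X'" "l \<in> Arr C" "Dom C l = B" "Cod C l = A'"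
    using f g q(2) r(2) m(2) l(2) by simp_all
  \<comment> \<open>The first factor of the image factorization as an arrow of crossed modules.\<close>
  let ?q = "((X, A, \<psi>, d), (q, r), (Y, B, \<theta>, b))"
  have \<alpha>\<beta>: "\<alpha> \<in> Arr (XMod C)" "\<beta> \<in> Hom (XMod C) (Dom (XMod C) \<alpha>) (Cod (XMod C) \<alpha>)"
    "Dom (XMod C) ?e = Cod (XMod C) \<alpha>" "Comp (XMod C) ?e \<alpha> = Comp (XMod C) ?e \<beta>"
    using c unfolding is_coequalizer_def by blast+
  note \<alpha>\<beta> = \<alpha>\<beta>(1,2) \<alpha>\<beta>(3)[unfolded XMod_simps(2), symmetric] \<alpha>\<beta>(4)
  obtain x a1 a2 where \<alpha>: "\<alpha> = (x, (a1, a2), (X, A, \<psi>, d))"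
    using \<alpha>\<beta>(1,3) by (auto elim!: XMod_ArrE simp: XMod_simps)
  obtain b1 b2 where \<beta>: "\<beta> = (x, (b1, b2), (X, A, \<psi>, d))"
    using \<alpha>\<beta>(2) unfolding \<alpha> by (auto elim!: XMod_ArrE simp: XMod_simps Hom_def)
  have \<beta>': "\<beta> \<in> Arr (XMod C)" using \<alpha>\<beta>(2) by (simp add: Hom_def)
  obtain V W \<omega> w where x: "x = (V, W, \<omega>, w)" by (cases x)
  have [simp]: "a1 \<in> Arr C" "Dom C a1 = V" "Cod C a1 = X" "a2 \<in> Arr C" "Dom C a2 = W" "Cod C a2 = A"
      "b1 \<in> Arr C" "Dom C b1 = V" "Cod C b1 = X" "b2 \<in> Arr C" "Dom C b2 = W" "Cod C b2 = A"
    using \<alpha>\<beta>(1) \<beta>' unfolding \<alpha> \<beta> x XMod_Arr by simp_all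
  have fa: "f \<cdot> a1 = f \<cdot> b1" "g \<cdot> a2 = g \<cdot> b2"
    using \<alpha>\<beta>(4) by (simp_all add: \<alpha> \<beta> XMod_simps)
  have "m \<cdot> (q \<cdot> a1) = m \<cdot> (q \<cdot> b1)" "l \<cdot> (r \<cdot> a2) = l \<cdot> (r \<cdot> b2)"
    using fa by (simp_all add: extend[OF mq] extend[OF lr])
  then have qa: "q \<cdot> a1 = q \<cdot> b1" "r \<cdot> a2 = r \<cdot> b2"
    using monicD[OF m(1), of "q \<cdot> a1" "q \<cdot> b1"] monicD[OF l(1), of "r \<cdot> a2" "r \<cdot> b2"] by simp_all
  have factor: "\<exists>!u. u \<in> Hom (XMod C) (X', A', \<psi>', d') (Cod (XMod C) \<delta>) \<and> Comp (XMod C) u ?e = \<delta>"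
    if "\<delta> \<in> Arr (XMod C)" "Dom (XMod C) \<delta> = (X, A, \<psi>, d)" "Comp (XMod C) \<delta> \<alpha> = Comp (XMod C) \<delta> \<beta>" for \<delta>
  proof -
    have "\<forall>d0 \<in> Arr (XMod C). Dom (XMod C) d0 = Cod (XMod C) \<alpha> \<and>
        Comp (XMod C) d0 \<alpha> = Comp (XMod C) d0 \<beta> \<longrightarrow>
        (\<exists>!u. u \<in> Hom (XMod C) (Cod (XMod C) ?e) (Cod (XMod C) d0) \<and> Comp (XMod C) u ?e = d0)"
      using c unfolding is_coequalizer_def by (elim conjE)
    then show ?thesis using that \<alpha>\<beta>(3) by (simp add: XMod_simps)
  qed
  have "\<exists>!u. u \<in> Hom (XMod C) (X', A', \<psi>', d') (Cod (XMod C) ?q) \<and> Comp (XMod C) u ?e = ?q"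
    by (rule factor) (use M I rd q\<psi> in \<open>simp_all add: XMod_Arr XMod_simps \<alpha> \<beta> qa\<close>)
  then obtain u where u: "u \<in> Hom (XMod C) (X', A', \<psi>', d') (Y, B, \<theta>, b)" "Comp (XMod C) u ?e = ?q"
    unfolding XMod_simps by blast
  obtain u1 u2 where u12: "u = ((X', A', \<psi>', d'), (u1, u2), (Y, B, \<theta>, b))"
    using u(1) by (auto simp: Hom_def XMod_simps elim!: XMod_ArrE)
  have "u \<in> Arr (XMod C)" using u(1) by (simp add: Hom_def)
  then have u_arr: "u1 \<in> Hom C X' Y" "u2 \<in> Hom C A' B" "u2 \<cdot> d' = b \<cdot> u1" "u1 \<cdot> \<psi>' = \<theta> \<cdot> cosmash_map C u2 u1"
    unfolding u12 XMod_Arr by blast+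
  have [simp]: "u1 \<in> Arr C" "Dom C u1 = X'" "Cod C u1 = Y" "u2 \<in> Arr C" "Dom C u2 = A'" "Cod C u2 = B"
    using u_arr by simp_all
  have uf: "u1 \<cdot> f = q" "u2 \<cdot> g = r" using u(2) by (simp_all add: u12 XMod_simps)
  have "\<exists>!u. u \<in> Hom (XMod C) (X', A', \<psi>', d') (Cod (XMod C) ?e) \<and> Comp (XMod C) u ?e = ?e"
    by (rule factor) (use e \<alpha>\<beta>(4) in \<open>simp_all add: XMod_simps\<close>)
  moreover have "((X', A', \<psi>', d'), (\<one>X', \<one>A'), (X', A', \<psi>', d')) \<in>
      Hom (XMod C) (X', A', \<psi>', d') (Cod (XMod C) ?e)"
    using M' by (simp add: Hom_def XMod_simps XMod_Arr)
  moreover have "((X', A', \<psi>', d'), (m \<cdot> u1, l \<cdot> u2), (X', A', \<psi>', d')) \<in>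
      Hom (XMod C) (X', A', \<psi>', d') (Cod (XMod C) ?e)"
  proof -
    have "l \<cdot> (u2 \<cdot> d') = d' \<cdot> (m \<cdot> u1)"
      unfolding u_arr(3) by (rule extend2[OF lb]) simp_all
    moreover have "m \<cdot> (u1 \<cdot> \<psi>') = \<psi>' \<cdot> cosmash_map C (l \<cdot> u2) (m \<cdot> u1)"
    proof -
      have "m \<cdot> (\<theta> \<cdot> cosmash_map C u2 u1) = \<psi>' \<cdot> (cosmash_map C l m \<cdot> cosmash_map C u2 u1)"
        by (rule extend2[OF m\<theta>]) simp_all
      then show ?thesis by (simp add: u_arr(4))
    qed
    ultimately show ?thesis using M' by (simp add: Hom_def[of "XMod C"] XMod_simps XMod_Arr)
  qed
  moreover have "Comp (XMod C) ((X', A', \<psi>', d'), (\<one>X', \<one>A'), (X', A', \<psi>', d')) ?e = ?e"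
    "Comp (XMod C) ((X', A', \<psi>', d'), (m \<cdot> u1, l \<cdot> u2), (X', A', \<psi>', d')) ?e = ?e"
    by (simp_all add: XMod_simps uf mq lr)
  ultimately have "((X', A', \<psi>', d'), (\<one>X', \<one>A'), (X', A', \<psi>', d')) =
      ((X', A', \<psi>', d'), (m \<cdot> u1, l \<cdot> u2), (X', A', \<psi>', d'))"
    by blast
  then have "m \<cdot> u1 = \<one>X'" "l \<cdot> u2 = \<one>A'" by simp_all
  then have "regular_epi C (m \<cdot> q)" "regular_epi C (l \<cdot> r)"
    using regular_epi_Comp_iso[OF q(1) m(1), of u1] regular_epi_Comp_iso[OF r(1) l(1), of u2]
    by simp_all
  then show "regular_epi C f" "regular_epi C g" by (simp_all add: mq lr)
qed

text \<open>The middle component \<open>g\<close> is extremal since the section and the kernel of the target lie in its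
  image, and the kernel pair of \<open>g\<close> is itself a split extension over \<open>B\<close>, of which the given arrow is the
  coequalizer.\<close>

lemma regular_epi_SSE:
  assumes S: "(X, E, k, p, s) \<in> split_extensions C B" and S': "(X', E', k', p', s') \<in> split_extensions C B"
    and f: "f \<in> Hom C X X'" and g: "g \<in> Hom C E E'"
    and gk: "g \<cdot> k = k' \<cdot> f" and pg: "p' \<cdot> g = p" and gs: "g \<cdot> s = s'" and f_reg: "regular_epi C f"
  shows "regular_epi (SSE C B) ((X, E, k, p, s), (f, g), (X', E', k', p', s'))"
proof -
  note [simp] = split_ext_simps[OF S] split_ext_simps[OF S']
  have [simp]: "f \<in> Arr C" "Dom C f = X" "Cod C f = X'" "g \<in> Arr C" "Dom C g = E" "Cod C g = E'"
    using f g by simp_all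
  have g_reg: "regular_epi C g"
  proof (rule regular_epiI)
    fix m g0 assume m: "monic C m" "g0 \<in> Arr C" "Cod C g0 = Dom C m" "Cod C m = Cod C g"
      "Dom C g0 = Dom C g" "m \<cdot> g0 = g"
    note [simp] = monic_Arr[OF m(1)] m(2,3)
    have [simp]: "Cod C m = E'" "Dom C g0 = E" using m(4,5) by simp_all
    have mg: "m \<cdot> (g0 \<cdot> x) = g \<cdot> x" if "x \<in> Arr C" "Cod C x = E" for x
      by (rule extend[OF m(6)]) (use that in simp_all)
    obtain d where d: "d \<in> Arr C" "Cod C d = Dom C m" "m \<cdot> d = k'"
      by (rule diagonal_fill_in[OF f_reg m(1), of "g0 \<cdot> k" k']) (simp_all add: mg gk)
    obtain w where "w \<in> Arr C" "Dom C w = E'" "Cod C w = Dom C m" "m \<cdot> w = \<one>E'"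
      by (rule split_extension_extremal[OF S' m(1) _ d, of "g0 \<cdot> s"]) (simp_all add: mg gs)
    then show "\<exists>w \<in> Arr C. Dom C w = Cod C m \<and> Cod C w = Dom C m \<and> m \<cdot> w = \<one>(Cod C m)"
      by auto
  qed simp
  note kmono = kernel_monic[OF split_extensionsD(11)[OF S]]
    and kmono' = kernel_monic[OF split_extensionsD(11)[OF S']]
  obtain r1 r2 where R: "is_pullback C g g r1 r2" using pullback_exists[of g g] by auto
  have [simp]: "r1 \<in> Arr C" "r2 \<in> Arr C" "Dom C r2 = Dom C r1" "Cod C r1 = E" "Cod C r2 = E"
    using is_pullbackD(4-8)[OF R] by simp_all
  note coeq = regular_epi_kernel_pair[OF g_reg R]
  have "p' \<cdot> (g \<cdot> r1) = p' \<cdot> (g \<cdot> r2)" by (simp add: is_pullbackD(9)[OF R])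
  then have pr: "p \<cdot> r2 = p \<cdot> r1" by (simp add: extend[OF pg])
  obtain t where t: "t \<in> Arr C" "Dom C t = B" "Cod C t = Dom C r1" "r1 \<cdot> t = s" "r2 \<cdot> t = s"
    by (rule pullback_lift[OF R, of s s]) simp_all
  note [simp] = t(1-3)
  obtain j where j: "is_kernel C j (p \<cdot> r1)" using kernel_exists[of "p \<cdot> r1"] by auto
  have [simp]: "j \<in> Arr C" "Cod C j = Dom C r1" using is_kernelD[OF j] by simp_all
  have prj: "p \<cdot> (r1 \<cdot> j) = \<zero> (Dom C j) B" using is_kernelD(4)[OF j] by simp
  have SR: "(Dom C j, Dom C r1, j, p \<cdot> r1, t) \<in> split_extensions C B"
    by (rule split_extensionsI[OF j]) (simp_all add: t(4))
  have "p \<cdot> (r2 \<cdot> j) = p \<cdot> (r1 \<cdot> j)" by (rule extend2[OF pr]) simp_all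
  then have prj2: "p \<cdot> (r2 \<cdot> j) = \<zero> (Dom C j) B" by (simp add: prj)
  obtain f1 where f1: "f1 \<in> Arr C" "Dom C f1 = Dom C j" "Cod C f1 = X" "k \<cdot> f1 = r1 \<cdot> j"
    by (rule kernel_lift[OF split_extensionsD(11)[OF S], of "r1 \<cdot> j"]) (simp_all add: prj)
  obtain f2 where f2: "f2 \<in> Arr C" "Dom C f2 = Dom C j" "Cod C f2 = X" "k \<cdot> f2 = r2 \<cdot> j"
    by (rule kernel_lift[OF split_extensionsD(11)[OF S], of "r2 \<cdot> j"]) (simp_all add: prj2)
  note [simp] = f1(1-3) f2(1-3)
  have "k' \<cdot> (f \<cdot> f1) = g \<cdot> (r1 \<cdot> j)" "k' \<cdot> (f \<cdot> f2) = g \<cdot> (r2 \<cdot> j)"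
    by (simp_all flip: f1(4) f2(4) add: extend2[OF gk])
  moreover have "g \<cdot> (r1 \<cdot> j) = g \<cdot> (r2 \<cdot> j)" by (rule extend2[OF is_pullbackD(9)[OF R]]) simp_all
  ultimately have "k' \<cdot> (f \<cdot> f1) = k' \<cdot> (f \<cdot> f2)" by simp
  then have ff: "f \<cdot> f1 = f \<cdot> f2" by (rule monicD[OF kmono']) simp_all
  let ?S = "(X, E, k, p, s)" and ?S' = "(X', E', k', p', s')" and ?R = "(Dom C j, Dom C r1, j, p \<cdot> r1, t)"
  let ?e = "(?S, (f, g), ?S')"
  have "is_coequalizer (SSE C B) (?R, (f1, r1), ?S) (?R, (f2, r2), ?S) ?e"
    unfolding is_coequalizer_def
  proof (intro conjI ballI impI)
    show "(?R, (f1, r1), ?S) \<in> Arr (SSE C B)"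
      using S SR by (simp add: SSE_Arr f1(4) t(4))
    show "(?R, (f2, r2), ?S) \<in> Hom (SSE C B) (Dom (SSE C B) (?R, (f1, r1), ?S)) (Cod (SSE C B) (?R, (f1, r1), ?S))"
      using S SR by (simp add: Hom_def[of "SSE C B"] SSE_simps SSE_Arr f2(4) t(5) pr)
    show "?e \<in> Arr (SSE C B)" using S S' by (simp add: SSE_Arr gk pg gs)
    show "Comp (SSE C B) ?e (?R, (f1, r1), ?S) = Comp (SSE C B) ?e (?R, (f2, r2), ?S)"
      by (simp add: SSE_simps ff is_pullbackD(9)[OF R])
    fix \<delta> assume \<delta>: "\<delta> \<in> Arr (SSE C B)" "Dom (SSE C B) \<delta> = Cod (SSE C B) (?R, (f1, r1), ?S) \<and>
      Comp (SSE C B) \<delta> (?R, (f1, r1), ?S) = Comp (SSE C B) \<delta> (?R, (f2, r2), ?S)"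
    obtain u v Y D i q z where uv: "\<delta> = (?S, (u, v), (Y, D, i, q, z))"
      using \<delta> by (auto elim!: SSE_ArrE simp: SSE_simps)
    have T: "(Y, D, i, q, z) \<in> split_extensions C B" and uv_arr: "u \<in> Hom C X Y" "v \<in> Hom C E D"
      and vk: "v \<cdot> k = i \<cdot> u" and qv: "q \<cdot> v = p" and vs: "v \<cdot> s = z"
      using \<delta>(1) unfolding uv SSE_Arr by blast+
    have vr: "v \<cdot> r1 = v \<cdot> r2" using \<delta>(2) by (simp add: uv SSE_simps)
    note [simp] = split_ext_simps[OF T]
    have [simp]: "u \<in> Arr C" "Dom C u = X" "Cod C u = Y" "v \<in> Arr C" "Dom C v = E" "Cod C v = D"
      using uv_arr by simp_all
    obtain v' where v': "v' \<in> Arr C" "Dom C v' = E'" "Cod C v' = D" "v' \<cdot> g = v"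
      by (rule coequalizer_factor[OF coeq, of v]) (simp_all add: vr)
    note [simp] = v'(1-3)
    have vg: "v' \<cdot> (g \<cdot> x) = v \<cdot> x" if "x \<in> Arr C" "Cod C x = E" for x
      by (rule extend[OF v'(4)]) (use that in simp_all)
    have "(q \<cdot> v') \<cdot> g = p' \<cdot> g" by (simp add: v'(4) qv pg)
    then have qv': "q \<cdot> v' = p'" by (rule regular_epi_epic[OF g_reg]) simp_all
    have "v' \<cdot> (g \<cdot> s) = z" by (simp only: vg split_ext_simps[OF S] vs)
    then have vs': "v' \<cdot> s' = z" by (simp add: gs)
    obtain u' where u': "u' \<in> Arr C" "Dom C u' = X'" "Cod C u' = Y" "i \<cdot> u' = v' \<cdot> k'"
      by (rule kernel_lift[OF split_extensionsD(11)[OF T], of "v' \<cdot> k'"]) (simp_all add: extend[OF qv'])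
    note [simp] = u'(1-3)
    have "i \<cdot> (u' \<cdot> f) = v' \<cdot> (k' \<cdot> f)" by (rule extend2[OF u'(4)]) simp_all
    also have "\<dots> = i \<cdot> u" by (simp flip: gk add: vg vk)
    finally have uf: "u' \<cdot> f = u" by (rule monicD[OF kernel_monic[OF split_extensionsD(11)[OF T]]]) simp_all
    have dc: "Cod (SSE C B) ?e = ?S'" "Cod (SSE C B) \<delta> = (Y, D, i, q, z)"
      by (simp_all add: uv SSE_simps)
    show "\<exists>!w. w \<in> Hom (SSE C B) (Cod (SSE C B) ?e) (Cod (SSE C B) \<delta>) \<and> Comp (SSE C B) w ?e = \<delta>"
      unfolding dc
    proof (rule ex1I[of _ "(?S', (u', v'), (Y, D, i, q, z))"])
      show "(?S', (u', v'), (Y, D, i, q, z)) \<in> Hom (SSE C B) ?S' (Y, D, i, q, z) \<and>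
          Comp (SSE C B) (?S', (u', v'), (Y, D, i, q, z)) ?e = \<delta>"
        using S' T by (simp add: Hom_def[of "SSE C B"] SSE_simps SSE_Arr u'(4) qv' vs' uf v'(4) uv)
      fix w assume w: "w \<in> Hom (SSE C B) ?S' (Y, D, i, q, z) \<and> Comp (SSE C B) w ?e = \<delta>"
      then obtain w1 w2 where w12: "w = (?S', (w1, w2), (Y, D, i, q, z))"
        by (auto simp: Hom_def[of "SSE C B"] SSE_simps elim!: SSE_ArrE)
      have "w \<in> Arr (SSE C B)" using w by (simp add: Hom_def[of "SSE C B"])
      then have [simp]: "w1 \<in> Arr C" "Dom C w1 = X'" "Cod C w1 = Y" "w2 \<in> Arr C" "Dom C w2 = E'" "Cod C w2 = D"
        unfolding w12 SSE_Arr by simp_all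
      have wf: "w1 \<cdot> f = u' \<cdot> f" and wg: "w2 \<cdot> g = v' \<cdot> g"
        using w by (simp_all add: w12 uv SSE_simps uf v'(4))
      have "w1 = u'" by (rule regular_epi_epic[OF f_reg wf]) simp_all
      moreover have "w2 = v'" by (rule regular_epi_epic[OF g_reg wg]) simp_all
      ultimately show "w = (?S', (u', v'), (Y, D, i, q, z))" by (simp add: w12)
    qed
  qed (simp_all add: SSE_simps)
  then show ?thesis unfolding regular_epi_def by blast
qed


section \<open>Lifting along regular epimorphisms of crossed modules\<close>

lemma pullback_split_extension:
  assumes S: "(X, E, k, p, s) \<in> split_extensions C A" and g: "g \<in> Hom C P A"
  obtains D e q l t where "is_pullback C p g e q" "(X, D, l, q, t) \<in> split_extensions C P"
    "e \<in> Hom C D E" "e \<cdot> l = k" "e \<cdot> t = s \<cdot> g"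
proof -
  note [simp] = split_ext_simps[OF S]
  have [simp]: "g \<in> Arr C" "Dom C g = P" "Cod C g = A" "P \<in> Obj C" using g Hom_Obj[OF g] by simp_all
  obtain e q where Q: "is_pullback C p g e q" using pullback_exists[of p g] by auto
  have [simp]: "e \<in> Arr C" "q \<in> Arr C" "Dom C q = Dom C e" "Cod C e = E" "Cod C q = P"
    using is_pullbackD(4-8)[OF Q] by simp_all
  obtain l where l: "l \<in> Arr C" "Dom C l = X" "Cod C l = Dom C e" "e \<cdot> l = k" "q \<cdot> l = \<zero> X P"
    by (rule pullback_lift[OF Q, of k "\<zero> X P"]) simp_all
  obtain t where t: "t \<in> Arr C" "Dom C t = P" "Cod C t = Dom C e" "e \<cdot> t = s \<cdot> g" "q \<cdot> t = \<one>P"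
    by (rule pullback_lift[OF Q, of "s \<cdot> g" "\<one>P"])
      (simp_all add: extend[OF split_ext_simps(10)[OF S]])
  note [simp] = l(1-3) t(1-3)
  have "is_kernel C l q"
  proof (rule is_kernelI)
    show "monic C l"
      by (rule monic_right_factor[of e]) (simp_all add: l(4) kernel_monic[OF split_extensionsD(11)[OF S]])
    fix x assume x: "x \<in> Arr C" "Cod C x = Dom C q" "q \<cdot> x = \<zero> (Dom C x) (Cod C q)"
    have "p \<cdot> (e \<cdot> x) = g \<cdot> (q \<cdot> x)"
      by (rule extend2[OF is_pullbackD(9)[OF Q]]) (use x in simp_all)
    then have pex: "p \<cdot> (e \<cdot> x) = \<zero> (Dom C x) A" using x by simp
    obtain u where u: "u \<in> Arr C" "Dom C u = Dom C x" "Cod C u = X" "k \<cdot> u = e \<cdot> x"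
      by (rule kernel_lift[OF split_extensionsD(11)[OF S], of "e \<cdot> x"]) (use x pex in simp_all)
    have "l \<cdot> u = x"
      by (rule pullback_ext[OF Q]) (use x u in \<open>simp_all add: extend[OF l(4)] extend[OF l(5)]\<close>)
    then show "\<exists>u \<in> Arr C. Dom C u = Dom C x \<and> Cod C u = Dom C l \<and> l \<cdot> u = x"
      using u by (intro bexI[of _ u]) simp_all
  qed (simp_all add: l(5))
  then have "(X, Dom C e, l, q, t) \<in> split_extensions C P"
    by (rule split_extensionsI) (simp_all add: t(5))
  then show thesis by (rule that[OF Q]) (simp_all add: l(4) t(4))
qed

lemma kernel_core_restrict:
  assumes S: "(Q, Z, d, p, s) \<in> split_extensions C P"
  shows "d \<cdot> (kernel_core C d \<cdot> cosmash_map C s (\<one>Q)) = cotuple C s d \<cdot> h\<^sub>2 C P Q"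
proof -
  note [simp] = split_ext_simps[OF S] kernel_core_props(1-3)[OF split_extensionsD(11)[OF S]]
  have d\<chi>: "d \<cdot> kernel_core C d = cotuple C (\<one>Z) d \<cdot> h\<^sub>2 C Z Q"
    using kernel_core_props(4)[OF split_extensionsD(11)[OF S]] by simp
  show ?thesis by (simp add: extend[OF d\<chi>]) (simp add: coprod_map_def)
qed

text \<open>If crossed modules are viewed as internal categories, then \<open>p\<close> is the domain arrow of the object \<open>E\<close> of
  arrows, and \<open>c\<close> is the codomain arrow. It exists by the first axiom of crossed modules.\<close>

lemma crossed_module_universal:
  assumes M: "(X, A, \<psi>, d) \<in> crossed_modules C"
    and S: "(X, E, k, p, s) \<in> split_extensions C A" and k\<psi>: "k \<cdot> \<psi> = cotuple C s k \<cdot> h\<^sub>2 C A X"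
  obtains c where "c \<in> Hom C E A" "c \<cdot> s = \<one>A" "c \<cdot> k = d"
proof -
  note [simp] = crossed_modulesD(1-8)[OF M]
  have eq: "cotuple C (\<one>A) d \<cdot> h\<^sub>2 C A X = d \<cdot> \<psi>"
    using crossed_modulesD(9)[OF M] by (simp add: conjugation_core_cosmash_map)
  obtain c where "c \<in> Arr C" "Dom C c = E" "Cod C c = A" "c \<cdot> s = \<one>A" "c \<cdot> k = d"
    by (rule action_core_universal[OF S _ k\<psi> _ _ eq, where T = A]) simp_all
  then show thesis using that by simp
qed

text \<open>Equivariance over \<open>P\<close> extends to \<open>Z\<close>. It suffices to compare the two arrows on \<open>(P \<oplus> Q) \<diamond> Q\<close>, which covers
  \<open>Z \<diamond> Q\<close>, and by \<open>cosmash_coprod_ext\<close> on three pieces. On \<open>P \<diamond> Q\<close> they agree by hypothesis, on \<open>Q \<diamond> Q\<close> by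
  the second axiom for both crossed modules. On the threefold cosmash product both arrows
  factor through the action of \<open>P\<close> and \<open>S\<^sub>1\<^sub>2\<close>, the first because \<open>Q\<close> acts on itself by conjugation in \<open>Z\<close>,
  the second by the third axiom, and the hypothesis applies again.\<close>

lemma equivariance_extension:
  assumes S: "(Q, Z, d, p, s) \<in> split_extensions C P"
    and M: "(X, A, \<psi>, \<tau>) \<in> crossed_modules C"
    and f: "f \<in> Hom C Q X" and g: "g \<in> Hom C Z A" and gd: "g \<cdot> d = \<tau> \<cdot> f"
    and equivariant: "f \<cdot> (kernel_core C d \<cdot> cosmash_map C s (\<one>Q)) = \<psi> \<cdot> cosmash_map C (g \<cdot> s) f"
  shows "f \<cdot> kernel_core C d = \<psi> \<cdot> cosmash_map C g f"
proof -
  let ?\<chi> = "kernel_core C d"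
  note dker = split_extensionsD(11)[OF S]
  note [simp] = split_ext_simps[OF S] crossed_modulesD(1-8)[OF M] kernel_core_props(1-3)[OF dker]
  have [simp]: "f \<in> Arr C" "Dom C f = Q" "Cod C f = X" "g \<in> Arr C" "Dom C g = Z" "Cod C g = A"
    using f g by simp_all
  have d\<chi>: "d \<cdot> ?\<chi> = cotuple C (\<one>Z) d \<cdot> h\<^sub>2 C Z Q"
    using kernel_core_props(4)[OF dker] by simp
  have K: "(Q, Z, ?\<chi>, d) \<in> crossed_modules C" using kernel_crossed_module[OF dker] by simp
  define r where "r = cotuple C s d"
  have r_reg: "regular_epi C r" unfolding r_def by (rule split_extension_cotuple_regular_epi[OF S])
  have [simp]: "r \<in> Arr C" "Dom C r = P \<oplus> Q" "Cod C r = Z" by (simp_all add: r_def)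
  obtain \<theta> where \<theta>: "\<theta> \<in> Arr C" "Dom C \<theta> = cosmash3 C P Q Q" "Cod C \<theta> = (P \<oplus> Q) \<diamond> Q"
      "h\<^sub>2 C (P \<oplus> Q) Q \<cdot> \<theta> = h\<^sub>3 C P Q Q"
  proof (rule h\<^sub>2_lift[of "P \<oplus> Q" Q "h\<^sub>3 C P Q Q"])
    show "cotuple C (\<one>(P \<oplus> Q)) (\<zero> Q (P \<oplus> Q)) \<cdot> h\<^sub>3 C P Q Q = \<zero> (Dom C (h\<^sub>3 C P Q Q)) (P \<oplus> Q)"
      using h\<^sub>3_zero(1)[of P Q Q] by simp
    have "cotuple C (cotuple C (\<zero> P Q) (\<zero> Q Q)) (\<one>Q) \<cdot> h\<^sub>3 C P Q Q = \<zero> (cosmash3 C P Q Q) Q"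
      by (rule cotuple_zero_h\<^sub>3(2)) simp_all
    moreover have "cotuple C (\<zero> P Q) (\<zero> Q Q) = \<zero> (P \<oplus> Q) Q"
      by (rule coprod_ext[of _ _ P Q]) simp_all
    ultimately show "cotuple C (\<zero> (P \<oplus> Q) Q) (\<one>Q) \<cdot> h\<^sub>3 C P Q Q = \<zero> (Dom C (h\<^sub>3 C P Q Q)) Q" by simp
  qed simp_all
  note [simp] = \<theta>(1-3)
  have r_in: "r \<cdot> in\<^sub>1 C P Q = s" "r \<cdot> in\<^sub>2 C P Q = d" by (simp_all add: r_def)
  have "(f \<cdot> ?\<chi>) \<cdot> cosmash_map C r (\<one>Q) = (\<psi> \<cdot> cosmash_map C g f) \<cdot> cosmash_map C r (\<one>Q)"
  proof (rule cosmash_coprod_ext[where a = P and y = Q and x = Q and \<theta> = \<theta>])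
    show "((f \<cdot> ?\<chi>) \<cdot> cosmash_map C r (\<one>Q)) \<cdot> cosmash_map C (in\<^sub>1 C P Q) (\<one>Q) =
        ((\<psi> \<cdot> cosmash_map C g f) \<cdot> cosmash_map C r (\<one>Q)) \<cdot> cosmash_map C (in\<^sub>1 C P Q) (\<one>Q)"
      by (simp add: r_in equivariant)
    have "f \<cdot> (?\<chi> \<cdot> cosmash_map C d (\<one>Q)) = conjugation_core C X \<cdot> cosmash_map C f f"
      using crossed_modulesD(10)[OF K] by (simp add: conjugation_core_natural)
    also have "\<dots> = \<psi> \<cdot> (cosmash_map C \<tau> (\<one>X) \<cdot> cosmash_map C f f)"
      by (rule extend[OF crossed_modulesD(10)[OF M], symmetric]) simp_all
    finally show "((f \<cdot> ?\<chi>) \<cdot> cosmash_map C r (\<one>Q)) \<cdot> cosmash_map C (in\<^sub>2 C P Q) (\<one>Q) =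
        ((\<psi> \<cdot> cosmash_map C g f) \<cdot> cosmash_map C r (\<one>Q)) \<cdot> cosmash_map C (in\<^sub>2 C P Q) (\<one>Q)"
      by (simp add: r_in gd)
    \<comment> \<open>On the threefold cosmash product the conjugation action of \<open>P \<oplus> Q\<close> is that of \<open>P\<close> after \<open>S\<^sub>1\<^sub>2\<close>.\<close>
    have "d \<cdot> (?\<chi> \<cdot> (cosmash_map C r (\<one>Q) \<cdot> \<theta>)) = d \<cdot> (?\<chi> \<cdot> (cosmash_map C s (\<one>Q) \<cdot> S\<^sub>1\<^sub>2 C P Q))"
      by (simp add: extend[OF d\<chi>]) (simp add: coprod_map_def cotuple3_def \<theta>(4) r_def)
    then have "?\<chi> \<cdot> (cosmash_map C r (\<one>Q) \<cdot> \<theta>) = ?\<chi> \<cdot> (cosmash_map C s (\<one>Q) \<cdot> S\<^sub>1\<^sub>2 C P Q)"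
      by (rule monicD[OF kernel_monic[OF dker]]) simp_all
    then have "f \<cdot> (?\<chi> \<cdot> (cosmash_map C r (\<one>Q) \<cdot> \<theta>)) =
        (f \<cdot> (?\<chi> \<cdot> cosmash_map C s (\<one>Q))) \<cdot> S\<^sub>1\<^sub>2 C P Q"
      by simp
    also have "\<dots> = \<psi> \<cdot> (S\<^sub>1\<^sub>2 C A X \<cdot> cosmash_map3 C (g \<cdot> s) f f)"
      unfolding equivariant by (simp add: S\<^sub>1\<^sub>2_natural[of "g \<cdot> s" f P Q A X])
    \<comment> \<open>The third axiom of crossed modules; it moves the middle variable from \<open>X\<close> to \<open>A\<close>.\<close>
    also have "\<dots> = (\<psi> \<cdot> S\<^sub>2\<^sub>1 C A X \<cdot> cosmash_map3 C (\<one>A) \<tau> (\<one>X)) \<cdot> cosmash_map3 C (g \<cdot> s) f f"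
      by (rule extend[OF crossed_modulesD(11)[OF M]]) simp_all
    also have "\<dots> = \<psi> \<cdot> (S\<^sub>2\<^sub>1 C A X \<cdot> cosmash_map3 C (g \<cdot> s) (g \<cdot> d) f)"
      by (simp add: cosmash_map3_Comp gd)
    also have "S\<^sub>2\<^sub>1 C A X \<cdot> cosmash_map3 C (g \<cdot> s) (g \<cdot> d) f = cosmash_map C (g \<cdot> r) f \<cdot> \<theta>"
      by (rule h\<^sub>2_cancel[of A X])
        (simp_all add: \<theta>(4) coprod_map_def coprod_map3_def, simp_all add: r_def)
    finally show "((f \<cdot> ?\<chi>) \<cdot> cosmash_map C r (\<one>Q)) \<cdot> \<theta> =
        ((\<psi> \<cdot> cosmash_map C g f) \<cdot> cosmash_map C r (\<one>Q)) \<cdot> \<theta>"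
      by simp
  qed (simp_all add: \<theta>(4))
  then show ?thesis
    by (rule regular_epi_epic[OF cosmash_map_regular_epi[OF r_reg split_ext_simps(11)[OF S]]]) simp_all
qed

text \<open>The arrow \<open>g1\<close> is the kernel component of a lift in the category of split extensions over \<open>P\<close>, and \<open>g2\<close>
  is the middle component of that lift followed by the pullback projection \<open>b\<close> and the codomain arrow \<open>c\<close>.\<close>

lemma crossed_module_lift:
  assumes P: "projective C P"
    and S: "(Q, Z, d', p, s) \<in> split_extensions C P"
    and SP: "projective (SSE C P) (Q, Z, d', p, s)"
    and M: "(X, A, \<psi>, \<tau>) \<in> crossed_modules C" and M': "(X', A', \<psi>', \<tau>') \<in> crossed_modules C"
    and e: "regular_epi C e1" "e1 \<in> Hom C X X'" "regular_epi C e2" "e2 \<in> Hom C A A'"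
      "e2 \<cdot> \<tau> = \<tau>' \<cdot> e1" "e1 \<cdot> \<psi> = \<psi>' \<cdot> cosmash_map C e2 e1"
    and f: "f1 \<in> Hom C Q X'" "f2 \<in> Hom C Z A'" "f2 \<cdot> d' = \<tau>' \<cdot> f1"
      "f1 \<cdot> kernel_core C d' = \<psi>' \<cdot> cosmash_map C f2 f1"
  obtains g1 g2 where "g1 \<in> Hom C Q X" "g2 \<in> Hom C Z A" "g2 \<cdot> d' = \<tau> \<cdot> g1"
    "g1 \<cdot> kernel_core C d' = \<psi> \<cdot> cosmash_map C g2 g1" "e1 \<cdot> g1 = f1" "e2 \<cdot> g2 = f2"
proof -
  let ?\<chi> = "kernel_core C d'"
  note [simp] = split_ext_simps[OF S] crossed_modulesD(1-8)[OF M] crossed_modulesD(1-8)[OF M']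
    kernel_core_props(1-3)[OF split_extensionsD(11)[OF S]]
  have [simp]: "e1 \<in> Arr C" "Dom C e1 = X" "Cod C e1 = X'" "e2 \<in> Arr C" "Dom C e2 = A" "Cod C e2 = A'"
      "f1 \<in> Arr C" "Dom C f1 = Q" "Cod C f1 = X'" "f2 \<in> Arr C" "Dom C f2 = Z" "Cod C f2 = A'"
    using e(2,4) f(1,2) by simp_all
  obtain g0 where "g0 \<in> Hom C P (Dom C e2)" and eg0: "e2 \<cdot> g0 = f2 \<cdot> s"
    using P e(3) unfolding projective_def by (metis in_Hom Comp_typing \<open>Cod C e2 = A'\<close>
      \<open>f2 \<in> Arr C\<close> \<open>Dom C f2 = Z\<close> \<open>Cod C f2 = A'\<close> split_ext_simps(7-9)[OF S])
  then have [simp]: "g0 \<in> Arr C" "Dom C g0 = P" "Cod C g0 = A" by simp_all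
  obtain E k q t where T: "(X, E, k, q, t) \<in> split_extensions C A"
    and k\<psi>: "k \<cdot> \<psi> = cotuple C t k \<cdot> h\<^sub>2 C A X" by (rule crossed_module_core[OF M])
  obtain E' k' q' t' where T': "(X', E', k', q', t') \<in> split_extensions C A'"
    and k\<psi>': "k' \<cdot> \<psi>' = cotuple C t' k' \<cdot> h\<^sub>2 C A' X'" by (rule crossed_module_core[OF M'])
  note [simp] = split_ext_simps[OF T] split_ext_simps[OF T']
  \<comment> \<open>The induced arrow of semidirect products.\<close>
  obtain \<epsilon> where \<epsilon>: "\<epsilon> \<in> Arr C" "Dom C \<epsilon> = E" "Cod C \<epsilon> = E'" "\<epsilon> \<cdot> k = k' \<cdot> e1" "\<epsilon> \<cdot> t = t' \<cdot> e2"
      "q' \<cdot> \<epsilon> = e2 \<cdot> q"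
    by (rule core_morphism[OF T _ k\<psi> T' _ k\<psi>' e(2,4,6)]) simp_all
  note [simp] = \<epsilon>(1-3)
  \<comment> \<open>The restrictions of the two actions to \<open>P\<close>, as split extensions over \<open>P\<close>.\<close>
  obtain D b u l v where Pb: "is_pullback C q g0 b u" and U: "(X, D, l, u, v) \<in> split_extensions C P"
    and "b \<in> Hom C D E" and bl: "b \<cdot> l = k" and bv: "b \<cdot> v = t \<cdot> g0"
    by (rule pullback_split_extension[OF T, of g0 P]) simp_all
  then have [simp]: "b \<in> Arr C" "Dom C b = D" "Cod C b = E" by simp_all
  obtain D' b' u' l' v' where Pb': "is_pullback C q' (f2 \<cdot> s) b' u'"
    and U': "(X', D', l', u', v') \<in> split_extensions C P"
    and "b' \<in> Hom C D' E'" and bl': "b' \<cdot> l' = k'" and bv': "b' \<cdot> v' = t' \<cdot> (f2 \<cdot> s)"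
    by (rule pullback_split_extension[OF T', of "f2 \<cdot> s" P]) simp_all
  then have [simp]: "b' \<in> Arr C" "Dom C b' = D'" "Cod C b' = E'" by simp_all
  note [simp] = split_ext_simps[OF U] split_ext_simps[OF U']
  have qb: "q \<cdot> b = g0 \<cdot> u" by (rule is_pullbackD(9)[OF Pb])
  have "q' \<cdot> (\<epsilon> \<cdot> b) = e2 \<cdot> (q \<cdot> b)" by (rule extend2[OF \<epsilon>(6)]) simp_all
  also have "\<dots> = f2 \<cdot> (s \<cdot> u)" by (simp add: qb extend[OF eg0])
  finally have q\<epsilon>b: "q' \<cdot> (\<epsilon> \<cdot> b) = f2 \<cdot> (s \<cdot> u)" .
  obtain \<delta> where \<delta>: "\<delta> \<in> Arr C" "Dom C \<delta> = D" "Cod C \<delta> = D'" "b' \<cdot> \<delta> = \<epsilon> \<cdot> b" "u' \<cdot> \<delta> = u"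
    by (rule pullback_lift[OF Pb', of "\<epsilon> \<cdot> b" u]) (simp_all add: q\<epsilon>b)
  note [simp] = \<delta>(1-3)
  have \<delta>l: "\<delta> \<cdot> l = l' \<cdot> e1"
    by (rule pullback_ext[OF Pb'])
      (simp_all add: extend2[OF \<delta>(4)] extend[OF \<delta>(5)] bl extend[OF bl'] \<epsilon>(4)
        extend[OF split_extension_zero[OF U']])
  have \<delta>v: "\<delta> \<cdot> v = v'"
    by (rule pullback_ext[OF Pb'])
      (simp_all add: extend2[OF \<delta>(4)] extend[OF \<delta>(5)] bv bv' extend2[OF \<epsilon>(5)] eg0)
  have reg: "regular_epi (SSE C P) ((X, D, l, u, v), (e1, \<delta>), (X', D', l', u', v'))"
    by (rule regular_epi_SSE[OF U U' _ _ \<delta>l \<delta>(5) \<delta>v e(1)]) simp_all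
  \<comment> \<open>The restriction of \<open>(f1, f2)\<close> along \<open>s\<close> is equivariant over \<open>P\<close>, which gives an arrow \<open>\<omega>\<close> of split
    extensions over \<open>P\<close>, to be lifted along \<open>\<delta>\<close>.\<close>
  have "f1 \<cdot> (?\<chi> \<cdot> cosmash_map C s (\<one>Q)) = \<psi>' \<cdot> cosmash_map C (f2 \<cdot> s) f1"
    by (simp add: extend2[OF f(4)])
  then obtain w where w: "w \<in> Arr C" "Dom C w = Z" "Cod C w = E'" "w \<cdot> d' = k' \<cdot> f1"
      "w \<cdot> s = t' \<cdot> (f2 \<cdot> s)" "q' \<cdot> w = (f2 \<cdot> s) \<cdot> p"
    by (rule core_morphism[OF S _ kernel_core_restrict[OF S] T' _ k\<psi>', rotated -2]) simp_all
  note [simp] = w(1-3)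
  obtain \<omega> where \<omega>: "\<omega> \<in> Arr C" "Dom C \<omega> = Z" "Cod C \<omega> = D'" "b' \<cdot> \<omega> = w" "u' \<cdot> \<omega> = p"
    by (rule pullback_lift[OF Pb', of w p]) (simp_all add: w(6))
  note [simp] = \<omega>(1-3)
  have \<omega>d: "\<omega> \<cdot> d' = l' \<cdot> f1"
    by (rule pullback_ext[OF Pb'])
      (simp_all add: extend[OF \<omega>(4)] extend[OF \<omega>(5)] w(4) extend[OF bl']
        extend[OF split_extension_zero[OF U']])
  have \<omega>s: "\<omega> \<cdot> s = v'"
    by (rule pullback_ext[OF Pb']) (simp_all add: extend[OF \<omega>(4)] extend[OF \<omega>(5)] w(5) bv')
  have "((Q, Z, d', p, s), (f1, \<omega>), (X', D', l', u', v')) \<in>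
      Hom (SSE C P) (Q, Z, d', p, s) (Cod (SSE C P) ((X, D, l, u, v), (e1, \<delta>), (X', D', l', u', v')))"
    using S U' by (simp add: Hom_def[of "SSE C P"] SSE_simps SSE_Arr \<omega>d \<omega>s \<omega>(5))
  then obtain \<gamma>' where \<gamma>': "\<gamma>' \<in> Hom (SSE C P) (Q, Z, d', p, s) (X, D, l, u, v)"
    "Comp (SSE C P) ((X, D, l, u, v), (e1, \<delta>), (X', D', l', u', v')) \<gamma>' =
      ((Q, Z, d', p, s), (f1, \<omega>), (X', D', l', u', v'))"
    using SP reg unfolding projective_def by (metis SSE_simps(2))
  then obtain g1 \<gamma> where \<gamma>'_eq: "\<gamma>' = ((Q, Z, d', p, s), (g1, \<gamma>), (X, D, l, u, v))"
    by (auto simp: Hom_def[of "SSE C P"] SSE_simps elim!: SSE_ArrE)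
  have "\<gamma>' \<in> Arr (SSE C P)" using \<gamma>'(1) by (simp add: Hom_def[of "SSE C P"])
  then have [simp]: "g1 \<in> Arr C" "Dom C g1 = Q" "Cod C g1 = X" "\<gamma> \<in> Arr C" "Dom C \<gamma> = Z" "Cod C \<gamma> = D"
    and \<gamma>: "\<gamma> \<cdot> d' = l \<cdot> g1" "u \<cdot> \<gamma> = p" "\<gamma> \<cdot> s = v"
    unfolding \<gamma>'_eq SSE_Arr by simp_all
  have eg1: "e1 \<cdot> g1 = f1" using \<gamma>'(2) by (simp add: \<gamma>'_eq SSE_simps)
  obtain c where "c \<in> Hom C E A" and ct: "c \<cdot> t = \<one>A" and ck: "c \<cdot> k = \<tau>"
    by (rule crossed_module_universal[OF M T k\<psi>])
  then have [simp]: "c \<in> Arr C" "Dom C c = E" "Cod C c = A" by simp_all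
  define g2 where "g2 = c \<cdot> (b \<cdot> \<gamma>)"
  have [simp]: "g2 \<in> Arr C" "Dom C g2 = Z" "Cod C g2 = A" by (simp_all add: g2_def)
  have b\<gamma>d: "b \<cdot> (\<gamma> \<cdot> d') = k \<cdot> g1" by (simp add: \<gamma>(1) extend[OF bl])
  have b\<gamma>s: "b \<cdot> (\<gamma> \<cdot> s) = t \<cdot> g0" by (simp add: \<gamma>(3) bv)
  have g2d: "g2 \<cdot> d' = \<tau> \<cdot> g1" by (simp add: g2_def b\<gamma>d extend[OF ck])
  have g2s: "g2 \<cdot> s = g0" by (simp add: g2_def b\<gamma>s extend[OF ct])
  have eg2: "e2 \<cdot> g2 = f2"
  proof (rule split_extension_ext[OF S])
    have "e2 \<cdot> (\<tau> \<cdot> g1) = \<tau>' \<cdot> (e1 \<cdot> g1)" by (rule extend2[OF e(5)]) simp_all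
    then show "(e2 \<cdot> g2) \<cdot> d' = f2 \<cdot> d'" by (simp add: g2d eg1 f(3))
  qed (simp_all add: g2s eg0)
  \<comment> \<open>Equivariance over \<open>P\<close>, from the lift \<open>\<gamma>\<close> being a morphism of split extensions.\<close>
  have "k \<cdot> (g1 \<cdot> (?\<chi> \<cdot> cosmash_map C s (\<one>Q))) =
      b \<cdot> (\<gamma> \<cdot> (d' \<cdot> (?\<chi> \<cdot> cosmash_map C s (\<one>Q))))"
    by (simp add: extend2[OF \<gamma>(1)] extend[OF bl])
  also have "\<dots> = cotuple C (t \<cdot> g0) (k \<cdot> g1) \<cdot> h\<^sub>2 C P Q"
    unfolding kernel_core_restrict[OF S] by (simp add: b\<gamma>d b\<gamma>s)
  also have "\<dots> = k \<cdot> (\<psi> \<cdot> cosmash_map C (g2 \<cdot> s) g1)"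
    by (simp add: g2s extend[OF k\<psi>]) (simp add: coprod_map_def)
  finally have "g1 \<cdot> (?\<chi> \<cdot> cosmash_map C s (\<one>Q)) = \<psi> \<cdot> cosmash_map C (g2 \<cdot> s) g1"
    by (rule monicD[OF kernel_monic[OF split_extensionsD(11)[OF T]]]) (simp_all add: g2s)
  then have "g1 \<cdot> ?\<chi> = \<psi> \<cdot> cosmash_map C g2 g1"
    by (intro equivariance_extension[OF S M _ _ g2d]) simp_all
  then show thesis
    by (intro that[of g1 g2]) (simp_all add: g2d eg1 eg2)
qed

lemma kernel_projective_XMod:
  assumes P: "projective C P"
    and S: "(Q, Z, d', p, s) \<in> split_extensions C P"
    and SP: "projective (SSE C P) (Q, Z, d', p, s)"
  shows "projective (XMod C) (Q, Z, kernel_core C d', d')"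
  unfolding projective_def
proof (intro conjI allI impI)
  have K: "(Q, Z, kernel_core C d', d') \<in> crossed_modules C"
    using kernel_crossed_module[OF split_extensionsD(11)[OF S]] split_extensionsD[OF S] by simp
  then show "(Q, Z, kernel_core C d', d') \<in> Obj (XMod C)" by (simp add: XMod_simps)
  fix e f
  assume ef: "regular_epi (XMod C) e \<and> f \<in> Hom (XMod C) (Q, Z, kernel_core C d', d') (Cod (XMod C) e)"
  then have "e \<in> Arr (XMod C)" by (auto simp: regular_epi_def is_coequalizer_def)
  then obtain X A \<psi> d e1 e2 X' A' \<psi>' d'' where e: "e = ((X, A, \<psi>, d), (e1, e2), (X', A', \<psi>', d''))"
    by (rule XMod_ArrE)
  obtain f1 f2 where f: "f = ((Q, Z, kernel_core C d', d'), (f1, f2), (X', A', \<psi>', d''))"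
    using ef by (auto simp: e Hom_def[of "XMod C"] XMod_simps elim!: XMod_ArrE)
  have reg: "regular_epi C e1" "regular_epi C e2"
    using regular_epi_XMod ef unfolding e by blast+
  have e_arr: "(X, A, \<psi>, d) \<in> crossed_modules C" "(X', A', \<psi>', d'') \<in> crossed_modules C"
    "e1 \<in> Hom C X X'" "e2 \<in> Hom C A A'" "e2 \<cdot> d = d'' \<cdot> e1" "e1 \<cdot> \<psi> = \<psi>' \<cdot> cosmash_map C e2 e1"
    using \<open>e \<in> Arr (XMod C)\<close> unfolding e XMod_Arr by blast+
  have "f \<in> Arr (XMod C)" using ef by (simp add: Hom_def[of "XMod C"])
  then have f_arr: "f1 \<in> Hom C Q X'" "f2 \<in> Hom C Z A'" "f2 \<cdot> d' = d'' \<cdot> f1"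
    "f1 \<cdot> kernel_core C d' = \<psi>' \<cdot> cosmash_map C f2 f1"
    unfolding f XMod_Arr by blast+
  obtain g1 g2 where g: "g1 \<in> Hom C Q X" "g2 \<in> Hom C Z A" "g2 \<cdot> d' = d \<cdot> g1"
    "g1 \<cdot> kernel_core C d' = \<psi> \<cdot> cosmash_map C g2 g1" "e1 \<cdot> g1 = f1" "e2 \<cdot> g2 = f2"
    by (rule crossed_module_lift[OF P S SP e_arr(1,2) reg(1) e_arr(3) reg(2) e_arr(4-6) f_arr])
  let ?g = "((Q, Z, kernel_core C d', d'), (g1, g2), (X, A, \<psi>, d))"
  have "?g \<in> Hom (XMod C) (Q, Z, kernel_core C d', d') (Dom (XMod C) e)"
    unfolding Hom_def[of "XMod C"] using K e_arr(1) g(1-4) by (simp add: e XMod_simps XMod_Arr)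
  moreover have "Comp (XMod C) e ?g = f"
    by (simp add: e f XMod_simps g)
  ultimately show "\<exists>g \<in> Hom (XMod C) (Q, Z, kernel_core C d', d') (Dom (XMod C) e). Comp (XMod C) e g = f"
    by blast
qed

end

theorem theorem3p2p2:
  fixes C :: "('o, 'm) cat"
    and P Q Z :: 'o
    and d' p s :: 'm
  assumes "semi_abelian C"
    and "projective C P"
    and "(Q, Z, d', p, s) \<in> split_extensions C P"
    and "projective (SSE C P) (Q, Z, d', p, s)"
  shows "projective (XMod C) (Q, Z, kernel_core C d', d')"
  using assms by (rule semi_abelian.kernel_projective_XMod)

end
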